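(* Let $\Omega\subset\mathbb{R}^2$ and $p\in(2,\infty]$ be as in the context, and let $k>0$, $f\in\overline{H^1(\Omega)}'$ and $q\in L^p(\Omega;[-1,\infty))$. Then $u\in H^1(\Omega)$ is the unique solution of $$u-k^2\mathcal V_q u=(\mathcal S-k^2\mathcal M_1-\imath k\mathcal B)^{-1}f\quad\text{in } H^1(\Omega)$$ if and only if $u$ is the unique solution of $$(\mathcal S-k^2\mathcal M_{1+q}-\imath k\mathcal B)u=f\quad\text{in }\overline{H^1(\Omega)}'.$$
   Context: Function spaces are spaces of complex-valued functions unless a range is indicated; $H^s(\Omega)$ are Sobolev spaces, $\imath$ is the imaginary unit, and $\overline{H^1(\Omega)}'$ is the anti-dual of $H^1(\Omega)$ (bounded antilinear functionals), with action denoted $\langle f,\phi\rangle$. $\Omega\subset\mathbb{R}^2$ is a bounded domain that is sufficiently smooth, at least $C^1$, so that the embedding $id_{H^2\to H^1}:H^2(\Omega)\hookrightarrow H^1(\Omega)$ is compact. "Sufficiently smooth" includes that the following regularity holds: there is $C>0$ such that for every $k>0$ and $g\in L^2(\Omega)$ the unique weak solution $w\in H^1(\Omega)$ of $(-\Delta-k^2)w=g$ in $\Omega$, $(\partial_n-\imath k)w=0$ on $\partial\Omega$ lies in $H^2(\Omega)$ and satisfies $\|w\|_{H^2(\Omega)}\le C(k+1+\frac1k+\frac1{k^2})\|g\|_{L^2(\Omega)}$. The exponent $p\in(2,\infty]$ is fixed. The operators $\mathcal S,\mathcal B,\mathcal M_m:H^1(\Omega)\to\overline{H^1(\Omega)}'$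 are defined by $\langle\mathcal S y,\phi\rangle=(\nabla y,\nabla\phi)_{L^2(\Omega;\mathbb{C}^2)}$, $\langle\mathcal B y,\phi\rangle=(y,\phi)_{L^2(\partial\Omega)}$ (traces), $\langle\mathcal M_m y,\phi\rangle=(my,\phi)_{L^2(\Omega)}=\int_\Omega m y\overline{\phi}\,dx$, for $m=1$, $m=q$, $m=1+q$. The operator $\mathcal S-k^2\mathcal M_1-\imath k\mathcal B:H^1(\Omega)\to\overline{H^1(\Omega)}'$ is known to be bijective with bounded inverse. The operator $\widetilde{\mathcal V_q}:=(\mathcal S-k^2\mathcal M_1-\imath k\mathcal B)^{-1}\mathcal M_q$ on $H^1(\Omega)$ takes values in $H^2(\Omega)$, and $\mathcal V_q:=id_{H^2\to H^1}\circ\widetilde{\mathcal V_q}:H^1(\Omega)\to H^1(\Omega)$. *)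

theory Defs
  imports "HOL-Analysis.Analysis"
begin

section \<open>Arc length measure\<close>

text \<open>One-dimensional Hausdorff measure. For exponent 1 the normalising constant is 1, so on a
  $C^1$ curve this is arc length.  Boundedness is required because \<^const>\<open>diameter\<close> is
  unspecified on unbounded sets.\<close>

definition hausdorff1_pre :: "real \<Rightarrow> 'a::metric_space set \<Rightarrow> ennreal" where
  "hausdorff1_pre \<delta> A =
     (INF U\<in>{U::nat \<Rightarrow> 'a set. A \<subseteq> (\<Union>n. U n) \<and> (\<forall>n. bounded (U n) \<and> diameter (U n) \<le> \<delta>)}.
        \<Sum>n. ennreal (diameter (U n)))"

definition hausdorff1_outer :: "'a::metric_space set \<Rightarrow> ennreal" where
  "hausdorff1_outer A = (SUP \<delta>\<in>{0<..}. hausdorff1_pre \<delta> A)"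

definition hausdorff1 :: "'a::metric_space measure" where
  "hausdorff1 = measure_of UNIV (sets borel) hausdorff1_outer"

lemma hausdorff1_pre_mono: "A \<subseteq> B \<Longrightarrow> hausdorff1_pre \<delta> A \<le> hausdorff1_pre \<delta> B"
  unfolding hausdorff1_pre_def by (rule INF_superset_mono) auto

lemma hausdorff1_pre_antimono: "\<delta> \<le> \<epsilon> \<Longrightarrow> hausdorff1_pre \<epsilon> A \<le> hausdorff1_pre \<delta> A"
  unfolding hausdorff1_pre_def by (rule INF_superset_mono) (auto intro: order_trans)

lemma hausdorff1_pre_le:
  "A \<subseteq> (\<Union>n. U n) \<Longrightarrow> (\<And>n. bounded (U n)) \<Longrightarrow> (\<And>n. diameter (U n) \<le> \<delta>) \<Longrightarrow>
     hausdorff1_pre \<delta> A \<le> (\<Sum>n. ennreal (diameter (U n)))"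
  unfolding hausdorff1_pre_def by (rule INF_lower) auto

lemma hausdorff1_pre_le_outer: "0 < \<delta> \<Longrightarrow> hausdorff1_pre \<delta> A \<le> hausdorff1_outer A"
  unfolding hausdorff1_outer_def by (rule SUP_upper) auto

lemma hausdorff1_outer_mono: "A \<subseteq> B \<Longrightarrow> hausdorff1_outer A \<le> hausdorff1_outer B"
  unfolding hausdorff1_outer_def by (rule SUP_mono) (auto intro: hausdorff1_pre_mono)

lemma hausdorff1_outer_empty [simp]: "hausdorff1_outer {} = 0"
proof -
  have "hausdorff1_pre \<delta> {} \<le> 0" if "0 < \<delta>" for \<delta>
    using hausdorff1_pre_le[of "{}" "\<lambda>_. {}" \<delta>] that by auto
  then show ?thesis
    unfolding hausdorff1_outer_def by (intro antisym SUP_least) auto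
qed

lemma hausdorff1_pre_countably_subadditive:
  "hausdorff1_pre \<delta> (\<Union>i::nat. A i) \<le> (\<Sum>i. hausdorff1_pre \<delta> (A i))"
proof (cases "\<exists>i. hausdorff1_pre \<delta> (A i) = \<infinity>")
  case True
  then obtain i where "hausdorff1_pre \<delta> (A i) = \<infinity>" by blast
  then have "(\<Sum>i. hausdorff1_pre \<delta> (A i)) = \<infinity>"
    by (metis ennreal_suminf_lessD infinity_ennreal_def less_irrefl top.not_eq_extremum)
  then show ?thesis by simp
next
  case False
  show ?thesis
  proof (rule ennreal_le_epsilon)
    fix e :: real assume e: "0 < e"
    have "\<exists>U. A i \<subseteq> (\<Union>n. U n) \<and> (\<forall>n. bounded (U n) \<and> diameter (U n) \<le> \<delta>) \<and>
        (\<Sum>n. ennreal (diameter (U n))) \<le> hausdorff1_pre \<delta> (A i) + ennreal (e * (1/2) ^ Suc i)"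
      for i :: nat
    proof -
      have "hausdorff1_pre \<delta> (A i) < hausdorff1_pre \<delta> (A i) + ennreal (e * (1/2) ^ Suc i)"
        using False e ennreal_add_left_cancel_less[of "hausdorff1_pre \<delta> (A i)" 0 "ennreal (e * (1/2) ^ Suc i)"]
        by simp
      then show ?thesis
        unfolding hausdorff1_pre_def INF_less_iff by (auto intro: less_imp_le)
    qed
    then obtain U where U: "\<And>i::nat. A i \<subseteq> (\<Union>n. U i n)" "\<And>i n. bounded (U i n)"
        "\<And>i n. diameter (U i n) \<le> \<delta>"
        "\<And>i. (\<Sum>n. ennreal (diameter (U i n))) \<le> hausdorff1_pre \<delta> (A i) + ennreal (e * (1/2) ^ Suc i)"
      by metis
    define V where "V = case_prod U \<circ> prod_decode"
    have "(\<Union>i. A i) \<subseteq> (\<Union>n. V n)"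
    proof
      fix x assume "x \<in> (\<Union>i. A i)"
      then obtain i n where "x \<in> U i n" using U(1) by blast
      then have "x \<in> V (prod_encode (i, n))" by (simp add: V_def)
      then show "x \<in> (\<Union>n. V n)" by blast
    qed
    then have "hausdorff1_pre \<delta> (\<Union>i. A i) \<le> (\<Sum>n. ennreal (diameter (V n)))"
      using U by (intro hausdorff1_pre_le) (auto simp: V_def split: prod.splits)
    also have "\<dots> = (\<Sum>n. ((\<lambda>p. ennreal (diameter (case_prod U p))) \<circ> prod_decode) n)"
      by (simp add: V_def)
    also have "\<dots> = (\<Sum>i. \<Sum>n. ennreal (diameter (U i n)))"
      unfolding comp_def
      by (subst suminf_ennreal_2dimen[where f="\<lambda>p. ennreal (diameter (case_prod U p))"
            and g="\<lambda>i. \<Sum>n. ennreal (diameter (U i n))", symmetric]) (simp_all add: comp_def)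
    also have "\<dots> \<le> (\<Sum>i. hausdorff1_pre \<delta> (A i) + ennreal (e * (1/2) ^ Suc i))"
      by (intro suminf_le U) auto
    also have "\<dots> = (\<Sum>i. hausdorff1_pre \<delta> (A i)) + (\<Sum>i. ennreal (e * (1/2) ^ Suc i))"
      by (intro suminf_add[symmetric]) auto
    also have "(\<Sum>i. ennreal (e * (1/2) ^ Suc i)) = ennreal e"
      using e sums_mult[OF power_half_series, of e] by (intro suminf_ennreal_eq) auto
    finally show "hausdorff1_pre \<delta> (\<Union>i. A i) \<le> (\<Sum>i. hausdorff1_pre \<delta> (A i)) + ennreal e" .
  qed
qed

lemma hausdorff1_outer_countably_subadditive:
  "hausdorff1_outer (\<Union>i::nat. A i) \<le> (\<Sum>i. hausdorff1_outer (A i))"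
proof -
  have "hausdorff1_pre \<delta> (\<Union>i. A i) \<le> (\<Sum>i. hausdorff1_outer (A i))" if "0 < \<delta>" for \<delta>
    using hausdorff1_pre_countably_subadditive
    by (rule order_trans) (auto intro!: suminf_le hausdorff1_pre_le_outer that)
  then show ?thesis
    unfolding hausdorff1_outer_def[of "\<Union>i. A i"] by (intro SUP_least) auto
qed

lemma hausdorff1_outer_space: "outer_measure_space (Pow UNIV) hausdorff1_outer"
  unfolding outer_measure_space_def positive_def increasing_def countably_subadditive_def
  by (auto intro: hausdorff1_outer_mono hausdorff1_outer_countably_subadditive)

lemma hausdorff1_outer_Un: "hausdorff1_outer (A \<union> B) \<le> hausdorff1_outer A + hausdorff1_outer B"
proof -
  have "hausdorff1_outer (A \<union> B) = hausdorff1_outer (\<Union>i. binaryset A B i)"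
    by (simp add: UN_binaryset_eq)
  also have "\<dots> \<le> (\<Sum>i. hausdorff1_outer (binaryset A B i))"
    by (rule hausdorff1_outer_countably_subadditive)
  also have "\<dots> = hausdorff1_outer A + hausdorff1_outer B"
    by (subst suminf_finite[of "{0,1}"]) (auto simp: binaryset_def)
  finally show ?thesis .
qed

lemma hausdorff1_outer_separated:
  assumes r: "0 < r" and sep: "\<And>a b. a \<in> A \<Longrightarrow> b \<in> B \<Longrightarrow> r \<le> dist a b"
  shows "hausdorff1_outer A + hausdorff1_outer B \<le> hausdorff1_outer (A \<union> B)"
proof -
  have 1: "hausdorff1_pre \<delta> A + hausdorff1_pre \<delta> B \<le> hausdorff1_pre \<delta> (A \<union> B)"
    if \<delta>: "0 < \<delta>" "\<delta> < r" for \<delta>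
    unfolding hausdorff1_pre_def[of \<delta> "A \<union> B"]
  proof (rule INF_greatest, clarify)
    fix U :: "nat \<Rightarrow> 'a set"
    assume U: "A \<union> B \<subseteq> (\<Union>n. U n)" "\<forall>n. bounded (U n) \<and> diameter (U n) \<le> \<delta>"
    define V where "V n = (if U n \<inter> A = {} then {} else U n)" for n
    define W where "W n = (if U n \<inter> A = {} then U n else {})" for n
    have "B \<subseteq> (\<Union>n. W n)"
    proof
      fix b assume b: "b \<in> B"
      then obtain n where n: "b \<in> U n" using U by blast
      have "U n \<inter> A = {}"
      proof (rule ccontr)
        assume "U n \<inter> A \<noteq> {}"
        then obtain a where a: "a \<in> U n" "a \<in> A" by blast
        have "dist a b \<le> diameter (U n)" using U a n by (intro diameter_bounded_bound) auto
        moreover have "diameter (U n) \<le> \<delta>" using U(2) by blast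
        ultimately show False using \<delta>(2) sep[OF a(2) b] by linarith
      qed
      with n show "b \<in> (\<Union>n. W n)" by (auto simp: W_def)
    qed
    then have W: "hausdorff1_pre \<delta> B \<le> (\<Sum>n. ennreal (diameter (W n)))"
      using U \<delta> by (intro hausdorff1_pre_le) (auto simp: W_def)
    have "A \<subseteq> (\<Union>n. V n)" using U by (fastforce simp: V_def)
    then have V: "hausdorff1_pre \<delta> A \<le> (\<Sum>n. ennreal (diameter (V n)))"
      using U \<delta> by (intro hausdorff1_pre_le) (auto simp: V_def)
    have "(\<Sum>n. ennreal (diameter (V n))) + (\<Sum>n. ennreal (diameter (W n)))
        = (\<Sum>n. ennreal (diameter (V n)) + ennreal (diameter (W n)))"
      by (intro suminf_add) auto
    also have "\<dots> = (\<Sum>n. ennreal (diameter (U n)))"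
      by (intro suminf_cong) (auto simp: V_def W_def)
    finally show "hausdorff1_pre \<delta> A + hausdorff1_pre \<delta> B \<le> (\<Sum>n. ennreal (diameter (U n)))"
      using add_mono[OF V W] by simp
  qed
  have 2: "hausdorff1_pre \<delta> A + hausdorff1_pre \<epsilon> B \<le> hausdorff1_outer (A \<union> B)"
    if "0 < \<delta>" "0 < \<epsilon>" for \<delta> \<epsilon>
  proof -
    define \<eta> where "\<eta> = min (min \<delta> \<epsilon>) (r/2)"
    have \<eta>: "0 < \<eta>" "\<eta> < r" "\<eta> \<le> \<delta>" "\<eta> \<le> \<epsilon>" using that r by (auto simp: \<eta>_def min_def)
    have "hausdorff1_pre \<delta> A + hausdorff1_pre \<epsilon> B \<le> hausdorff1_pre \<eta> A + hausdorff1_pre \<eta> B"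
      by (intro add_mono hausdorff1_pre_antimono \<eta>)
    also have "\<dots> \<le> hausdorff1_outer (A \<union> B)"
      using 1[OF \<eta>(1,2)] hausdorff1_pre_le_outer[OF \<eta>(1)] by (rule order_trans)
    finally show ?thesis .
  qed
  have ne: "{0::real<..} \<noteq> {}" by auto
  have "hausdorff1_outer A + hausdorff1_outer B
      = (SUP \<delta>\<in>{0<..}. SUP \<epsilon>\<in>{0<..}. hausdorff1_pre \<delta> A + hausdorff1_pre \<epsilon> B)"
    unfolding hausdorff1_outer_def
    by (simp add: ennreal_SUP_add_left[OF ne, symmetric] ennreal_SUP_add_right[OF ne, symmetric])
  also have "\<dots> \<le> hausdorff1_outer (A \<union> B)"
    by (intro SUP_least) (use 2 in auto)
  finally show ?thesis .
qed

lemma hausdorff1_outer_separated_sum: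
  fixes A :: "nat \<Rightarrow> 'a::metric_space set"
  assumes "\<And>i j. i < j \<Longrightarrow> \<exists>r>0. \<forall>a\<in>A i. \<forall>b\<in>A j. r \<le> dist a b"
  shows "(\<Sum>i<n. hausdorff1_outer (A i)) \<le> hausdorff1_outer (\<Union>i<n. A i)"
proof (induction n)
  case (Suc n)
  have "\<forall>i\<in>{..<n}. \<exists>r>0. \<forall>a\<in>A i. \<forall>b\<in>A n. r \<le> dist a b" by (intro ballI assms) simp
  from bchoice[OF this] obtain r
    where "\<forall>i\<in>{..<n}. 0 < r i \<and> (\<forall>a\<in>A i. \<forall>b\<in>A n. r i \<le> dist a b)" ..
  then have r: "\<And>i. i < n \<Longrightarrow> 0 < r i"
      "\<And>i a b. i < n \<Longrightarrow> a \<in> A i \<Longrightarrow> b \<in> A n \<Longrightarrow> r i \<le> dist a b"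
    by (metis lessThan_iff)+
  define s where "s = Min (insert 1 (r ` {..<n}))"
  have s: "0 < s" "\<And>i. i < n \<Longrightarrow> s \<le> r i"
    using r(1) unfolding s_def by (subst Min_gr_iff) (auto intro!: Min_le)
  have "(\<Sum>i<Suc n. hausdorff1_outer (A i)) \<le> hausdorff1_outer (\<Union>i<n. A i) + hausdorff1_outer (A n)"
    using add_right_mono[OF Suc] by (simp only: sum.lessThan_Suc)
  also have "\<dots> \<le> hausdorff1_outer ((\<Union>i<n. A i) \<union> A n)"
  proof (rule hausdorff1_outer_separated[OF s(1)])
    fix a b assume "a \<in> (\<Union>i<n. A i)" "b \<in> A n"
    then obtain i where "i < n" "a \<in> A i" "b \<in> A n" by blast
    then show "s \<le> dist a b" using s(2) r(2) by (meson order_trans)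
  qed
  also have "(\<Union>i<n. A i) \<union> A n = (\<Union>i<Suc n. A i)"
    by (auto simp: lessThan_Suc)
  finally show ?case .
qed simp

lemma hausdorff1_closed_lambda_system:
  assumes C: "closed C"
  shows "C \<in> lambda_system UNIV (Pow UNIV) hausdorff1_outer"
proof -
  interpret algebra UNIV "Pow UNIV :: 'a set set" by (rule algebra_Pow)
  have "hausdorff1_outer (E \<inter> C) + hausdorff1_outer (E - C) = hausdorff1_outer E" for E
  proof (rule antisym)
    have "hausdorff1_outer E = hausdorff1_outer (E \<inter> C \<union> (E - C))"
      by (simp add: Int_Diff_Un)
    then show "hausdorff1_outer E \<le> hausdorff1_outer (E \<inter> C) + hausdorff1_outer (E - C)"
      by (simp add: hausdorff1_outer_Un)
    show "hausdorff1_outer (E \<inter> C) + hausdorff1_outer (E - C) \<le> hausdorff1_outer E"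
    proof (cases "hausdorff1_outer E = \<infinity>")
      case False
      define D where "D n = {x\<in>E. \<forall>c\<in>C. 1 / real (Suc n) \<le> dist x c}" for n
      define R where "R n = D (Suc n) - D n" for n
      have Dmono: "D m \<subseteq> D n" if "m \<le> n" for m n
      proof -
        have "1 / real (Suc n) \<le> 1 / real (Suc m)" using that by (intro frac_le) auto
        then have "1 / real (Suc n) \<le> t" if "1 / real (Suc m) \<le> t" for t
          using that by linarith
        then show ?thesis unfolding D_def by blast
      qed
      have Rsep: "\<exists>r>0. \<forall>a\<in>R i. \<forall>b\<in>R j. r \<le> dist a b" if ij: "i + 2 \<le> j" for i j
      proof (intro exI conjI ballI)
        have "1 / real (i+3) < 1 / real (i+2)" by (intro frac_less2) auto
        then show "0 < 1 / real (i+2) - 1 / real (i+3)" by simp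
        fix a b assume a: "a \<in> R i" and b: "b \<in> R j"
        obtain c where c: "c \<in> C" "dist b c < 1 / real (Suc j)"
          using b by (auto simp: R_def D_def not_le)
        have "1 / real (Suc j) \<le> 1 / real (i+3)" using ij by (intro frac_le) auto
        moreover have "1 / real (i+2) \<le> dist a c" using a c by (auto simp: R_def D_def)
        moreover have "dist a c \<le> dist a b + dist b c" by (rule dist_triangle)
        ultimately show "1 / real (i+2) - 1 / real (i+3) \<le> dist a b" using c(2) by linarith
      qed
      have half: "(\<Sum>i<n. hausdorff1_outer (R (2*i+p))) \<le> hausdorff1_outer E" for n p
      proof -
        have "(\<Sum>i<n. hausdorff1_outer (R (2*i+p))) \<le> hausdorff1_outer (\<Union>i<n. R (2*i+p))"
          by (intro hausdorff1_outer_separated_sum[of "\<lambda>i. R (2*i+p)"] Rsep) auto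
        also have "\<dots> \<le> hausdorff1_outer E"
          by (intro hausdorff1_outer_mono) (auto simp: R_def D_def)
        finally show ?thesis .
      qed
      have bound: "(\<Sum>i<n. hausdorff1_outer (R i)) \<le> hausdorff1_outer E + hausdorff1_outer E" for n
      proof -
        have "(\<Sum>i<n. hausdorff1_outer (R i)) \<le> (\<Sum>i<2*n. hausdorff1_outer (R i))"
          by (intro sum_mono2) auto
        also have "\<dots> = (\<Sum>i<n. hausdorff1_outer (R (2*i+0))) + (\<Sum>i<n. hausdorff1_outer (R (2*i+1)))"
          by (induction n) (auto simp: algebra_simps)
        also have "\<dots> \<le> hausdorff1_outer E + hausdorff1_outer E"
          by (intro add_mono half)
        finally show ?thesis .
      qed
      have "(\<Sum>i. hausdorff1_outer (R i)) \<le> hausdorff1_outer E + hausdorff1_outer E"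
        by (intro suminf_le_const bound) auto
      also have "\<dots> < \<infinity>" using False by (simp add: less_top[symmetric])
      finally have fin: "(\<Sum>i. hausdorff1_outer (R i)) < \<infinity>" .
      have EC: "E - C \<subseteq> (\<Union>n. D n)"
      proof
        fix x assume x: "x \<in> E - C"
        obtain e where e: "0 < e" "\<And>c. dist c x < e \<Longrightarrow> c \<notin> C"
          using C x unfolding closed_def open_dist by blast
        obtain n where "1 / real (Suc n) < e" using e(1) nat_approx_posE by blast
        moreover have "e \<le> dist x c" if "c \<in> C" for c
          using e(2)[of c] that by (metis dist_commute not_less)
        ultimately have "\<forall>c\<in>C. 1 / real (Suc n) \<le> dist x c" by (meson less_le_trans less_imp_le)
        with x have "x \<in> D n" by (simp add: D_def)
        then show "x \<in> (\<Union>n. D n)" by blast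
      qed
      have tail: "hausdorff1_outer (E \<inter> C) + hausdorff1_outer (E - C)
          \<le> hausdorff1_outer E + (\<Sum>i. hausdorff1_outer (R (i + n)))" for n
      proof -
        have step: "D m \<subseteq> D n \<union> (\<Union>i. R (i + n))" for m
        proof (induction m)
          case 0
          then show ?case using Dmono[of 0 n] by blast
        next
          case (Suc m)
          show ?case
          proof (cases "Suc m \<le> n")
            case True
            then show ?thesis using Dmono[OF True] by blast
          next
            case False
            then have "R m = R ((m - n) + n)" by simp
            then have "R m \<subseteq> (\<Union>i. R (i + n))" by blast
            with Suc show ?thesis by (auto simp: R_def)
          qed
        qed
        have "hausdorff1_outer (E - C) \<le> hausdorff1_outer (D n \<union> (\<Union>i. R (i + n)))"
          using EC step by (intro hausdorff1_outer_mono) blast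
        also have "\<dots> \<le> hausdorff1_outer (D n) + hausdorff1_outer (\<Union>i. R (i + n))"
          by (rule hausdorff1_outer_Un)
        also have "\<dots> \<le> hausdorff1_outer (D n) + (\<Sum>i. hausdorff1_outer (R (i + n)))"
          by (intro add_left_mono hausdorff1_outer_countably_subadditive)
        finally have a: "hausdorff1_outer (E - C) \<le> \<dots>" .
        have "hausdorff1_outer (E \<inter> C) + hausdorff1_outer (D n) \<le> hausdorff1_outer (E \<inter> C \<union> D n)"
          by (intro hausdorff1_outer_separated[of "1 / real (Suc n)"]) (auto simp: D_def dist_commute)
        also have "\<dots> \<le> hausdorff1_outer E"
          by (intro hausdorff1_outer_mono) (auto simp: D_def)
        finally have b: "hausdorff1_outer (E \<inter> C) + hausdorff1_outer (D n) \<le> hausdorff1_outer E" .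
        show ?thesis
          by (rule order_trans[OF add_left_mono[OF a]])
            (use add_right_mono[OF b] in \<open>simp only: add.assoc\<close>)
      qed
      have lim0: "(\<lambda>n. \<Sum>i. hausdorff1_outer (R (i + n))) \<longlonglongrightarrow> 0"
      proof -
        define h where "h i = enn2real (hausdorff1_outer (R i))" for i
        have hR: "hausdorff1_outer (R i) = ennreal (h i)" for i
          using ennreal_suminf_lessD[OF fin, of i] by (simp add: h_def)
        have h0: "0 \<le> h i" for i by (simp add: h_def)
        have hs: "summable h"
          using fin[unfolded hR] by (intro summable_suminf_not_top h0) (metis infinity_ennreal_def less_irrefl)
        have "(\<Sum>i. hausdorff1_outer (R (i + n))) = ennreal (\<Sum>i. h (i + n))" for n
          unfolding hR using hs by (intro suminf_ennreal2 summable_ignore_initial_segment h0)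
        moreover have "(\<lambda>n. ennreal (\<Sum>i. h (i + n))) \<longlonglongrightarrow> ennreal 0"
          by (intro tendsto_ennrealI suminf_exist_split2 hs)
        ultimately show ?thesis by simp
      qed
      have "(\<lambda>n. hausdorff1_outer E + (\<Sum>i. hausdorff1_outer (R (i + n)))) \<longlonglongrightarrow> hausdorff1_outer E + 0"
        by (intro tendsto_add tendsto_const lim0)
      then show ?thesis
        using tail by (intro LIMSEQ_le_const) auto
    qed simp
  qed
  then show ?thesis unfolding lambda_system_eq by blast
qed

text \<open>The side conditions of \<^const>\<open>measure_of\<close> hold, so \<^const>\<open>hausdorff1\<close> really is
  Hausdorff measure and not the null measure.\<close>

lemma sets_hausdorff1 [simp, measurable_cong]: "sets hausdorff1 = sets borel"
  unfolding hausdorff1_def using sets.sets_measure_of_eq[of borel] by simp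

lemma space_hausdorff1 [simp]: "space hausdorff1 = UNIV"
  unfolding hausdorff1_def by (simp add: space_measure_of_conv)

lemma emeasure_hausdorff1:
  assumes "A \<in> sets borel"
  shows "emeasure hausdorff1 A = hausdorff1_outer A"
proof -
  let ?L = "lambda_system (UNIV::'a set) (Pow UNIV) hausdorff1_outer"
  have ms: "measure_space UNIV ?L hausdorff1_outer"
    by (rule sigma_algebra.caratheodory_lemma[OF sigma_algebra_Pow hausdorff1_outer_space])
  then have "sigma_algebra UNIV ?L" by (simp add: measure_space_def)
  then have "sigma_sets UNIV (Collect closed) \<subseteq> ?L"
    by (rule sigma_algebra.sigma_sets_subset) (blast intro: hausdorff1_closed_lambda_system)
  then have sub: "sets borel \<subseteq> ?L"
    by (simp only: borel_eq_closed sets_measure_of top_greatest subset_Pow_Union Pow_UNIV)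
  have sb: "sigma_algebra (UNIV::'a set) (sets borel)"
    using sets.sigma_algebra_axioms[of "borel :: 'a measure"] by (simp only: space_borel)
  have "measure_space (UNIV::'a set) (sets borel) hausdorff1_outer"
    by (rule measure_down[OF ms sb sub])
  then have "positive (sets (borel :: 'a measure)) hausdorff1_outer"
      "countably_additive (sets (borel :: 'a measure)) hausdorff1_outer"
    by (simp_all only: measure_space_def)
  then show ?thesis
    unfolding hausdorff1_def by (rule emeasure_measure_of_sigma[OF sb _ _ assms])
qed


section \<open>Lebesgue spaces\<close>

text \<open>Members of function spaces are representatives; equality in the space is equality almost
  everywhere.\<close>

definition L2 :: "'a measure \<Rightarrow> ('a \<Rightarrow> complex) set" where
  "L2 M = {f \<in> borel_measurable M. integrable M (\<lambda>x. (cmod (f x))\<^sup>2)}"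

definition inner_L2 :: "'a measure \<Rightarrow> ('a \<Rightarrow> complex) \<Rightarrow> ('a \<Rightarrow> complex) \<Rightarrow> complex" where
  "inner_L2 M f g = (LINT x|M. f x * cnj (g x))"

definition norm_L2 :: "'a measure \<Rightarrow> ('a \<Rightarrow> complex) \<Rightarrow> real" where
  "norm_L2 M f = sqrt (LINT x|M. (cmod (f x))\<^sup>2)"

definition Lp_real :: "'a measure \<Rightarrow> ennreal \<Rightarrow> ('a \<Rightarrow> real) set" where
  "Lp_real M p = {f \<in> borel_measurable M.
     if p = \<infinity> then \<exists>C. AE x in M. \<bar>f x\<bar> \<le> C
     else integrable M (\<lambda>x. \<bar>f x\<bar> powr enn2real p)}"


section \<open>Sobolev spaces on planar domains\<close>

definition partial_deriv :: "2 \<Rightarrow> (real^2 \<Rightarrow> complex) \<Rightarrow> real^2 \<Rightarrow> complex" where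
  "partial_deriv i f x = frechet_derivative f (at x) (axis i 1)"

primrec Ck :: "nat \<Rightarrow> (real^2 \<Rightarrow> complex) \<Rightarrow> bool" where
  "Ck 0 f \<longleftrightarrow> continuous_on UNIV f"
| "Ck (Suc n) f \<longleftrightarrow> (\<forall>x. f differentiable (at x)) \<and> (\<forall>i. Ck n (partial_deriv i f))"

definition test_functions :: "(real^2) set \<Rightarrow> (real^2 \<Rightarrow> complex) set" where
  "test_functions \<Omega> =
     {\<phi>. (\<forall>n. Ck n \<phi>) \<and> compact (closure {x. \<phi> x \<noteq> 0}) \<and> closure {x. \<phi> x \<noteq> 0} \<subseteq> \<Omega>}"

definition is_weak_deriv ::
  "(real^2) set \<Rightarrow> 2 \<Rightarrow> (real^2 \<Rightarrow> complex) \<Rightarrow> (real^2 \<Rightarrow> complex) \<Rightarrow> bool" where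
  "is_weak_deriv \<Omega> i u v \<longleftrightarrow> (\<forall>\<phi>\<in>test_functions \<Omega>.
     (LINT x|lebesgue_on \<Omega>. u x * partial_deriv i \<phi> x) = - (LINT x|lebesgue_on \<Omega>. v x * \<phi> x))"

definition weak_deriv :: "(real^2) set \<Rightarrow> 2 \<Rightarrow> (real^2 \<Rightarrow> complex) \<Rightarrow> real^2 \<Rightarrow> complex" where
  "weak_deriv \<Omega> i u = (SOME v. v \<in> L2 (lebesgue_on \<Omega>) \<and> is_weak_deriv \<Omega> i u v)"

definition H1 :: "(real^2) set \<Rightarrow> (real^2 \<Rightarrow> complex) set" where
  "H1 \<Omega> = {u \<in> L2 (lebesgue_on \<Omega>). \<forall>i. \<exists>v\<in>L2 (lebesgue_on \<Omega>). is_weak_deriv \<Omega> i u v}"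

definition norm_H1 :: "(real^2) set \<Rightarrow> (real^2 \<Rightarrow> complex) \<Rightarrow> real" where
  "norm_H1 \<Omega> u = sqrt ((norm_L2 (lebesgue_on \<Omega>) u)\<^sup>2
     + (\<Sum>i\<in>UNIV. (norm_L2 (lebesgue_on \<Omega>) (weak_deriv \<Omega> i u))\<^sup>2))"

definition H2 :: "(real^2) set \<Rightarrow> (real^2 \<Rightarrow> complex) set" where
  "H2 \<Omega> = {u \<in> H1 \<Omega>. \<forall>i. weak_deriv \<Omega> i u \<in> H1 \<Omega>}"

definition norm_H2 :: "(real^2) set \<Rightarrow> (real^2 \<Rightarrow> complex) \<Rightarrow> real" where
  "norm_H2 \<Omega> u = sqrt ((norm_L2 (lebesgue_on \<Omega>) u)\<^sup>2
     + (\<Sum>i\<in>UNIV. (norm_H1 \<Omega> (weak_deriv \<Omega> i u))\<^sup>2))"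

definition antidual_H1 :: "(real^2) set \<Rightarrow> ((real^2 \<Rightarrow> complex) \<Rightarrow> complex) set" where
  "antidual_H1 \<Omega> = {F.
     (\<forall>\<phi>\<in>H1 \<Omega>. \<forall>\<psi>\<in>H1 \<Omega>. F (\<lambda>x. \<phi> x + \<psi> x) = F \<phi> + F \<psi>) \<and>
     (\<forall>c. \<forall>\<phi>\<in>H1 \<Omega>. F (\<lambda>x. c * \<phi> x) = cnj c * F \<phi>) \<and>
     (\<exists>C. \<forall>\<phi>\<in>H1 \<Omega>. cmod (F \<phi>) \<le> C * norm_H1 \<Omega> \<phi>)}"

definition eq_H1 :: "(real^2) set \<Rightarrow> (real^2 \<Rightarrow> complex) \<Rightarrow> (real^2 \<Rightarrow> complex) \<Rightarrow> bool" where
  "eq_H1 \<Omega> u v \<longleftrightarrow> (AE x in lebesgue_on \<Omega>. u x = v x)"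

definition eq_antidual_H1 ::
  "(real^2) set \<Rightarrow> ((real^2 \<Rightarrow> complex) \<Rightarrow> complex) \<Rightarrow> ((real^2 \<Rightarrow> complex) \<Rightarrow> complex) \<Rightarrow> bool" where
  "eq_antidual_H1 \<Omega> F G \<longleftrightarrow> (\<forall>\<phi>\<in>H1 \<Omega>. F \<phi> = G \<phi>)"

definition unique_solution_H1 ::
  "(real^2) set \<Rightarrow> ((real^2 \<Rightarrow> complex) \<Rightarrow> bool) \<Rightarrow> (real^2 \<Rightarrow> complex) \<Rightarrow> bool" where
  "unique_solution_H1 \<Omega> P u \<longleftrightarrow> u \<in> H1 \<Omega> \<and> P u \<and> (\<forall>v\<in>H1 \<Omega>. P v \<longrightarrow> eq_H1 \<Omega> v u)"


section \<open>Domains with continuously differentiable boundary\<close>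

text \<open>Locally, after a rigid motion (the orthonormal frame \<open>e\<^sub>1, e\<^sub>2\<close>), the domain is the region
  above the graph of a $C^1$ function.\<close>

definition C1_boundary :: "(real^2) set \<Rightarrow> bool" where
  "C1_boundary \<Omega> \<longleftrightarrow> (\<forall>x0\<in>frontier \<Omega>. \<exists>r>0. \<exists>e\<^sub>1 e\<^sub>2. \<exists>\<gamma>::real \<Rightarrow> real.
     norm e\<^sub>1 = 1 \<and> norm e\<^sub>2 = 1 \<and> e\<^sub>1 \<bullet> e\<^sub>2 = 0 \<and> \<gamma> C1_differentiable_on UNIV \<and>
     \<Omega> \<inter> ball x0 r = {x \<in> ball x0 r. \<gamma> (x \<bullet> e\<^sub>1) < x \<bullet> e\<^sub>2})"

definition C1_domain :: "(real^2) set \<Rightarrow> bool" where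
  "C1_domain \<Omega> \<longleftrightarrow>
     open \<Omega> \<and> connected \<Omega> \<and> \<Omega> \<noteq> {} \<and> bounded \<Omega> \<and> C1_boundary \<Omega>"

abbreviation boundary_measure :: "(real^2) set \<Rightarrow> (real^2) measure" where
  "boundary_measure \<Omega> \<equiv> restrict_space hausdorff1 (frontier \<Omega>)"

text \<open>The trace is characterised as the bounded linear extension to $H^1$ of the restriction to the
  boundary; by density of the functions continuous up to the boundary it is unique.\<close>

definition trace_operator ::
  "(real^2) set \<Rightarrow> ((real^2 \<Rightarrow> complex) \<Rightarrow> real^2 \<Rightarrow> complex) \<Rightarrow> bool" where
  "trace_operator \<Omega> T \<longleftrightarrow>
     (\<forall>u\<in>H1 \<Omega>. T u \<in> L2 (boundary_measure \<Omega>)) \<and>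
     (\<forall>u\<in>H1 \<Omega>. \<forall>v\<in>H1 \<Omega>. AE x in boundary_measure \<Omega>. T (\<lambda>y. u y + v y) x = T u x + T v x) \<and>
     (\<forall>c. \<forall>u\<in>H1 \<Omega>. AE x in boundary_measure \<Omega>. T (\<lambda>y. c * u y) x = c * T u x) \<and>
     (\<exists>C. \<forall>u\<in>H1 \<Omega>. norm_L2 (boundary_measure \<Omega>) (T u) \<le> C * norm_H1 \<Omega> u) \<and>
     (\<forall>u\<in>H1 \<Omega>. continuous_on (closure \<Omega>) u \<longrightarrow> (AE x in boundary_measure \<Omega>. T u x = u x))"

definition compact_embedding_H2_H1 :: "(real^2) set \<Rightarrow> bool" where
  "compact_embedding_H2_H1 \<Omega> \<longleftrightarrow> (\<forall>(u::nat \<Rightarrow> _) R. (\<forall>n. u n \<in> H2 \<Omega> \<and> norm_H2 \<Omega> (u n) \<le> R) \<longrightarrow>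
     (\<exists>v\<in>H1 \<Omega>. \<exists>r. strict_mono r \<and> (\<lambda>n. norm_H1 \<Omega> (\<lambda>x. u (r n) x - v x)) \<longlonglongrightarrow> 0))"


section \<open>Helmholtz operators\<close>

definition S_op :: "(real^2) set \<Rightarrow> (real^2 \<Rightarrow> complex) \<Rightarrow> (real^2 \<Rightarrow> complex) \<Rightarrow> complex" where
  "S_op \<Omega> y \<phi> = (\<Sum>i\<in>UNIV. inner_L2 (lebesgue_on \<Omega>) (weak_deriv \<Omega> i y) (weak_deriv \<Omega> i \<phi>))"

definition B_op :: "(real^2) set \<Rightarrow> ((real^2 \<Rightarrow> complex) \<Rightarrow> real^2 \<Rightarrow> complex) \<Rightarrow>
    (real^2 \<Rightarrow> complex) \<Rightarrow> (real^2 \<Rightarrow> complex) \<Rightarrow> complex" where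
  "B_op \<Omega> T y \<phi> = inner_L2 (boundary_measure \<Omega>) (T y) (T \<phi>)"

definition M_op :: "(real^2) set \<Rightarrow> (real^2 \<Rightarrow> real) \<Rightarrow>
    (real^2 \<Rightarrow> complex) \<Rightarrow> (real^2 \<Rightarrow> complex) \<Rightarrow> complex" where
  "M_op \<Omega> m y \<phi> = inner_L2 (lebesgue_on \<Omega>) (\<lambda>x. complex_of_real (m x) * y x) \<phi>"

text \<open>The operator $\mathcal S - k^2 \mathcal M_m - \imath k \mathcal B$.\<close>

definition helmholtz_op :: "(real^2) set \<Rightarrow> ((real^2 \<Rightarrow> complex) \<Rightarrow> real^2 \<Rightarrow> complex) \<Rightarrow>
    real \<Rightarrow> (real^2 \<Rightarrow> real) \<Rightarrow> (real^2 \<Rightarrow> complex) \<Rightarrow> (real^2 \<Rightarrow> complex) \<Rightarrow> complex" where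
  "helmholtz_op \<Omega> T k m y \<phi> =
     S_op \<Omega> y \<phi> - (complex_of_real k)\<^sup>2 * M_op \<Omega> m y \<phi> - \<i> * complex_of_real k * B_op \<Omega> T y \<phi>"

definition helmholtz_inv :: "(real^2) set \<Rightarrow> ((real^2 \<Rightarrow> complex) \<Rightarrow> real^2 \<Rightarrow> complex) \<Rightarrow>
    real \<Rightarrow> ((real^2 \<Rightarrow> complex) \<Rightarrow> complex) \<Rightarrow> real^2 \<Rightarrow> complex" where
  "helmholtz_inv \<Omega> T k F =
     (SOME y. y \<in> H1 \<Omega> \<and> eq_antidual_H1 \<Omega> (helmholtz_op \<Omega> T k (\<lambda>_. 1) y) F)"

definition V_tilde_op :: "(real^2) set \<Rightarrow> ((real^2 \<Rightarrow> complex) \<Rightarrow> real^2 \<Rightarrow> complex) \<Rightarrow>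
    real \<Rightarrow> (real^2 \<Rightarrow> real) \<Rightarrow> (real^2 \<Rightarrow> complex) \<Rightarrow> real^2 \<Rightarrow> complex" where
  "V_tilde_op \<Omega> T k q y = helmholtz_inv \<Omega> T k (M_op \<Omega> q y)"

text \<open>Since $H^2 \subseteq H^1$ as sets of representatives, the embedding of $H^2$ into $H^1$ is
  \<^const>\<open>id\<close>.\<close>

definition V_op :: "(real^2) set \<Rightarrow> ((real^2 \<Rightarrow> complex) \<Rightarrow> real^2 \<Rightarrow> complex) \<Rightarrow>
    real \<Rightarrow> (real^2 \<Rightarrow> real) \<Rightarrow> (real^2 \<Rightarrow> complex) \<Rightarrow> real^2 \<Rightarrow> complex" where
  "V_op \<Omega> T k q = id \<circ> V_tilde_op \<Omega> T k q"

text \<open>The weak form of $(-\Delta - k^2) w = g$ in the domain, $(\partial_n - \imath k) w = 0$ on its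
  boundary, tests \<open>helmholtz_op\<close> with $m = 1$ against $(g, \cdot)$.\<close>

definition helmholtz_regularity ::
  "(real^2) set \<Rightarrow> ((real^2 \<Rightarrow> complex) \<Rightarrow> real^2 \<Rightarrow> complex) \<Rightarrow> bool" where
  "helmholtz_regularity \<Omega> T \<longleftrightarrow> (\<exists>C>0. \<forall>k>0. \<forall>g\<in>L2 (lebesgue_on \<Omega>). \<exists>w.
     unique_solution_H1 \<Omega>
       (\<lambda>w. eq_antidual_H1 \<Omega> (helmholtz_op \<Omega> T k (\<lambda>_. 1) w) (inner_L2 (lebesgue_on \<Omega>) g)) w \<and>
     w \<in> H2 \<Omega> \<and>
     norm_H2 \<Omega> w \<le> C * (k + 1 + 1/k + 1/k\<^sup>2) * norm_L2 (lebesgue_on \<Omega>) g)"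

end

(*
  Let A = S - k^2 M_1 - i k B.  Adding (1 + k^2) M_1 makes A coercive on H^1, so Lax--Milgram and the
  assumed regularity for right-hand sides in L^2 show that A maps H^1 bijectively onto its anti-dual.
  Since S - k^2 M_{1+q} - i k B = A - k^2 M_q, applying A to u - k^2 V_q u - A^{-1} f turns one equation
  into the other, and the two problems have the same solutions.

  The analytic point is that M_q u lies in the anti-dual.  As q is in L^2, this follows from the
  embedding of H^1 into L^4.  Near each point of the closure the domain contains short segments in two
  independent directions, along which u(x) is an integral of u and of a directional derivative; by
  Cauchy--Schwarz |u|^2 is bounded by a line integral in either direction, and the product of the two
  bounds is integrated by a planar Loomis--Whitney identity.  The identity along segments is obtained by
  testing with translated test functions, so no approximation by smooth functions is needed.
*)

theory Submission
  imports Defs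
begin

section \<open>Square-integrable functions\<close>

text \<open>Both \<open>helmholtz_inv\<close> and \<open>weak_deriv\<close> are Hilbert choices. The
  first is known to invert \<open>A\<close> only on bounded antilinear functionals, so
  \<open>V_op\<close> says nothing about u until \<open>M_op \<Omega> q u\<close> has been shown to
  be one; this is why an embedding theorem has to precede a short piece of algebra. The second fixes
  a derivative only up to null sets, so linearity of derivatives holds almost everywhere and is
  drawn from uniqueness of weak derivatives. On a bounded domain an exponent above 2 puts q into
  L^2, and the product of u and phi lies in L^2 as soon as both lie in L^4; hence the exponent 4.
  Functions are not identified modulo null sets, so the H^1 norm is a seminorm on its carrier set.
  The Hilbert space arguments are therefore carried out for a complete semidefinite form.\<close>

lemma borel_measurable_cnj [measurable]:
  "f \<in> borel_measurable M \<Longrightarrow> (\<lambda>x. cnj (f x)) \<in> borel_measurable M"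
  by (rule borel_measurable_continuous_on[of cnj]) (intro continuous_intros)

lemma L2_measurable: "f \<in> L2 M \<Longrightarrow> f \<in> borel_measurable M"
  by (simp add: L2_def)

lemma L2_integrable: "f \<in> L2 M \<Longrightarrow> integrable M (\<lambda>x. (cmod (f x))\<^sup>2)"
  by (simp add: L2_def)

lemma L2_I: "f \<in> borel_measurable M \<Longrightarrow> integrable M (\<lambda>x. (cmod (f x))\<^sup>2) \<Longrightarrow> f \<in> L2 M"
  by (simp add: L2_def)

lemma L2_integrable_mult:
  assumes "f \<in> L2 M" "g \<in> L2 M"
  shows "integrable M (\<lambda>x. f x * g x)"
proof (rule Bochner_Integration.integrable_bound)
  show "integrable M (\<lambda>x. (cmod (f x))\<^sup>2 + (cmod (g x))\<^sup>2)"
    using assms by (intro Bochner_Integration.integrable_add L2_integrable)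
  show "AE x in M. norm (f x * g x) \<le> norm ((cmod (f x))\<^sup>2 + (cmod (g x))\<^sup>2)"
  proof (intro AE_I2)
    fix x
    have "2 * (cmod (f x) * cmod (g x)) \<le> (cmod (f x))\<^sup>2 + (cmod (g x))\<^sup>2"
      using sum_squares_bound[of "cmod (f x)" "cmod (g x)"] by (simp add: mult.assoc)
    moreover have "0 \<le> cmod (f x) * cmod (g x)" by simp
    ultimately show "norm (f x * g x) \<le> norm ((cmod (f x))\<^sup>2 + (cmod (g x))\<^sup>2)"
      unfolding real_norm_def norm_mult by linarith
  qed
qed (intro borel_measurable_times borel_measurable_add borel_measurable_power measurable_compose[OF _ borel_measurable_norm] L2_measurable assms)

lemma L2_cnj: "f \<in> L2 M \<Longrightarrow> (\<lambda>x. cnj (f x)) \<in> L2 M"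
  by (auto simp: L2_def)

lemma L2_scale: "f \<in> L2 M \<Longrightarrow> (\<lambda>x. c * f x) \<in> L2 M"
  by (auto simp: L2_def norm_mult power_mult_distrib)

lemma L2_zero: "(\<lambda>_. 0) \<in> L2 M"
  by (auto simp: L2_def)

lemma L2_add:
  assumes "f \<in> L2 M" "g \<in> L2 M"
  shows "(\<lambda>x. f x + g x) \<in> L2 M"
proof (rule L2_I)
  show "integrable M (\<lambda>x. (cmod (f x + g x))\<^sup>2)"
  proof (rule Bochner_Integration.integrable_bound)
    show "integrable M (\<lambda>x. 2 * (cmod (f x))\<^sup>2 + 2 * (cmod (g x))\<^sup>2)"
      using assms by (intro Bochner_Integration.integrable_add integrable_mult_right L2_integrable)
    show "AE x in M. norm ((cmod (f x + g x))\<^sup>2) \<le> norm (2 * (cmod (f x))\<^sup>2 + 2 * (cmod (g x))\<^sup>2)"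
    proof (intro AE_I2)
      fix x
      have "(cmod (f x + g x))\<^sup>2 \<le> (cmod (f x) + cmod (g x))\<^sup>2"
        by (intro power_mono norm_triangle_ineq) simp
      also have "\<dots> \<le> 2 * (cmod (f x))\<^sup>2 + 2 * (cmod (g x))\<^sup>2"
        using sum_squares_bound[of "cmod (f x)" "cmod (g x)"] by (simp add: power2_sum)
      finally show "norm ((cmod (f x + g x))\<^sup>2) \<le> norm (2 * (cmod (f x))\<^sup>2 + 2 * (cmod (g x))\<^sup>2)"
        by simp
    qed
  qed (intro borel_measurable_times borel_measurable_add borel_measurable_power measurable_compose[OF _ borel_measurable_norm] L2_measurable assms)
qed (intro borel_measurable_times borel_measurable_add borel_measurable_power measurable_compose[OF _ borel_measurable_norm] L2_measurable assms)

lemma L2_diff: "f \<in> L2 M \<Longrightarrow> g \<in> L2 M \<Longrightarrow> (\<lambda>x. f x - g x) \<in> L2 M"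
  using L2_add[of f M "\<lambda>x. - 1 * g x"] L2_scale[of g M "-1"] by simp

lemma L2_cong_AE:
  assumes "f \<in> L2 M" "g \<in> borel_measurable M" "AE x in M. f x = g x"
  shows "g \<in> L2 M"
proof (rule L2_I)
  have [measurable]: "f \<in> borel_measurable M" "g \<in> borel_measurable M"
    using assms by (auto simp: L2_def)
  have "integrable M (\<lambda>x. (cmod (f x))\<^sup>2) \<longleftrightarrow> integrable M (\<lambda>x. (cmod (g x))\<^sup>2)"
    using assms(3) by (intro integrable_cong_AE) auto
  then show "integrable M (\<lambda>x. (cmod (g x))\<^sup>2)" using assms L2_integrable by blast
qed fact

lemma norm_L2_nonneg [simp]: "0 \<le> norm_L2 M f"
  by (simp add: norm_L2_def)

lemma norm_L2_sq: "(norm_L2 M f)\<^sup>2 = (LINT x|M. (cmod (f x))\<^sup>2)"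
  by (simp add: norm_L2_def)

lemma norm_L2_eq_0_iff:
  assumes "f \<in> L2 M"
  shows "norm_L2 M f = 0 \<longleftrightarrow> (AE x in M. f x = 0)"
proof -
  have "norm_L2 M f = 0 \<longleftrightarrow> (LINT x|M. (cmod (f x))\<^sup>2) = 0"
    by (simp add: norm_L2_def)
  also have "\<dots> \<longleftrightarrow> (AE x in M. (cmod (f x))\<^sup>2 = 0)"
    using L2_integrable[OF assms] by (intro integral_nonneg_eq_0_iff_AE) auto
  finally show ?thesis by simp
qed

lemma norm_L2_cong_AE:
  assumes "f \<in> borel_measurable M" "g \<in> borel_measurable M" "AE x in M. f x = g x"
  shows "norm_L2 M f = norm_L2 M g"
  unfolding norm_L2_def using assms by (intro arg_cong[where f=sqrt] integral_cong_AE) auto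

lemma nn_integral_L2:
  "f \<in> L2 M \<Longrightarrow> (\<integral>\<^sup>+x. ennreal ((cmod (f x))\<^sup>2) \<partial>M) = ennreal ((norm_L2 M f)\<^sup>2)"
  unfolding norm_L2_sq by (intro nn_integral_eq_integral L2_integrable) auto

text \<open>Cauchy-Schwarz, taken from its version for nonnegative integrals. Integrability of the
  product identifies \<open>ennreal I\<close> with such an integral, after which squares are
  compared in the reals.\<close>

lemma LINT_cmod_mult_le:
  assumes "f \<in> L2 M" "g \<in> L2 M"
  shows "(LINT x|M. cmod (f x) * cmod (g x)) \<le> norm_L2 M f * norm_L2 M g"
proof -
  have [measurable]: "f \<in> borel_measurable M" "g \<in> borel_measurable M"
    using assms by (auto simp: L2_def)
  define I where "I = (LINT x|M. cmod (f x) * cmod (g x))"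
  have I: "0 \<le> I" unfolding I_def by (intro integral_nonneg_AE) auto
  have "integrable M (\<lambda>x. cmod (f x * g x))"
    by (intro integrable_norm L2_integrable_mult assms)
  then have "ennreal I = (\<integral>\<^sup>+x. ennreal (cmod (f x) * cmod (g x)) \<partial>M)"
    unfolding I_def by (intro nn_integral_eq_integral[symmetric]) (auto simp: norm_mult)
  also have "\<dots> = (\<integral>\<^sup>+x. ennreal (cmod (f x)) * ennreal (cmod (g x)) \<partial>M)"
    by (simp add: ennreal_mult)
  finally have "(ennreal I)\<^sup>2 = (\<integral>\<^sup>+x. ennreal (cmod (f x)) * ennreal (cmod (g x)) \<partial>M)\<^sup>2" by simp
  also have "\<dots> \<le> (\<integral>\<^sup>+x. (ennreal (cmod (f x)))\<^sup>2 \<partial>M) * (\<integral>\<^sup>+x. (ennreal (cmod (g x)))\<^sup>2 \<partial>M)"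
    by (intro Cauchy_Schwarz_nn_integral) auto
  also have "\<dots> = ennreal ((norm_L2 M f)\<^sup>2) * ennreal ((norm_L2 M g)\<^sup>2)"
    using nn_integral_L2[OF assms(1)] nn_integral_L2[OF assms(2)] by (simp add: ennreal_power)
  also have "\<dots> = ennreal ((norm_L2 M f * norm_L2 M g)\<^sup>2)"
    by (simp add: ennreal_mult power_mult_distrib)
  finally have "I\<^sup>2 \<le> (norm_L2 M f * norm_L2 M g)\<^sup>2"
    using I by (simp add: ennreal_power)
  then have "I \<le> norm_L2 M f * norm_L2 M g"
    by (rule power2_le_imp_le) (intro mult_nonneg_nonneg norm_L2_nonneg)
  then show ?thesis unfolding I_def .
qed

lemma norm_integral_mult_le:
  assumes "f \<in> L2 M" "g \<in> L2 M"
  shows "cmod (LINT x|M. f x * g x) \<le> norm_L2 M f * norm_L2 M g"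
proof -
  have "cmod (LINT x|M. f x * g x) \<le> (LINT x|M. cmod (f x * g x))"
    by (rule integral_norm_bound)
  also have "\<dots> \<le> norm_L2 M f * norm_L2 M g"
    using LINT_cmod_mult_le[OF assms] by (simp add: norm_mult)
  finally show ?thesis .
qed

lemma norm_L2_cnj [simp]: "norm_L2 M (\<lambda>x. cnj (f x)) = norm_L2 M f"
  by (simp add: norm_L2_def)

lemma norm_inner_L2_le:
  assumes "f \<in> L2 M" "g \<in> L2 M"
  shows "cmod (inner_L2 M f g) \<le> norm_L2 M f * norm_L2 M g"
  using norm_integral_mult_le[OF assms(1) L2_cnj[OF assms(2)]] by (simp add: inner_L2_def)

lemma inner_L2_cnj: "cnj (inner_L2 M f g) = inner_L2 M g f"
  unfolding inner_L2_def by (subst Bochner_Integration.integral_cnj[symmetric]) (simp add: mult.commute)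

lemma inner_L2_self: "inner_L2 M f f = complex_of_real ((norm_L2 M f)\<^sup>2)"
  unfolding inner_L2_def norm_L2_sq complex_norm_square[symmetric]
  by (simp only: integral_complex_of_real flip: of_real_power)

lemma inner_L2_add_left:
  "f \<in> L2 M \<Longrightarrow> g \<in> L2 M \<Longrightarrow> h \<in> L2 M \<Longrightarrow>
     inner_L2 M (\<lambda>x. f x + g x) h = inner_L2 M f h + inner_L2 M g h"
  unfolding inner_L2_def distrib_right
  by (intro Bochner_Integration.integral_add L2_integrable_mult L2_cnj)

lemma inner_L2_scale_left: "inner_L2 M (\<lambda>x. c * f x) g = c * inner_L2 M f g"
  unfolding inner_L2_def by (simp add: mult.assoc)

lemma inner_L2_cong_AE:
  assumes "f \<in> borel_measurable M" "f' \<in> borel_measurable M" "g \<in> borel_measurable M"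
    and "g' \<in> borel_measurable M" "AE x in M. f x = f' x" "AE x in M. g x = g' x"
  shows "inner_L2 M f g = inner_L2 M f' g'"
  unfolding inner_L2_def using assms by (intro integral_cong_AE) auto

lemma L2_imp_integrable:
  assumes "finite_measure M" "f \<in> L2 M"
  shows "integrable M f"
proof -
  interpret finite_measure M by fact
  have "(\<lambda>_. 1) \<in> L2 M" by (auto simp: L2_def)
  from L2_integrable_mult[OF assms(2) this] show ?thesis by simp
qed

lemma L2_bounded:
  fixes f :: "'a \<Rightarrow> complex"
  assumes "finite_measure M" "f \<in> borel_measurable M" "\<And>x. cmod (f x) \<le> C"
  shows "f \<in> L2 M"
proof (rule L2_I)
  interpret finite_measure M by fact
  show "integrable M (\<lambda>x. (cmod (f x))\<^sup>2)"
    using assms by (intro integrable_const_bound[where B="C\<^sup>2"]) (auto intro!: power_mono)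
qed fact

text \<open>Riesz-Fischer. On a finite measure space an L^2 Cauchy sequence is L^1 Cauchy, which
  provides a subsequence converging almost everywhere; Fatou then upgrades the pointwise limit to a
  limit in L^2.\<close>

lemma L2_complete:
  assumes M: "finite_measure M" and f: "\<And>n. f n \<in> L2 M"
    and Cauchy: "\<And>e. 0 < e \<Longrightarrow> \<exists>N. \<forall>m\<ge>N. \<forall>n\<ge>N. norm_L2 M (\<lambda>x. f m x - f n x) < e"
  shows "\<exists>g\<in>L2 M. (\<lambda>n. norm_L2 M (\<lambda>x. f n x - g x)) \<longlonglongrightarrow> 0"
proof -
  interpret finite_measure M by fact
  have [measurable]: "\<And>n. f n \<in> borel_measurable M" using f by (auto simp: L2_def)
  \<comment> \<open>Compares the L^1 with the L^2 norm; adding 1 keeps it positive even for the zero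
    measure, so that it can be divided by.\<close>
  define K where "K = norm_L2 M (\<lambda>_. 1) + 1"
  have K: "0 < K" unfolding K_def by (simp add: add_nonneg_pos)
  have one: "(\<lambda>_. 1) \<in> L2 M" by (rule L2_bounded[OF M, of _ 1]) auto
  have L1: "(LINT x|M. norm (f i x - f j x)) \<le> K * norm_L2 M (\<lambda>x. f i x - f j x)" for i j
  proof -
    have "(LINT x|M. norm (f i x - f j x)) \<le> norm_L2 M (\<lambda>x. f i x - f j x) * norm_L2 M (\<lambda>_. 1)"
      using LINT_cmod_mult_le[OF L2_diff[OF f f] one] by simp
    also have "\<dots> \<le> norm_L2 M (\<lambda>x. f i x - f j x) * K"
      unfolding K_def by (intro mult_left_mono) auto
    finally show ?thesis by (simp add: mult.commute)
  qed
  obtain r where r: "strict_mono r" and ae: "AE x in M. Cauchy (\<lambda>i. f (r i) x)"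
  proof (rule cauchy_L1_AE_cauchy_subseq[of M f])
    show "integrable M (f n)" for n by (rule L2_imp_integrable[OF M f])
    fix e :: real assume "0 < e"
    then obtain N where N: "\<forall>m\<ge>N. \<forall>n\<ge>N. norm_L2 M (\<lambda>x. f m x - f n x) < e / K"
      using Cauchy[of "e / K"] K by auto
    have "(LINT x|M. norm (f i x - f j x)) < e" if "i \<ge> N" "j \<ge> N" for i j
    proof -
      have "K * norm_L2 M (\<lambda>x. f i x - f j x) < K * (e / K)"
        using K N that by (intro mult_strict_left_mono) auto
      with L1[of i j] K show ?thesis by simp
    qed
    then show "\<exists>N. \<forall>i\<ge>N. \<forall>j\<ge>N. LINT x|M. norm (f i x - f j x) < e" by blast
  qed
  define g where "g x = lim (\<lambda>i. f (r i) x)" for x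
  have [measurable]: "g \<in> borel_measurable M"
    unfolding g_def by measurable
  have lim: "AE x in M. (\<lambda>i. f (r i) x) \<longlonglongrightarrow> g x"
    using ae unfolding g_def by eventually_elim (simp add: Cauchy_convergent_iff convergent_LIMSEQ_iff)
  \<comment> \<open>The first index stays fixed at m while the second runs through \<open>r\<close>;
    the lower limit inherits the Cauchy bound. Both the membership of f m - g in L^2 and the
    convergence come from this estimate.\<close>
  have Fatou: "(\<integral>\<^sup>+x. ennreal ((cmod (f m x - g x))\<^sup>2) \<partial>M) \<le> ennreal (e\<^sup>2)"
    if e: "0 < e" and N: "\<forall>m\<ge>N. \<forall>n\<ge>N. norm_L2 M (\<lambda>x. f m x - f n x) < e" and m: "m \<ge> N" for e m N
  proof -
    have "(\<integral>\<^sup>+x. ennreal ((cmod (f m x - g x))\<^sup>2) \<partial>M)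
        = (\<integral>\<^sup>+x. liminf (\<lambda>i. ennreal ((cmod (f m x - f (r i) x))\<^sup>2)) \<partial>M)"
    proof (rule nn_integral_cong_AE)
      show "AE x in M. ennreal ((cmod (f m x - g x))\<^sup>2) = liminf (\<lambda>i. ennreal ((cmod (f m x - f (r i) x))\<^sup>2))"
        using lim
      proof eventually_elim
        case (elim x)
        have "(\<lambda>i. ennreal ((cmod (f m x - f (r i) x))\<^sup>2)) \<longlonglongrightarrow> ennreal ((cmod (f m x - g x))\<^sup>2)"
          using elim by (intro tendsto_ennrealI tendsto_intros)
        then show ?case by (rule lim_imp_Liminf[OF sequentially_bot, symmetric])
      qed
    qed
    also have "\<dots> \<le> liminf (\<lambda>i. \<integral>\<^sup>+x. ennreal ((cmod (f m x - f (r i) x))\<^sup>2) \<partial>M)"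
      by (intro nn_integral_liminf) auto
    also have "\<dots> \<le> ennreal (e\<^sup>2)"
    proof (rule Liminf_le)
      have "eventually (\<lambda>i. r i \<ge> N) sequentially"
        using filterlim_subseq[OF r] unfolding filterlim_at_top by blast
      then show "\<forall>\<^sub>F i in sequentially. (\<integral>\<^sup>+x. ennreal ((cmod (f m x - f (r i) x))\<^sup>2) \<partial>M) \<le> ennreal (e\<^sup>2)"
      proof eventually_elim
        case (elim i)
        then have "norm_L2 M (\<lambda>x. f m x - f (r i) x) \<le> e" using N m by (simp add: less_imp_le)
        then show ?case
          unfolding nn_integral_L2[OF L2_diff[OF f f]] by (intro ennreal_leI power_mono) auto
      qed
    qed simp
    finally show ?thesis .
  qed
  have diff: "(\<lambda>x. f m x - g x) \<in> L2 M"
    if e: "0 < e" and N: "\<forall>m\<ge>N. \<forall>n\<ge>N. norm_L2 M (\<lambda>x. f m x - f n x) < e" and m: "m \<ge> N" for e m N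
  proof (rule L2_I)
    show "integrable M (\<lambda>x. (cmod (f m x - g x))\<^sup>2)"
      unfolding integrable_iff_bounded using Fatou[OF that] ennreal_less_top
      by (auto intro: le_less_trans)
  qed simp
  obtain N where N: "\<forall>m\<ge>N. \<forall>n\<ge>N. norm_L2 M (\<lambda>x. f m x - f n x) < 1" using Cauchy[of 1] by auto
  \<comment> \<open>\<open>g\<close> is \<open>f N\<close> minus the difference of
    \<open>f N\<close> and \<open>g\<close>, and both are in L^2.\<close>
  from L2_diff[OF f diff[OF _ this, of N], of N] have g: "g \<in> L2 M" by simp
  have "(\<lambda>n. norm_L2 M (\<lambda>x. f n x - g x)) \<longlonglongrightarrow> 0"
  proof (rule LIMSEQ_I)
    fix e :: real assume e: "0 < e"
    then obtain N where N: "\<forall>m\<ge>N. \<forall>n\<ge>N. norm_L2 M (\<lambda>x. f m x - f n x) < e/2" using Cauchy[of "e/2"] by auto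
    have "norm_L2 M (\<lambda>x. f n x - g x) \<le> e/2" if "n \<ge> N" for n
    proof -
      have "ennreal ((norm_L2 M (\<lambda>x. f n x - g x))\<^sup>2) \<le> ennreal ((e/2)\<^sup>2)"
        using Fatou[OF _ N that] e unfolding nn_integral_L2[OF L2_diff[OF f g]] by simp
      then have "(norm_L2 M (\<lambda>x. f n x - g x))\<^sup>2 \<le> (e/2)\<^sup>2" by simp
      then show ?thesis by (rule power2_le_imp_le) (use e in simp)
    qed
    then show "\<exists>no. \<forall>n\<ge>no. norm (norm_L2 M (\<lambda>x. f n x - g x) - 0) < e" using e by (intro exI[of _ N]) force
  qed
  with g show ?thesis by blast
qed

section \<open>Test functions and the fundamental lemma\<close>

text \<open>Generalises the classical flat function exp(-1/y): the polynomial in 1/y makes the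
  family closed under differentiation, so that one derivative computation yields smoothness of every
  order.\<close>

definition flat_fun :: "real poly \<Rightarrow> real \<Rightarrow> real" where
  "flat_fun p y = (if 0 < y then poly p (1 / y) * exp (- (1 / y)) else 0)"

lemma power_poly_exp_tendsto_0:
  "((\<lambda>z::real. z ^ k * poly p z * exp (- z)) \<longlongrightarrow> 0) at_top"
proof (induction p arbitrary: k)
  case 0
  then show ?case by simp
next
  case (pCons a p)
  have "((\<lambda>z::real. a * (z ^ k / exp z) + z ^ Suc k * poly p z * exp (- z)) \<longlongrightarrow> a * 0 + 0) at_top"
    by (intro tendsto_add tendsto_mult tendsto_const tendsto_power_div_exp_0 pCons.IH)
  then show ?case by (simp add: exp_minus field_simps)
qed

text \<open>The quotient is the difference quotient at 0, as \<open>flat_fun p 0 = 0\<close>. On the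
  right, z = 1/y turns it into z p(z) exp(-z) at infinity.\<close>

lemma flat_fun_tendsto_0: "((\<lambda>y. flat_fun p y / y) \<longlongrightarrow> 0) (at 0)"
proof (rule filterlim_split_at)
  show "((\<lambda>y. flat_fun p y / y) \<longlongrightarrow> 0) (at_left 0)"
    by (rule tendsto_eventually) (simp add: flat_fun_def eventually_at_filter)
  have "((\<lambda>y::real. inverse y ^ 1 * poly p (inverse y) * exp (- inverse y)) \<longlongrightarrow> 0) (at_right 0)"
    by (rule filterlim_compose[OF power_poly_exp_tendsto_0 filterlim_inverse_at_top_right])
  then show "((\<lambda>y. flat_fun p y / y) \<longlongrightarrow> 0) (at_right 0)"
  proof (rule Lim_transform_eventually)
    show "\<forall>\<^sub>F y in at_right 0. inverse y ^ 1 * poly p (inverse y) * exp (- inverse y) = flat_fun p y / y"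
      using eventually_at_right_less[of "0::real"]
      by eventually_elim (simp add: flat_fun_def field_simps)
  qed
qed

text \<open>In the variable z = 1/y, d/dy is -z^2 d/dz, and d/dz maps p exp(-z) to (p' - p) exp(-z).
  The polynomial \<open>[:0, 0, 1:]\<close> is the factor z^2.\<close>

lemma flat_fun_has_derivative:
  "(flat_fun p has_real_derivative flat_fun ([:0, 0, 1:] * (p - pderiv p)) y) (at y)"
proof -
  consider "y < 0" | "y = 0" | "0 < y" by linarith
  then show ?thesis
  proof cases
    case 1
    have "((\<lambda>_. 0) has_real_derivative 0) (at y)" by simp
    then have "(flat_fun p has_real_derivative 0) (at y)"
      by (rule DERIV_cong_ev[THEN iffD1, rotated -1])
        (auto simp: flat_fun_def eventually_nhds intro!: exI[of _ "{..<0}"] 1)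
    then show ?thesis using 1 by (simp add: flat_fun_def)
  next
    case 2
    then show ?thesis using flat_fun_tendsto_0[of p]
      by (simp add: has_field_derivative_iff flat_fun_def)
  next
    case 3
    have "((\<lambda>y. poly p (1 / y) * exp (- (1 / y))) has_real_derivative
        flat_fun ([:0, 0, 1:] * (p - pderiv p)) y) (at y)"
      using 3 by (auto simp: flat_fun_def power2_eq_square field_simps intro!: derivative_eq_intros)
    then show ?thesis
      by (rule DERIV_cong_ev[THEN iffD1, rotated -1])
        (auto simp: flat_fun_def eventually_nhds intro!: exI[of _ "{0<..}"] 3)
  qed
qed

text \<open>An algebraic class closed under differentiation, so derivatives of all orders exist
  without being written down. The affine argument, with c of either sign, allows cut-offs facing
  left and right.\<close>

inductive smooth1 :: "(real \<Rightarrow> real) \<Rightarrow> bool" where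
  flat: "smooth1 (\<lambda>x. flat_fun p (c * x + d))"
| add: "smooth1 a \<Longrightarrow> smooth1 b \<Longrightarrow> smooth1 (\<lambda>x. a x + b x)"
| mult: "smooth1 a \<Longrightarrow> smooth1 b \<Longrightarrow> smooth1 (\<lambda>x. a x * b x)"

lemma smooth1_has_derivative:
  assumes "smooth1 a"
  shows "\<exists>a'. smooth1 a' \<and> (\<forall>x. (a has_real_derivative a' x) (at x))"
  using assms
proof induction
  case (flat p c d)
  \<comment> \<open>The inner derivative c is absorbed into the polynomial, so the derivative is
    again a generator.\<close>
  have "((\<lambda>x. flat_fun p (c * x + d)) has_real_derivative
      flat_fun (smult c ([:0, 0, 1:] * (p - pderiv p))) (c * x + d)) (at x)" for x
  proof -
    have "((\<lambda>x. flat_fun p (c * x + d)) has_real_derivative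
      flat_fun ([:0, 0, 1:] * (p - pderiv p)) (c * x + d) * c) (at x)"
      by (rule DERIV_chain2[OF flat_fun_has_derivative]) (auto intro!: derivative_eq_intros)
    then show ?thesis by (rule DERIV_cong) (simp add: flat_fun_def)
  qed
  then show ?case using smooth1.flat by blast
next
  case (add a b)
  then obtain a' b' where d: "smooth1 a'" "smooth1 b'" "\<And>x. (a has_real_derivative a' x) (at x)"
    "\<And>x. (b has_real_derivative b' x) (at x)" by blast
  show ?case
    by (intro exI[of _ "\<lambda>x. a' x + b' x"] conjI allI smooth1.add DERIV_add d)
next
  case (mult a b)
  then obtain a' b' where d: "smooth1 a'" "smooth1 b'" "\<And>x. (a has_real_derivative a' x) (at x)"
    "\<And>x. (b has_real_derivative b' x) (at x)" by blast
  show ?case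
    by (intro exI[of _ "\<lambda>x. a' x * b x + b' x * a x"] conjI allI smooth1.add smooth1.mult DERIV_mult d mult.hyps)
qed

text \<open>A partial derivative of a product in separated variables is such a product again, with
  one factor replaced by its derivative in \<open>smooth1\<close>; hence the induction on n with
  arbitrary factors.\<close>

lemma Ck_product:
  assumes "smooth1 a" "smooth1 b"
  shows "Ck n (\<lambda>x::real^2. complex_of_real (a (x $ 1) * b (x $ 2)))"
  using assms
proof (induction n arbitrary: a b)
  case 0
  then obtain a' b' where "\<And>x. (a has_real_derivative a' x) (at x)"
    "\<And>x. (b has_real_derivative b' x) (at x)" using smooth1_has_derivative by blast
  then have "continuous_on UNIV a" "continuous_on UNIV b"
    by (auto intro: DERIV_continuous_on has_field_derivative_at_within)
  then have "continuous_on UNIV (\<lambda>x::real^2. a (x $ 1))" "continuous_on UNIV (\<lambda>x::real^2. b (x $ 2))"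
    by (auto intro!: continuous_on_compose2[where f="\<lambda>x::real^2. x $ _"] continuous_intros)
  then show ?case by (auto intro!: continuous_intros)
next
  case (Suc n)
  obtain a' where a': "smooth1 a'" "\<And>x. (a has_real_derivative a' x) (at x)"
    using smooth1_has_derivative[OF Suc.prems(1)] by blast
  obtain b' where b': "smooth1 b'" "\<And>x. (b has_real_derivative b' x) (at x)"
    using smooth1_has_derivative[OF Suc.prems(2)] by blast
  note s = a'(1) b'(1) and d = a'(2) b'(2)
  let ?f = "\<lambda>x::real^2. complex_of_real (a (x $ 1) * b (x $ 2))"
  have der: "(?f has_derivative (\<lambda>h. complex_of_real (a' (x $ 1) * h $ 1 * b (x $ 2) + a (x $ 1) * (b' (x $ 2) * h $ 2)))) (at x)" for x
  proof -
    have c: "((\<lambda>x::real^2. x $ i) has_derivative (\<lambda>h. h $ i)) (at x)" for i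
      by (intro bounded_linear_imp_has_derivative bounded_linear_vec_nth)
    have 1: "((\<lambda>x::real^2. a (x $ 1)) has_derivative (\<lambda>h. a' (x $ 1) * h $ 1)) (at x)"
      using has_derivative_compose[OF c d(1)[of "x $ 1", unfolded has_field_derivative_def]] .
    have 2: "((\<lambda>x::real^2. b (x $ 2)) has_derivative (\<lambda>h. b' (x $ 2) * h $ 2)) (at x)"
      using has_derivative_compose[OF c d(2)[of "x $ 2", unfolded has_field_derivative_def]] .
    show ?thesis
      using has_derivative_of_real[OF has_derivative_mult[OF 1 2], where 'a=complex] by (simp add: algebra_simps)
  qed
  have fd: "frechet_derivative ?f (at x) = (\<lambda>h. complex_of_real (a' (x $ 1) * h $ 1 * b (x $ 2) + a (x $ 1) * (b' (x $ 2) * h $ 2)))" for x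
    using frechet_derivative_at[OF der[of x]] by simp
  have "partial_deriv 1 ?f = (\<lambda>x. complex_of_real (a' (x $ 1) * b (x $ 2)))"
    "partial_deriv 2 ?f = (\<lambda>x. complex_of_real (a (x $ 1) * b' (x $ 2)))"
    unfolding partial_deriv_def fd by (auto simp: fun_eq_iff axis_def)
  then have "Ck n (partial_deriv i ?f)" for i
    using exhaust_2[of i] Suc.IH[OF s(1) Suc.prems(2)] Suc.IH[OF Suc.prems(1) s(2)] by auto
  then show ?case using der by (auto simp: differentiable_def)
qed

text \<open>The arguments are n (t - l) and n (r - t), so the product lives on l < t < r. Scaling by
  n sends exp(-1/(n s)) to 1 for s > 0: the bumps converge to the indicator of the open
  interval.\<close>

definition bump :: "real \<Rightarrow> real \<Rightarrow> nat \<Rightarrow> real \<Rightarrow> real" where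
  "bump l r n t = flat_fun 1 (real n * t + (- (real n * l))) * flat_fun 1 (- real n * t + real n * r)"

lemma smooth1_bump: "smooth1 (bump l r n)"
  unfolding bump_def[abs_def] by (intro smooth1.mult smooth1.flat)

lemma flat_fun_1: "flat_fun 1 y = (if 0 < y then exp (- (1 / y)) else 0)"
  by (simp add: flat_fun_def)

lemma bump_bounds: "0 \<le> bump l r n t" "bump l r n t \<le> 1"
  unfolding bump_def flat_fun_1 by (auto simp: mult_le_one)

lemma bump_nonzero: "bump l r n t \<noteq> 0 \<Longrightarrow> l < t \<and> t < r"
  unfolding bump_def flat_fun_1
  by (auto simp: mult_less_cancel_left split: if_splits)

lemma flat_fun_1_tendsto:
  assumes "0 < s"
  shows "(\<lambda>n. flat_fun 1 (real n * s)) \<longlonglongrightarrow> 1"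
proof -
  have "(\<lambda>n. exp (- (1 / s * inverse (real n)))) \<longlonglongrightarrow> exp (- (1 / s * 0))"
    by (intro tendsto_exp tendsto_minus tendsto_mult tendsto_const lim_inverse_n)
  then have "(\<lambda>n. exp (- (1 / s * inverse (real n)))) \<longlonglongrightarrow> 1" by simp
  then show ?thesis
  proof (rule Lim_transform_eventually)
    show "\<forall>\<^sub>F n in sequentially. exp (- (1 / s * inverse (real n))) = flat_fun 1 (real n * s)"
      using eventually_gt_at_top[of "0::nat"]
      by eventually_elim (use assms in \<open>simp add: flat_fun_1 field_simps\<close>)
  qed
qed

lemma bump_tendsto:
  assumes "l < t" "t < r"
  shows "(\<lambda>n. bump l r n t) \<longlonglongrightarrow> 1"
proof -
  have "(\<lambda>n. flat_fun 1 (real n * (t - l)) * flat_fun 1 (real n * (r - t))) \<longlonglongrightarrow> 1 * 1"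
    using assms by (intro tendsto_mult flat_fun_1_tendsto) auto
  then show ?thesis by (simp add: bump_def algebra_simps)
qed

definition box_bump :: "real^2 \<Rightarrow> real^2 \<Rightarrow> nat \<Rightarrow> real^2 \<Rightarrow> complex" where
  "box_bump a b n x = complex_of_real (bump (a $ 1) (b $ 1) n (x $ 1) * bump (a $ 2) (b $ 2) n (x $ 2))"

lemma box_bump_zero:
  assumes "x \<notin> box a b" shows "box_bump a b n x = 0"
proof (rule ccontr)
  assume "box_bump a b n x \<noteq> 0"
  then have "x \<in> box a b"
    using bump_nonzero unfolding box_bump_def by (auto simp: mem_box_cart forall_2)
  with assms show False by simp
qed

text \<open>The function is nonzero only in the open box, so its closed support is confined to
  \<open>cbox a b\<close>; this is why the closed box has to lie in U.\<close>

lemma box_bump_test: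
  assumes "cbox a b \<subseteq> U"
  shows "box_bump a b n \<in> test_functions U"
proof -
  have sub: "closure {x. box_bump a b n x \<noteq> 0} \<subseteq> cbox a b"
    by (rule closure_minimal) (use box_bump_zero box_subset_cbox in fast)+
  then have "compact (closure {x. box_bump a b n x \<noteq> 0})"
    using closed_Int_compact[of "closure {x. box_bump a b n x \<noteq> 0}" "cbox a b"] compact_cbox
    by (simp add: Int_absorb2)
  with sub assms show ?thesis
    unfolding test_functions_def using Ck_product[OF smooth1_bump smooth1_bump]
    by (auto simp: box_bump_def[abs_def])
qed

lemma norm_box_bump: "cmod (box_bump a b n x) \<le> 1"
  unfolding box_bump_def norm_of_real using bump_bounds by (simp add: abs_mult mult_le_one)

lemma box_bump_tendsto: "(\<lambda>n. box_bump a b n x) \<longlonglongrightarrow> indicator (box a b) x"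
proof (cases "x \<in> box a b")
  case True
  then have "(\<lambda>n. complex_of_real (bump (a $ 1) (b $ 1) n (x $ 1) * bump (a $ 2) (b $ 2) n (x $ 2))) \<longlonglongrightarrow> complex_of_real (1 * 1)"
    by (intro tendsto_of_real tendsto_mult bump_tendsto) (auto simp: mem_box_cart)
  then show ?thesis using True by (simp add: box_bump_def)
next
  case False
  then show ?thesis by (simp add: box_bump_zero)
qed

lemma Ck_continuous: "\<forall>n. Ck n \<phi> \<Longrightarrow> continuous_on UNIV \<phi>"
  using Ck.simps(1) by blast

lemma test_functions_continuous: "\<phi> \<in> test_functions U \<Longrightarrow> continuous_on UNIV \<phi>"
  by (simp add: test_functions_def Ck_continuous)

lemma test_functions_measurable: "\<phi> \<in> test_functions U \<Longrightarrow> \<phi> \<in> borel_measurable borel"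
  by (intro borel_measurable_continuous_onI test_functions_continuous)

lemma borel_measurable_lebesgue_on:
  "f \<in> borel_measurable borel \<Longrightarrow> f \<in> borel_measurable (lebesgue_on U)"
  by (simp add: borel_measurable_if_D measurable_completion measurable_restrict_space1)

text \<open>The positive and negative parts of f, taken as densities, give finite and equal mass to
  every open box. Boxes are stable under intersection and generate the Borel sets, so the two
  measures coincide, and with them the two parts almost everywhere.\<close>

lemma AE_zero_of_box_integrals:
  fixes f :: "'a::euclidean_space \<Rightarrow> real"
  assumes f: "integrable lborel f"
    and zero: "\<And>a b. (LINT x|lborel. indicator (box a b) x * f x) = 0"
  shows "AE x in lborel. f x = 0"
proof -
  have [measurable]: "f \<in> borel_measurable borel" using f by auto
  let ?M1 = "density lborel (\<lambda>x. ennreal (f x))"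
  let ?M2 = "density lborel (\<lambda>x. ennreal (- f x))"
  have fin: "(\<integral>\<^sup>+x. ennreal (g x) \<partial>lborel) < \<infinity>" if "integrable lborel g" for g :: "'a \<Rightarrow> real"
  proof -
    have "(\<integral>\<^sup>+x. ennreal (g x) \<partial>lborel) \<le> (\<integral>\<^sup>+x. ennreal (norm (g x)) \<partial>lborel)"
      by (intro nn_integral_mono ennreal_leI) auto
    also have "\<dots> < \<infinity>" using that unfolding integrable_iff_bounded by simp
    finally show ?thesis .
  qed
  have eq: "emeasure ?M1 (box a b) = emeasure ?M2 (box a b) \<and> emeasure ?M1 (box a b) < \<infinity>" for a b
  proof -
    let ?g = "\<lambda>x. indicator (box a b) x * f x"
    have int: "integrable lborel ?g" using integrable_mult_indicator[OF _ f, of "box a b"] by simp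
    have 1: "emeasure ?M1 (box a b) = (\<integral>\<^sup>+x. ennreal (?g x) \<partial>lborel)"
      by (subst emeasure_density) (auto intro!: nn_integral_cong split: split_indicator)
    have 2: "emeasure ?M2 (box a b) = (\<integral>\<^sup>+x. ennreal (- ?g x) \<partial>lborel)"
      by (subst emeasure_density) (auto intro!: nn_integral_cong split: split_indicator)
    have "enn2real (\<integral>\<^sup>+x. ennreal (?g x) \<partial>lborel) = enn2real (\<integral>\<^sup>+x. ennreal (- ?g x) \<partial>lborel)"
      using zero[of a b] real_lebesgue_integral_def[OF int] by simp
    moreover have "(\<integral>\<^sup>+x. ennreal (?g x) \<partial>lborel) < \<infinity>" by (rule fin[OF int])
    moreover have "(\<integral>\<^sup>+x. ennreal (- ?g x) \<partial>lborel) < \<infinity>" by (rule fin) (use int in simp)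
    ultimately show ?thesis unfolding 1 2
      by (cases "\<integral>\<^sup>+x. ennreal (?g x) \<partial>lborel"; cases "\<integral>\<^sup>+x. ennreal (- ?g x) \<partial>lborel") auto
  qed
  have "?M1 = ?M2"
  proof (rule measure_eqI_generator_eq)
    let ?E = "range (\<lambda>(a, b). box a b::'a set)"
    show "Int_stable ?E" by (auto simp: Int_stable_def box_Int_box)
    show "?E \<subseteq> Pow UNIV" "sets ?M1 = sigma_sets UNIV ?E" "sets ?M2 = sigma_sets UNIV ?E"
      by (simp_all add: borel_eq_box)
    let ?A = "\<lambda>n::nat. box (- (real n *\<^sub>R One)) (real n *\<^sub>R One) :: 'a set"
    show "range ?A \<subseteq> ?E" "(\<Union>i. ?A i) = UNIV" unfolding UN_box_eq_UNIV by auto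
    show "emeasure ?M1 (?A i) \<noteq> \<infinity>" for i using eq[of "- (real i *\<^sub>R One)" "real i *\<^sub>R One"] by (metis less_irrefl infinity_ennreal_def)
    show "emeasure ?M1 X = emeasure ?M2 X" if "X \<in> ?E" for X using that eq by auto
  qed
  then have "AE x in lborel. ennreal (f x) = ennreal (- f x)"
    using fin[OF f] by (subst (asm) finite_density_unique) auto
  then show ?thesis
  proof eventually_elim
    case (elim x)
    show ?case
    proof (cases "0 \<le> f x")
      case True
      then have "ennreal (- f x) = 0" by (simp add: ennreal_neg)
      with elim True show ?thesis by (simp add: ennreal_eq_0_iff)
    next
      case False
      then have "ennreal (f x) = 0" by (simp add: ennreal_neg)
      with elim False show ?thesis by (simp add: ennreal_eq_0_iff)
    qed
  qed
qed

lemma AE_zero_of_box_integrals_lebesgue: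
  fixes f :: "'a::euclidean_space \<Rightarrow> real"
  assumes f: "integrable lebesgue f"
    and zero: "\<And>a b. (LINT x|lebesgue. indicator (box a b) x * f x) = 0"
  shows "AE x in lebesgue. f x = 0"
proof -
  from f have "f \<in> borel_measurable lebesgue" by auto
  then obtain g where g: "g \<in> borel_measurable lborel" and ae: "AE x in lborel. f x = g x"
    using completion_ex_borel_measurable_real by blast
  note [measurable] = g[unfolded measurable_lborel1]
  have gm: "g \<in> borel_measurable lebesgue" by (rule measurable_completion[OF g])
  have ae': "AE x in lebesgue. f x = g x" using ae by (rule AE_completion)
  have "integrable lebesgue g"
    using f ae' gm by (subst integrable_cong_AE[symmetric, of f]) auto
  then have "integrable lborel g" using g by (simp add: integrable_completion)
  moreover have "(LINT x|lborel. indicator (box a b) x * g x) = 0" for a b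
  proof -
    have [measurable]: "box a b \<in> sets lebesgue" by simp
    note [measurable] = gm \<open>f \<in> borel_measurable lebesgue\<close>
    have "(LINT x|lborel. indicator (box a b) x * g x) = (LINT x|lebesgue. indicator (box a b) x * g x)"
      by (rule integral_completion[symmetric]) simp
    also have "\<dots> = (LINT x|lebesgue. indicator (box a b) x * f x)"
      using ae' by (intro integral_cong_AE) auto
    finally show ?thesis using zero by simp
  qed
  ultimately have "AE x in lborel. g x = 0" by (rule AE_zero_of_box_integrals)
  then have "AE x in lebesgue. g x = 0" by (rule AE_completion)
  with ae' show ?thesis by eventually_elim simp
qed

lemma test_functions_bounded:
  assumes "\<phi> \<in> test_functions U"
  obtains C where "\<And>x. cmod (\<phi> x) \<le> C"
proof -
  have "compact (\<phi> ` closure {x. \<phi> x \<noteq> 0})"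
    using assms test_functions_continuous[OF assms]
    by (intro compact_continuous_image) (auto simp: test_functions_def intro: continuous_on_subset)
  then obtain C where C: "\<And>x. x \<in> closure {x. \<phi> x \<noteq> 0} \<Longrightarrow> cmod (\<phi> x) \<le> C"
    by (meson bounded_iff compact_imp_bounded imageI)
  have "cmod (\<phi> x) \<le> max C 0" for x
    using C[of x] closure_subset[of "{x. \<phi> x \<noteq> 0}"] by (cases "\<phi> x = 0") (auto simp: le_max_iff_disj)
  then show ?thesis by (rule that)
qed

lemma indicator_scaleR_complex: "indicator A x *\<^sub>R z = indicator A x * (z::complex)"
  by (simp split: split_indicator)

text \<open>Bumps turn the hypothesis into vanishing integrals over boxes whose closure lies in U,
  by dominated convergence with majorant |h|. Localising to one closed box in U makes the criterion
  for boxes of the whole space applicable, and countably many closed boxes exhaust U.\<close>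

lemma fundamental_lemma:
  fixes h :: "real^2 \<Rightarrow> complex"
  assumes U: "open U" and h: "integrable (lebesgue_on U) h"
    and zero: "\<And>\<phi>. \<phi> \<in> test_functions U \<Longrightarrow> (LINT x|lebesgue_on U. h x * \<phi> x) = 0"
  shows "AE x in lebesgue_on U. h x = 0"
proof -
  have Us: "U \<in> sets lebesgue" using U by simp
  define H where "H x = (if x \<in> U then h x else 0)" for x
  have H: "integrable lebesgue H"
    unfolding H_def using Lebesgue_Measure.integrable_restrict_UNIV[OF Us] h by blast
  have box0: "(LINT x|lebesgue. indicator (box a b) x * H x) = 0" if ab: "cbox a b \<subseteq> U" for a b
  proof -
    have bs: "box a b \<subseteq> U" using ab box_subset_cbox by blast
    have "(\<lambda>n. LINT x|lebesgue_on U. h x * box_bump a b n x) \<longlonglongrightarrow> (LINT x|lebesgue_on U. h x * indicator (box a b) x)"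
    proof (rule integral_dominated_convergence)
      show "integrable (lebesgue_on U) (\<lambda>x. cmod (h x))" using h by simp
      show "AE x in lebesgue_on U. (\<lambda>n. h x * box_bump a b n x) \<longlonglongrightarrow> h x * indicator (box a b) x"
        by (intro AE_I2 tendsto_mult tendsto_const box_bump_tendsto)
      show "AE x in lebesgue_on U. norm (h x * box_bump a b n x) \<le> cmod (h x)" for n
        using norm_box_bump by (auto simp: norm_mult intro!: mult_left_le)
      show "(\<lambda>x. h x * indicator (box a b) x) \<in> borel_measurable (lebesgue_on U)"
        by (intro borel_measurable_times borel_measurable_integrable[OF h]
          borel_measurable_lebesgue_on borel_measurable_indicator) auto
      show "(\<lambda>x. h x * box_bump a b n x) \<in> borel_measurable (lebesgue_on U)" for n
        by (intro borel_measurable_times borel_measurable_integrable[OF h]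
          borel_measurable_lebesgue_on test_functions_measurable[OF box_bump_test[OF ab]])
    qed
    then have "(LINT x|lebesgue_on U. h x * indicator (box a b) x) = 0"
      using zero[OF box_bump_test[OF ab]] by (simp add: LIMSEQ_const_iff)
    also have "(LINT x|lebesgue_on U. h x * indicator (box a b) x)
        = (LINT x|lebesgue. (if x \<in> U then h x * indicator (box a b) x else 0))"
      by (rule Lebesgue_Measure.integral_restrict_UNIV[symmetric, OF Us])
    also have "\<dots> = (LINT x|lebesgue. indicator (box a b) x * H x)"
      by (intro Bochner_Integration.integral_cong) (auto simp: H_def)
    finally show ?thesis .
  qed
  \<comment> \<open>Only boxes inside U are controlled so far. Multiplying \<open>H\<close> by the
    indicator of \<open>box l r\<close> replaces an arbitrary box by its intersection with this one,
    which is again a box with closure in U.\<close>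
  have part: "AE x in lebesgue. x \<in> cbox l r \<longrightarrow> H x = 0" if lr: "cbox l r \<subseteq> U" for l r
  proof -
    have int: "integrable lebesgue (\<lambda>x. indicator (box l r) x * H x)"
      using integrable_mult_indicator[OF lmeasurable_box[THEN fmeasurableD] H, of l r] by (simp only: indicator_scaleR_complex)
    have z: "(LINT x|lebesgue. indicator (box a b) x * (indicator (box l r) x * H x)) = 0" for a b
    proof -
      obtain c d where cd: "box a b \<inter> box l r = box c d" "cbox a b \<inter> cbox l r = cbox c d"
        unfolding box_Int_box Int_interval by blast
      then have "cbox c d \<subseteq> U" using lr by blast
      from box0[OF this] show ?thesis
        unfolding cd(1)[symmetric] by (simp only: indicator_inter_arith mult.assoc)
    qed
    have int2: "integrable lebesgue (\<lambda>x. indicator (box a b) x * (indicator (box l r) x * H x))" for a b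
      using integrable_mult_indicator[OF lmeasurable_box[THEN fmeasurableD] int, of a b] by (simp only: indicator_scaleR_complex)
    have "AE x in lebesgue. Re (indicator (box l r) x * H x) = 0"
    proof (rule AE_zero_of_box_integrals_lebesgue)
      show "integrable lebesgue (\<lambda>x. Re (indicator (box l r) x * H x))" using int by (rule integrable_Re)
      show "(LINT x|lebesgue. indicator (box a b) x * Re (indicator (box l r) x * H x)) = 0" for a b
      proof -
        have "(LINT x|lebesgue. indicator (box a b) x * Re (indicator (box l r) x * H x))
            = (LINT x|lebesgue. Re (indicator (box a b) x * (indicator (box l r) x * H x)))"
          by (intro Bochner_Integration.integral_cong) (auto split: split_indicator)
        also have "\<dots> = 0" using integral_Re[OF int2] z by simp
        finally show ?thesis .
      qed
    qed
    moreover have "AE x in lebesgue. Im (indicator (box l r) x * H x) = 0"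
    proof (rule AE_zero_of_box_integrals_lebesgue)
      show "integrable lebesgue (\<lambda>x. Im (indicator (box l r) x * H x))" using int by (rule integrable_Im)
      show "(LINT x|lebesgue. indicator (box a b) x * Im (indicator (box l r) x * H x)) = 0" for a b
      proof -
        have "(LINT x|lebesgue. indicator (box a b) x * Im (indicator (box l r) x * H x))
            = (LINT x|lebesgue. Im (indicator (box a b) x * (indicator (box l r) x * H x)))"
          by (intro Bochner_Integration.integral_cong) (auto split: split_indicator)
        also have "\<dots> = 0" using integral_Im[OF int2] z by simp
        finally show ?thesis .
      qed
    qed
    \<comment> \<open>The criterion concerns the open box only; the faces form a null set.\<close>
    moreover have "AE x in lebesgue. x \<notin> cbox l r - box l r"
      by (intro AE_completion AE_not_in null_sets_cbox_Diff_box)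
    ultimately show ?thesis
      by eventually_elim (auto simp: complex_eq_iff)
  qed
  obtain D where D: "countable D" "D \<subseteq> Pow U" "\<And>X. X \<in> D \<Longrightarrow> \<exists>a b. X = cbox a b" "\<Union>D = U"
    using open_countable_Union_open_cbox[OF U] by metis
  have "AE x in lebesgue. \<forall>X\<in>D. x \<in> X \<longrightarrow> H x = 0"
  proof (subst AE_ball_countable[OF D(1)], intro ballI)
    fix X assume X: "X \<in> D"
    then obtain a b where ab: "X = cbox a b" using D(3) by blast
    with X D(2) have "cbox a b \<subseteq> U" by blast
    from part[OF this] show "AE x in lebesgue. x \<in> X \<longrightarrow> H x = 0" unfolding ab .
  qed
  then have "AE x in lebesgue. x \<in> U \<longrightarrow> h x = 0"
  proof eventually_elim
    case (elim x)
    then show ?case using D(4) unfolding H_def by (metis UnionE)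
  qed
  then show ?thesis using Us by (simp add: AE_restrict_space_iff)
qed

section \<open>The Lax--Milgram theorem\<close>

text \<open>\<open>V\<close> consists of representatives, so \<open>G\<close> is only positive
  semidefinite and \<open>complete\<close> is completeness in a seminorm. Limits, representers and
  fixed points below are accordingly determined up to functions of seminorm 0.\<close>

locale hilbert_function_space =
  fixes V :: "('b \<Rightarrow> complex) set"
    and G :: "('b \<Rightarrow> complex) \<Rightarrow> ('b \<Rightarrow> complex) \<Rightarrow> complex"
  assumes V_zero: "(\<lambda>_. 0) \<in> V"
    and V_add: "u \<in> V \<Longrightarrow> v \<in> V \<Longrightarrow> (\<lambda>x. u x + v x) \<in> V"
    and V_scale: "u \<in> V \<Longrightarrow> (\<lambda>x. c * u x) \<in> V"
    and G_add: "u \<in> V \<Longrightarrow> v \<in> V \<Longrightarrow> w \<in> V \<Longrightarrow> G (\<lambda>x. u x + v x) w = G u w + G v w"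
    and G_scale: "u \<in> V \<Longrightarrow> w \<in> V \<Longrightarrow> G (\<lambda>x. c * u x) w = c * G u w"
    and G_cnj: "u \<in> V \<Longrightarrow> v \<in> V \<Longrightarrow> cnj (G u v) = G v u"
    and G_pos: "u \<in> V \<Longrightarrow> 0 \<le> Re (G u u)"
    and complete: "(\<And>n. X n \<in> V) \<Longrightarrow>
      (\<And>e. 0 < e \<Longrightarrow> \<exists>N. \<forall>m\<ge>N. \<forall>n\<ge>N. sqrt (Re (G (\<lambda>x. X m x - X n x) (\<lambda>x. X m x - X n x))) < e) \<Longrightarrow>
      \<exists>u\<in>V. (\<lambda>n. sqrt (Re (G (\<lambda>x. X n x - u x) (\<lambda>x. X n x - u x)))) \<longlonglongrightarrow> 0"
begin

section \<open>Seminorm and inner product calculus\<close>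

definition nrm :: "('b \<Rightarrow> complex) \<Rightarrow> real" where
  "nrm u = sqrt (Re (G u u))"

definition antilinear_on :: "(('b \<Rightarrow> complex) \<Rightarrow> complex) \<Rightarrow> bool" where
  "antilinear_on F \<longleftrightarrow>
     (\<forall>\<phi>\<in>V. \<forall>\<psi>\<in>V. F (\<lambda>x. \<phi> x + \<psi> x) = F \<phi> + F \<psi>) \<and> (\<forall>c. \<forall>\<phi>\<in>V. F (\<lambda>x. c * \<phi> x) = cnj c * F \<phi>)"

lemma V_diff: "u \<in> V \<Longrightarrow> v \<in> V \<Longrightarrow> (\<lambda>x. u x - v x) \<in> V"
  using V_add[of u "\<lambda>x. -1 * v x"] V_scale[of v "-1"] by simp

lemma G_diff: "u \<in> V \<Longrightarrow> v \<in> V \<Longrightarrow> w \<in> V \<Longrightarrow> G (\<lambda>x. u x - v x) w = G u w - G v w"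
  using G_add[of u "\<lambda>x. -1 * v x" w] V_scale[of v "-1"] G_scale[of v w "-1"] by simp

lemma G_add_right: "u \<in> V \<Longrightarrow> v \<in> V \<Longrightarrow> w \<in> V \<Longrightarrow> G w (\<lambda>x. u x + v x) = G w u + G w v"
  using G_add[of u v w] V_add[of u v] by (metis G_cnj complex_cnj_add)

lemma G_scale_right: "u \<in> V \<Longrightarrow> w \<in> V \<Longrightarrow> G w (\<lambda>x. c * u x) = cnj c * G w u"
  using G_scale[of u w c] V_scale[of u c] by (metis G_cnj complex_cnj_mult)

lemma antilinear_on_scale: "antilinear_on F \<Longrightarrow> u \<in> V \<Longrightarrow> F (\<lambda>x. c * u x) = cnj c * F u"
  by (simp add: antilinear_on_def)

lemma antilinear_on_add:
  "antilinear_on F \<Longrightarrow> u \<in> V \<Longrightarrow> v \<in> V \<Longrightarrow> F (\<lambda>x. u x + v x) = F u + F v"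
  by (simp add: antilinear_on_def)

lemma antilinear_on_diff:
  "antilinear_on F \<Longrightarrow> u \<in> V \<Longrightarrow> v \<in> V \<Longrightarrow> F (\<lambda>x. u x - v x) = F u - F v"
  using antilinear_on_add[of F u "\<lambda>x. -1 * v x"] V_scale[of v "-1"] antilinear_on_scale[of F v "-1"] by simp

lemma nrm_nonneg: "0 \<le> nrm u" if "u \<in> V"
  using G_pos[OF that] by (simp add: nrm_def)

lemma nrm_sq: "u \<in> V \<Longrightarrow> (nrm u)\<^sup>2 = Re (G u u)"
  using G_pos by (simp add: nrm_def)

lemma G_self: "u \<in> V \<Longrightarrow> G u u = complex_of_real ((nrm u)\<^sup>2)"
  using G_cnj[of u u] by (simp add: nrm_sq complex_eq_iff)

lemma nrm_sq_add_scale: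
  assumes "u \<in> V" "v \<in> V"
  shows "(nrm (\<lambda>x. u x + c * v x))\<^sup>2 = (nrm u)\<^sup>2 + 2 * Re (cnj c * G u v) + (cmod c)\<^sup>2 * (nrm v)\<^sup>2"
proof -
  have cv: "(\<lambda>x. c * v x) \<in> V" using assms V_scale by blast
  have "G (\<lambda>x. u x + c * v x) (\<lambda>x. u x + c * v x)
      = G u u + cnj c * G u v + cnj (cnj c * G u v) + (c * cnj c) * G v v"
    using assms cv G_cnj[of u v] V_add[OF assms(1) cv]
    by (simp add: G_add G_add_right G_scale G_scale_right algebra_simps)
  then show ?thesis
    using assms by (simp add: nrm_sq[OF V_add[OF assms(1) cv]] G_self complex_mult_cnj cmod_power2)
qed

lemma nrm_sq_diff:
  assumes "u \<in> V" "v \<in> V"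
  shows "(nrm (\<lambda>x. u x - v x))\<^sup>2 = (nrm u)\<^sup>2 - 2 * Re (G u v) + (nrm v)\<^sup>2"
  using nrm_sq_add_scale[OF assms, of "-1"] by simp

lemma nrm_sq_add:
  assumes "u \<in> V" "v \<in> V"
  shows "(nrm (\<lambda>x. u x + v x))\<^sup>2 = (nrm u)\<^sup>2 + 2 * Re (G u v) + (nrm v)\<^sup>2"
  using nrm_sq_add_scale[OF assms, of 1] by simp

lemma nrm_scale:
  assumes u: "u \<in> V"
  shows "nrm (\<lambda>x. c * u x) = cmod c * nrm u"
proof -
  have "G (\<lambda>x. c * u x) (\<lambda>x. c * u x) = (c * cnj c) * G u u"
    using G_scale[OF u V_scale[OF u], of c c] G_scale_right[OF u u, of c] by simp
  also have "\<dots> = complex_of_real ((cmod c * nrm u)\<^sup>2)"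
    unfolding G_self[OF u] power_mult_distrib of_real_mult complex_norm_square ..
  finally have "nrm (\<lambda>x. c * u x) = sqrt ((cmod c * nrm u)\<^sup>2)"
    unfolding nrm_def[of "\<lambda>x. c * u x"] by (simp only: Re_complex_of_real)
  then show ?thesis using nrm_nonneg[OF u] by simp
qed

lemma nrm_minus_commute:
  assumes "u \<in> V" "v \<in> V"
  shows "nrm (\<lambda>x. u x - v x) = nrm (\<lambda>x. v x - u x)"
proof -
  have "(\<lambda>x. u x - v x) = (\<lambda>x. -1 * (v x - u x))" by auto
  then show ?thesis using nrm_scale[OF V_diff[OF assms(2,1)], of "-1"] by simp
qed

text \<open>Discriminant bound: t = b / c is the minimiser. For c = 0 the expression is affine in t
  and can stay nonnegative only if b = 0.\<close>

lemma quadratic_nonneg: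
  fixes a b c :: real
  assumes "\<And>t. 0 \<le> a - 2 * t * b + t\<^sup>2 * c" "0 \<le> a" "0 \<le> c"
  shows "b\<^sup>2 \<le> a * c"
proof (cases "c = 0")
  case True
  have "b = 0"
  proof (rule ccontr)
    assume b: "b \<noteq> 0"
    \<comment> \<open>At this t the expression equals a - (a + 1) = -1.\<close>
    then show False using assms(1)[of "(a + 1) / (2 * b)"] True by simp
  qed
  with True show ?thesis by simp
next
  case False
  with assms(3) have c: "0 < c" by simp
  then have "0 \<le> a - 2 * (b / c) * b + (b / c)\<^sup>2 * c" using assms(1) by blast
  with c show ?thesis by (simp add: power2_eq_square field_simps)
qed

lemma G_Cauchy_Schwarz:
  assumes "u \<in> V" "v \<in> V"
  shows "cmod (G u v) \<le> nrm u * nrm v"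
proof (cases "G u v = 0")
  case True
  with assms nrm_nonneg show ?thesis by simp
next
  case False
  \<comment> \<open>A unimodular factor that rotates \<open>G u v\<close> onto its modulus, so that
    a quadratic in a real t sees the modulus rather than the real part.\<close>
  define s where "s = G u v / complex_of_real (cmod (G u v))"
  have s: "cmod s = 1" using False by (simp add: s_def norm_divide)
  have sG: "cnj s * G u v = complex_of_real (cmod (G u v))"
    using False complex_norm_square[of "G u v"] by (simp add: s_def power2_eq_square field_simps mult.commute)
  have "0 \<le> (nrm u)\<^sup>2 - 2 * t * cmod (G u v) + t\<^sup>2 * (nrm v)\<^sup>2" for t
  proof -
    have "cnj (- complex_of_real t * s) * G u v = - complex_of_real (t * cmod (G u v))"
      using sG by (simp add: mult.assoc)
    then have "Re (cnj (- complex_of_real t * s) * G u v) = - (t * cmod (G u v))" by (simp only:) simp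
    moreover have "(cmod (- complex_of_real t * s))\<^sup>2 = t\<^sup>2" using s by (simp add: norm_mult)
    moreover have "0 \<le> (nrm (\<lambda>x. u x + - complex_of_real t * s * v x))\<^sup>2" by simp
    ultimately have "0 \<le> (nrm u)\<^sup>2 + 2 * - (t * cmod (G u v)) + t\<^sup>2 * (nrm v)\<^sup>2"
      by (simp only: nrm_sq_add_scale[OF assms])
    then show ?thesis by simp
  qed
  then have "(cmod (G u v))\<^sup>2 \<le> (nrm u)\<^sup>2 * (nrm v)\<^sup>2" by (rule quadratic_nonneg) auto
  then have "(cmod (G u v))\<^sup>2 \<le> (nrm u * nrm v)\<^sup>2" by (simp add: power_mult_distrib)
  then show ?thesis by (rule power2_le_imp_le) (simp add: nrm_nonneg assms)
qed

lemma nrm_triangle: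
  assumes "u \<in> V" "v \<in> V"
  shows "nrm (\<lambda>x. u x + v x) \<le> nrm u + nrm v"
proof (rule power2_le_imp_le)
  have "Re (G u v) \<le> nrm u * nrm v"
    using G_Cauchy_Schwarz[OF assms] complex_Re_le_cmod[of "G u v"] by linarith
  then show "(nrm (\<lambda>x. u x + v x))\<^sup>2 \<le> (nrm u + nrm v)\<^sup>2"
    using nrm_sq_add[OF assms] by (simp add: power2_sum)
qed (simp add: nrm_nonneg assms)

lemma nrm_triangle_diff:
  assumes "u \<in> V" "v \<in> V" "w \<in> V"
  shows "nrm (\<lambda>x. u x - w x) \<le> nrm (\<lambda>x. u x - v x) + nrm (\<lambda>x. v x - w x)"
  using nrm_triangle[OF V_diff[OF assms(1,2)] V_diff[OF assms(2,3)]] by simp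

lemma nrm_diff_le: "u \<in> V \<Longrightarrow> v \<in> V \<Longrightarrow> \<bar>nrm u - nrm v\<bar> \<le> nrm (\<lambda>x. u x - v x)"
  using nrm_triangle[OF V_diff[of u v], of v] nrm_triangle[OF V_diff[of v u], of u]
    nrm_minus_commute[of u v] by simp

text \<open>The representer is the minimiser of the quadratic energy \<open>J\<close>. By the
  parallelogram law a minimising sequence is Cauchy, and the vanishing first variation at its limit
  is the equation.\<close>

theorem riesz_representation:
  assumes F: "antilinear_on F" and C: "\<And>\<phi>. \<phi> \<in> V \<Longrightarrow> cmod (F \<phi>) \<le> C * nrm \<phi>"
  shows "\<exists>r\<in>V. \<forall>\<phi>\<in>V. G r \<phi> = F \<phi>"
proof -
  define J where "J v = (nrm v)\<^sup>2 - 2 * Re (F v)" for v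
  \<comment> \<open>Completing the square: x^2 - 2 C x = (x - C)^2 - C^2 with x the seminorm of
    v.\<close>
  have J_lower: "- C\<^sup>2 \<le> J v" if v: "v \<in> V" for v
  proof -
    have "Re (F v) \<le> C * nrm v" using C[OF v] complex_Re_le_cmod[of "F v"] by linarith
    moreover have "0 \<le> (nrm v - C)\<^sup>2" by simp
    ultimately show ?thesis by (simp add: J_def power2_diff mult.commute)
  qed
  define j where "j = Inf (J ` V)"
  have bdd: "bdd_below (J ` V)" using J_lower by (intro bdd_belowI) auto
  have j: "j \<le> J v" if "v \<in> V" for v unfolding j_def using bdd that by (intro cInf_lower) auto
  have "\<exists>v\<in>V. J v < j + 1 / real (Suc n)" for n
  proof -
    have "Inf (J ` V) < j + 1 / real (Suc n)" unfolding j_def by simp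
    then show ?thesis using V_zero bdd by (subst (asm) cInf_less_iff) auto
  qed
  then obtain X where X: "\<And>n. X n \<in> V" "\<And>n. J (X n) < j + 1 / real (Suc n)" by metis
  \<comment> \<open>The midpoint \<open>w\<close> lies in \<open>V\<close>, so \<open>J w\<close> is
    at least the infimum, while the parallelogram identity equates the left side with 2 J(X m) + 2
    J(X n) - 4 J(w).\<close>
  have par: "(nrm (\<lambda>x. X m x - X n x))\<^sup>2 \<le> 2 / real (Suc m) + 2 / real (Suc n)" for m n
  proof -
    define w where "w = (\<lambda>x. (1/2) * (X m x + X n x))"
    have s: "(\<lambda>x. X m x + X n x) \<in> V" using X V_add by blast
    then have w: "w \<in> V" unfolding w_def by (rule V_scale)
    have "nrm w = 1/2 * nrm (\<lambda>x. X m x + X n x)" unfolding w_def using nrm_scale[OF s, of "1/2"] by simp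
    then have "nrm (\<lambda>x. X m x + X n x) = 2 * nrm w" by simp
    then have "4 * (nrm w)\<^sup>2 = (nrm (\<lambda>x. X m x + X n x))\<^sup>2" by (simp add: power_mult_distrib)
    moreover have "2 * Re (F w) = Re (F (X m)) + Re (F (X n))"
    proof -
      have "F w = cnj (1/2) * F (\<lambda>x. X m x + X n x)"
        unfolding w_def by (rule antilinear_on_scale[OF F s])
      also have "F (\<lambda>x. X m x + X n x) = F (X m) + F (X n)" using F X by (intro antilinear_on_add)
      finally have "F w = (F (X m) + F (X n)) / 2" by simp
      then show ?thesis by (simp only: Re_divide_numeral plus_complex.simps) simp
    qed
    ultimately have "4 * J w = (nrm (\<lambda>x. X m x + X n x))\<^sup>2 - 4 * Re (F (X m)) - 4 * Re (F (X n))"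
      by (simp add: J_def)
    moreover have "(nrm (\<lambda>x. X m x - X n x))\<^sup>2 + (nrm (\<lambda>x. X m x + X n x))\<^sup>2 = 2 * (nrm (X m))\<^sup>2 + 2 * (nrm (X n))\<^sup>2"
      using nrm_sq_diff[OF X(1) X(1), of m n] nrm_sq_add[OF X(1) X(1), of m n] by simp
    ultimately have "(nrm (\<lambda>x. X m x - X n x))\<^sup>2 = 2 * J (X m) + 2 * J (X n) - 4 * J w"
      by (simp add: J_def)
    then show ?thesis using X(2)[of m] X(2)[of n] j[OF w] by simp
  qed
  have "\<exists>u\<in>V. (\<lambda>n. nrm (\<lambda>x. X n x - u x)) \<longlonglongrightarrow> 0"
    unfolding nrm_def
  proof (rule complete[OF X(1)])
    fix e :: real assume e: "0 < e"
    obtain N :: nat where N: "4 / e\<^sup>2 < real N" using reals_Archimedean2 by blast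
    have "nrm (\<lambda>x. X m x - X n x) < e" if "m \<ge> N" "n \<ge> N" for m n
    proof (rule power2_less_imp_less)
      have "2 / real (Suc m) \<le> 2 / real (Suc N)" "2 / real (Suc n) \<le> 2 / real (Suc N)"
        using that by (auto intro!: divide_left_mono)
      then have "(nrm (\<lambda>x. X m x - X n x))\<^sup>2 \<le> 4 / real (Suc N)" using par[of m n] by simp
      also have "\<dots> < e\<^sup>2"
      proof -
        have "4 < real N * e\<^sup>2" using N e by (simp add: pos_divide_less_eq)
        also have "\<dots> \<le> e\<^sup>2 * real (Suc N)" by (simp add: algebra_simps)
        finally show ?thesis by (simp add: pos_divide_less_eq)
      qed
      finally show "(nrm (\<lambda>x. X m x - X n x))\<^sup>2 < e\<^sup>2" .
    qed (use e in simp)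
    then show "\<exists>N. \<forall>m\<ge>N. \<forall>n\<ge>N. sqrt (Re (G (\<lambda>x. X m x - X n x) (\<lambda>x. X m x - X n x))) < e"
      unfolding nrm_def by blast
  qed
  then obtain r where r: "r \<in> V" and lim: "(\<lambda>n. nrm (\<lambda>x. X n x - r x)) \<longlonglongrightarrow> 0" by blast
  have "(\<lambda>n. nrm (X n)) \<longlonglongrightarrow> nrm r"
    by (rule LIM_zero_cancel, rule Lim_null_comparison[OF always_eventually lim]) (simp add: nrm_diff_le X(1) r)
  moreover have "(\<lambda>n. F (X n)) \<longlonglongrightarrow> F r"
  proof -
    have "norm (F (X n) - F r) \<le> C * nrm (\<lambda>x. X n x - r x)" for n
      using C[OF V_diff[OF X(1) r, of n]] unfolding antilinear_on_diff[OF F X(1) r] .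
    moreover have "(\<lambda>n. C * nrm (\<lambda>x. X n x - r x)) \<longlonglongrightarrow> 0"
      using tendsto_mult[OF tendsto_const[of C] lim] by simp
    ultimately have "(\<lambda>n. F (X n) - F r) \<longlonglongrightarrow> 0"
      by - (rule Lim_null_comparison[OF always_eventually], rule allI)
    then show ?thesis by (rule LIM_zero_cancel)
  qed
  ultimately have "(\<lambda>n. J (X n)) \<longlonglongrightarrow> J r" unfolding J_def by (intro tendsto_intros)
  moreover have "(\<lambda>n. j + 1 / real (Suc n)) \<longlonglongrightarrow> j + 0"
    by (intro tendsto_add tendsto_const LIMSEQ_Suc[OF lim_1_over_n])
  ultimately have "J r \<le> j + 0" by (rule LIMSEQ_le) (use X(2) in \<open>auto intro: less_imp_le\<close>)
  then have Jr: "J r \<le> j" by simp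
  have zero: "Re (G r \<phi> - F \<phi>) = 0" if \<phi>: "\<phi> \<in> V" for \<phi>
  proof -
    \<comment> \<open>Minimality along the line r + t phi, put into the shape of
      \<open>quadratic_nonneg\<close> with constant term 0, which forces the linear coefficient to
      vanish.\<close>
    have "0 \<le> 0 - 2 * t * (- Re (G r \<phi> - F \<phi>)) + t\<^sup>2 * (nrm \<phi>)\<^sup>2" for t
    proof -
      have t: "(\<lambda>x. complex_of_real t * \<phi> x) \<in> V" using \<phi> V_scale by blast
      have "F (\<lambda>x. r x + complex_of_real t * \<phi> x) = F r + F (\<lambda>x. complex_of_real t * \<phi> x)"
        using F r t by (rule antilinear_on_add)
      also have "F (\<lambda>x. complex_of_real t * \<phi> x) = complex_of_real t * F \<phi>"
        using antilinear_on_scale[OF F \<phi>, of "complex_of_real t"] by simp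
      finally have "J (\<lambda>x. r x + complex_of_real t * \<phi> x) = J r - 2 * t * (- Re (G r \<phi> - F \<phi>)) + t\<^sup>2 * (nrm \<phi>)\<^sup>2"
        unfolding J_def nrm_sq_add_scale[OF r \<phi>] by (simp add: algebra_simps)
      then show ?thesis using j[OF V_add[OF r t]] Jr by linarith
    qed
    then have "(- Re (G r \<phi> - F \<phi>))\<^sup>2 \<le> 0 * (nrm \<phi>)\<^sup>2" by (rule quadratic_nonneg) auto
    then show ?thesis by simp
  qed
  have "G r \<phi> = F \<phi>" if \<phi>: "\<phi> \<in> V" for \<phi>
  proof -
    \<comment> \<open>The real part is settled for every test function; testing with the multiple of
      phi by the imaginary unit supplies the imaginary part.\<close>
    have "F (\<lambda>x. \<i> * \<phi> x) = cnj \<i> * F \<phi>" using F \<phi> by (rule antilinear_on_scale)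
    moreover have "G r (\<lambda>x. \<i> * \<phi> x) = cnj \<i> * G r \<phi>" using r \<phi> by (rule G_scale_right[rotated])
    ultimately show ?thesis using zero[OF \<phi>] zero[OF V_scale[OF \<phi>, of \<i>]] by (simp add: complex_eq_iff)
  qed
  with r show ?thesis by blast
qed

text \<open>With \<open>R u\<close> representing \<open>a u\<close>, the equation reads R u = r, and
  the damped iteration u - \<rho> (R u - r) is a contraction. The fixed point argument is spelled
  out because \<open>nrm\<close> is only a seminorm.\<close>

theorem lax_milgram:
  assumes a_add: "\<And>u v w. u \<in> V \<Longrightarrow> v \<in> V \<Longrightarrow> w \<in> V \<Longrightarrow> a (\<lambda>x. u x + v x) w = a u w + a v w"
    and a_scale: "\<And>u w c. u \<in> V \<Longrightarrow> w \<in> V \<Longrightarrow> a (\<lambda>x. c * u x) w = c * a u w"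
    and a_anti: "\<And>u. u \<in> V \<Longrightarrow> antilinear_on (a u)"
    and a_bound: "\<And>u w. u \<in> V \<Longrightarrow> w \<in> V \<Longrightarrow> cmod (a u w) \<le> C * nrm u * nrm w"
    and a_coercive: "\<And>u. u \<in> V \<Longrightarrow> (nrm u)\<^sup>2 \<le> Re (a u u)"
    and F: "antilinear_on F" and F_bound: "\<And>\<phi>. \<phi> \<in> V \<Longrightarrow> cmod (F \<phi>) \<le> K * nrm \<phi>"
  shows "\<exists>u\<in>V. \<forall>\<phi>\<in>V. a u \<phi> = F \<phi>"
proof -
  \<comment> \<open>At least 1, so that \<open>\<rho>\<close> below is at most 1 and 1 - \<rho> has
    a real square root.\<close>
  define B where "B = max C 1"
  have B: "1 \<le> B" "C \<le> B" by (auto simp: B_def)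
  have bound: "cmod (a u w) \<le> B * nrm u * nrm w" if "u \<in> V" "w \<in> V" for u w
  proof -
    have "C * (nrm u * nrm w) \<le> B * (nrm u * nrm w)"
      using B that nrm_nonneg by (intro mult_right_mono) auto
    with a_bound[OF that] show ?thesis by (simp add: mult.assoc)
  qed
  have "\<forall>u\<in>V. \<exists>z. z \<in> V \<and> (\<forall>\<phi>\<in>V. G z \<phi> = a u \<phi>)"
    using riesz_representation[OF a_anti bound] by blast
  from bchoice[OF this] obtain R where R: "\<And>u. u \<in> V \<Longrightarrow> R u \<in> V"
      "\<And>u \<phi>. u \<in> V \<Longrightarrow> \<phi> \<in> V \<Longrightarrow> G (R u) \<phi> = a u \<phi>" by blast
  obtain r where r: "r \<in> V" "\<And>\<phi>. \<phi> \<in> V \<Longrightarrow> G r \<phi> = F \<phi>"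
    using riesz_representation[OF F F_bound] by blast
  \<comment> \<open>Minimises 1 - 2 \<rho> + \<rho>^2 B^2, the bound on the squared contraction
    factor for coercivity constant 1; the minimum is 1 - \<rho>.\<close>
  define \<rho> where "\<rho> = 1 / B\<^sup>2"
  have \<rho>: "0 < \<rho>" "\<rho> \<le> 1" using B by (auto simp: \<rho>_def)
  define \<Phi> where "\<Phi> u = (\<lambda>x. u x + - complex_of_real \<rho> * (R u x - r x))" for u
  have \<Phi>V: "\<Phi> u \<in> V" if "u \<in> V" for u
    unfolding \<Phi>_def using that R r by (intro V_add V_scale V_diff)
  define \<kappa> where "\<kappa> = sqrt (1 - \<rho>)"
  have \<kappa>: "0 \<le> \<kappa>" "\<kappa> < 1" using \<rho> by (auto simp: \<kappa>_def)
  have contraction: "nrm (\<lambda>x. \<Phi> u x - \<Phi> v x) \<le> \<kappa> * nrm (\<lambda>x. u x - v x)" if u: "u \<in> V" and v: "v \<in> V" for u v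
  proof -
    define d z where "d = (\<lambda>x. u x - v x)" and "z = (\<lambda>x. R u x - R v x)"
    have d: "d \<in> V" and z: "z \<in> V" unfolding d_def z_def using u v R V_diff by auto
    \<comment> \<open>\<open>R\<close> is a pointwise choice and need not be linear; linearity is
      recovered after pairing, where \<open>z\<close> represents \<open>a d\<close>.\<close>
    have dz: "G z \<phi> = a d \<phi>" if \<phi>: "\<phi> \<in> V" for \<phi>
    proof -
      have "a d \<phi> = a u \<phi> + a (\<lambda>x. -1 * v x) \<phi>"
        unfolding d_def using a_add[OF u V_scale[OF v, of "-1"] \<phi>] by simp
      also have "\<dots> = a u \<phi> - a v \<phi>" using a_scale[OF v \<phi>, of "-1"] by simp
      finally show ?thesis unfolding z_def using G_diff[OF R(1)[OF u] R(1)[OF v] \<phi>] R(2) u v \<phi> by simp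
    qed
    have "(nrm z)\<^sup>2 \<le> B * nrm d * nrm z"
      using dz[OF z] bound[OF d z] nrm_sq[OF z] complex_Re_le_cmod[of "a d z"] by simp
    then have zd: "nrm z \<le> B * nrm d"
      using nrm_nonneg[OF z] nrm_nonneg[OF d] B
      by (cases "nrm z = 0") (auto simp: power2_eq_square)
    have "(nrm z)\<^sup>2 \<le> (B * nrm d)\<^sup>2" by (rule power_mono[OF zd nrm_nonneg[OF z]])
    then have "\<rho>\<^sup>2 * (nrm z)\<^sup>2 \<le> \<rho>\<^sup>2 * (B\<^sup>2 * (nrm d)\<^sup>2)"
      by (intro mult_left_mono) (auto simp: power_mult_distrib)
    also have "\<dots> = \<rho> * (nrm d)\<^sup>2" using B by (simp add: \<rho>_def power2_eq_square)
    finally have z2: "\<rho>\<^sup>2 * (nrm z)\<^sup>2 \<le> \<rho> * (nrm d)\<^sup>2" .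
    have "Re (G d z) = Re (a d d)" using G_cnj[OF z d] dz[OF d] by (metis cnj.simps(1))
    then have "(nrm d)\<^sup>2 \<le> Re (G d z)" using a_coercive[OF d] by simp
    then have "\<rho> * (nrm d)\<^sup>2 \<le> \<rho> * Re (G d z)" using \<rho> by (intro mult_left_mono) auto
    moreover have "(nrm (\<lambda>x. d x + - complex_of_real \<rho> * z x))\<^sup>2 = (nrm d)\<^sup>2 - 2 * (\<rho> * Re (G d z)) + \<rho>\<^sup>2 * (nrm z)\<^sup>2"
      using nrm_sq_add_scale[OF d z, of "- complex_of_real \<rho>"] by simp
    ultimately have "(nrm (\<lambda>x. d x + - complex_of_real \<rho> * z x))\<^sup>2 \<le> (1 - \<rho>) * (nrm d)\<^sup>2"
      using z2 by (simp add: algebra_simps)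
    also have "\<dots> = (\<kappa> * nrm d)\<^sup>2" using \<rho> by (simp add: \<kappa>_def power_mult_distrib)
    finally have "nrm (\<lambda>x. d x + - complex_of_real \<rho> * z x) \<le> \<kappa> * nrm d"
      by (rule power2_le_imp_le) (simp add: \<kappa> nrm_nonneg d)
    moreover have "(\<lambda>x. \<Phi> u x - \<Phi> v x) = (\<lambda>x. d x + - complex_of_real \<rho> * z x)"
      by (auto simp: \<Phi>_def d_def z_def algebra_simps)
    ultimately show ?thesis by (simp add: d_def)
  qed
  define X where "X n = (\<Phi> ^^ n) (\<lambda>_. 0)" for n
  have X: "X n \<in> V" for n unfolding X_def by (induction n) (auto intro: V_zero \<Phi>V)
  have XSuc: "X (Suc n) = \<Phi> (X n)" for n by (simp add: X_def)
  \<comment> \<open>Sum of the geometric series of steps. It solves \<kappa> D + nrm (X 1 - X 0) =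
    D, which closes the induction for \<open>far\<close>.\<close>
  define D where "D = nrm (\<lambda>x. X 1 x - X 0 x) / (1 - \<kappa>)"
  have D0: "0 \<le> D" unfolding D_def using nrm_nonneg[OF V_diff[OF X X]] \<kappa> by simp
  have step: "nrm (\<lambda>x. X (n + k) x - X n x) \<le> \<kappa> ^ n * nrm (\<lambda>x. X k x - X 0 x)" for n k
  proof (induction n)
    case (Suc n)
    have "nrm (\<lambda>x. X (Suc n + k) x - X (Suc n) x) \<le> \<kappa> * nrm (\<lambda>x. X (n + k) x - X n x)"
      using contraction[OF X X, of "n + k" n] by (simp add: XSuc)
    also have "\<dots> \<le> \<kappa> * (\<kappa> ^ n * nrm (\<lambda>x. X k x - X 0 x))"
      using Suc \<kappa> by (intro mult_left_mono)
    finally show ?case by simp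
  qed simp
  have far: "nrm (\<lambda>x. X k x - X 0 x) \<le> D" for k
  proof (induction k)
    case 0
    have "nrm (\<lambda>x. X 0 x - X 0 x) = 0" using nrm_scale[OF V_zero, of 0] by simp
    with D0 show ?case by simp
  next
    case (Suc k)
    have "nrm (\<lambda>x. X (Suc k) x - X 0 x) \<le> nrm (\<lambda>x. X (Suc k) x - X 1 x) + nrm (\<lambda>x. X 1 x - X 0 x)"
      by (rule nrm_triangle_diff[OF X X X])
    also have "nrm (\<lambda>x. X (Suc k) x - X 1 x) \<le> \<kappa> * nrm (\<lambda>x. X k x - X 0 x)"
      using step[of 1 k] by simp
    also have "\<dots> \<le> \<kappa> * D" using Suc \<kappa> by (intro mult_left_mono)
    also have "\<kappa> * D + nrm (\<lambda>x. X 1 x - X 0 x) = D"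
      unfolding D_def using \<kappa> by (simp add: field_simps)
    finally show ?case by simp
  qed
  have close: "nrm (\<lambda>x. X m x - X n x) \<le> \<kappa> ^ N * D" if "m \<ge> N" "n \<ge> N" for m n N
  proof -
    have *: "nrm (\<lambda>x. X m x - X n x) \<le> \<kappa> ^ N * D" if "N \<le> n" "n \<le> m" for m n
    proof -
      have "nrm (\<lambda>x. X m x - X n x) \<le> \<kappa> ^ n * nrm (\<lambda>x. X (m - n) x - X 0 x)"
        using step[of n "m - n"] that by simp
      also have "\<dots> \<le> \<kappa> ^ N * D"
        using that far \<kappa> nrm_nonneg[OF V_diff[OF X X]] by (intro mult_mono power_decreasing) auto
      finally show ?thesis .
    qed
    show ?thesis using *[of n m] *[of m n] that nrm_minus_commute[OF X X, of m n] by (cases "n \<le> m") auto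
  qed
  have \<kappa>lim: "(\<lambda>n. \<kappa> ^ n * D) \<longlonglongrightarrow> 0"
    using tendsto_mult[OF LIMSEQ_realpow_zero[OF \<kappa>] tendsto_const[of D]] by simp
  have "\<exists>u\<in>V. (\<lambda>n. nrm (\<lambda>x. X n x - u x)) \<longlonglongrightarrow> 0"
    unfolding nrm_def
  proof (rule complete[OF X])
    fix e :: real assume e: "0 < e"
    then obtain N where "\<kappa> ^ N * D < e"
      using order_tendstoD(2)[OF \<kappa>lim e] by (auto simp: eventually_sequentially)
    then show "\<exists>N. \<forall>m\<ge>N. \<forall>n\<ge>N. sqrt (Re (G (\<lambda>x. X m x - X n x) (\<lambda>x. X m x - X n x))) < e"
      using close unfolding nrm_def by (intro exI[of _ N]) (meson le_less_trans)
  qed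
  then obtain u where u: "u \<in> V" and lim: "(\<lambda>n. nrm (\<lambda>x. X n x - u x)) \<longlonglongrightarrow> 0" by blast
  \<comment> \<open>In the limit u is a fixed point up to a function of seminorm 0, and
    Cauchy-Schwarz makes that function invisible to \<open>G\<close>.\<close>
  have "nrm (\<lambda>x. \<Phi> u x - u x) \<le> \<kappa> * nrm (\<lambda>x. X n x - u x) + nrm (\<lambda>x. X (Suc n) x - u x)" for n
    using nrm_triangle_diff[OF \<Phi>V[OF u] X u, of "Suc n"] contraction[OF u X, of n] nrm_minus_commute[OF u X, of n]
    by (simp add: XSuc)
  moreover have "(\<lambda>n. \<kappa> * nrm (\<lambda>x. X n x - u x) + nrm (\<lambda>x. X (Suc n) x - u x)) \<longlonglongrightarrow> \<kappa> * 0 + 0"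
    by (intro tendsto_add tendsto_mult tendsto_const lim LIMSEQ_Suc[OF lim])
  ultimately have "nrm (\<lambda>x. \<Phi> u x - u x) \<le> \<kappa> * 0 + 0"
    by - (rule LIMSEQ_le_const, assumption, blast)
  then have "nrm (\<lambda>x. \<Phi> u x - u x) \<le> 0" by simp
  moreover have "(\<lambda>x. \<Phi> u x - u x) = (\<lambda>x. - complex_of_real \<rho> * (R u x - r x))" by (auto simp: \<Phi>_def)
  ultimately have "\<rho> * nrm (\<lambda>x. R u x - r x) \<le> 0"
    using nrm_scale[OF V_diff[OF R(1)[OF u] r(1)], of "- complex_of_real \<rho>"] \<rho> by simp
  then have 0: "nrm (\<lambda>x. R u x - r x) = 0"
    using \<rho> nrm_nonneg[OF V_diff[OF R(1)[OF u] r(1)]] by (simp add: mult_le_0_iff)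
  have "a u \<phi> = F \<phi>" if \<phi>: "\<phi> \<in> V" for \<phi>
    using G_Cauchy_Schwarz[OF V_diff[OF R(1)[OF u] r(1)] \<phi>] 0 G_diff[OF R(1)[OF u] r(1) \<phi>] R(2)[OF u \<phi>] r(2)[OF \<phi>]
    by simp
  with u show ?thesis by blast
qed

end

section \<open>The space $H^1$\<close>

text \<open>Off the closed support phi vanishes on a whole neighbourhood, so it agrees there with a
  constant function.\<close>

lemma partial_deriv_zero:
  assumes "x \<notin> closure {x. \<phi> x \<noteq> 0}"
  shows "partial_deriv i \<phi> x = 0"
proof -
  have "((\<lambda>_. 0) has_derivative (\<lambda>_. 0)) (at x)" by simp
  then have "(\<phi> has_derivative (\<lambda>_. 0)) (at x)"
  proof (rule has_derivative_transform_within_open)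
    show "open (- closure {x. \<phi> x \<noteq> 0})" "x \<in> - closure {x. \<phi> x \<noteq> 0}" using assms by auto
    show "0 = \<phi> y" if "y \<in> - closure {x. \<phi> x \<noteq> 0}" for y
      using that closure_subset[of "{x. \<phi> x \<noteq> 0}"] by auto
  qed
  from frechet_derivative_at[OF this] show ?thesis by (metis partial_deriv_def)
qed

lemma partial_deriv_test:
  assumes "\<phi> \<in> test_functions U"
  shows "partial_deriv i \<phi> \<in> test_functions U"
proof -
  have "closure {x. partial_deriv i \<phi> x \<noteq> 0} \<subseteq> closure {x. \<phi> x \<noteq> 0}"
    by (rule closure_minimal) (use partial_deriv_zero in blast)+
  moreover have "Ck n (partial_deriv i \<phi>)" for n
  proof -
    have "Ck (Suc n) \<phi>" using assms unfolding test_functions_def by blast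
    then show ?thesis unfolding Ck.simps by blast
  qed
  moreover have "compact (closure {x. \<phi> x \<noteq> 0})" "closure {x. \<phi> x \<noteq> 0} \<subseteq> U"
    using assms unfolding test_functions_def by blast+
  ultimately show ?thesis
    unfolding test_functions_def compact_eq_bounded_closed by (auto intro: bounded_subset)
qed

locale bounded_open =
  fixes \<Omega> :: "(real^2) set"
  assumes open_\<Omega>: "open \<Omega>" and bounded_\<Omega>: "bounded \<Omega>"
begin

abbreviation "L \<equiv> lebesgue_on \<Omega>"
abbreviation "D \<equiv> weak_deriv \<Omega>"

lemma sets_\<Omega>: "\<Omega> \<in> sets lebesgue"
  using open_\<Omega> by simp

lemma finite_L: "finite_measure L"
  by (intro finite_measure_lebesgue_on lmeasurable_open bounded_\<Omega> open_\<Omega>)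

lemma test_L2:
  assumes "\<phi> \<in> test_functions \<Omega>"
  shows "\<phi> \<in> L2 L"
proof -
  obtain C where "\<And>x. cmod (\<phi> x) \<le> C" using test_functions_bounded[OF assms] by blast
  then show ?thesis
    by (rule L2_bounded[OF finite_L borel_measurable_lebesgue_on[OF test_functions_measurable[OF assms]]])
qed

lemma partial_L2: "\<phi> \<in> test_functions \<Omega> \<Longrightarrow> partial_deriv i \<phi> \<in> L2 L"
  by (intro test_L2 partial_deriv_test)

lemma weak_deriv_unique:
  assumes "v \<in> L2 L" "w \<in> L2 L" "is_weak_deriv \<Omega> i u v" "is_weak_deriv \<Omega> i u w"
  shows "AE x in L. v x = w x"
proof -
  have "AE x in L. v x - w x = 0"
  proof (rule fundamental_lemma[OF open_\<Omega>])
    show "integrable L (\<lambda>x. v x - w x)" by (intro L2_imp_integrable[OF finite_L] L2_diff assms)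
    fix \<phi> assume \<phi>: "\<phi> \<in> test_functions \<Omega>"
    have "(LINT x|L. (v x - w x) * \<phi> x) = (LINT x|L. v x * \<phi> x) - (LINT x|L. w x * \<phi> x)"
      unfolding left_diff_distrib
      by (intro Bochner_Integration.integral_diff L2_integrable_mult test_L2 assms \<phi>)
    also have "\<dots> = 0"
      using bspec[OF assms(3)[unfolded is_weak_deriv_def] \<phi>] bspec[OF assms(4)[unfolded is_weak_deriv_def] \<phi>] by simp
    finally show "(LINT x|L. (v x - w x) * \<phi> x) = 0" .
  qed
  then show ?thesis by simp
qed

section \<open>Linear structure of H^1\<close>

lemma H1_L2: "u \<in> H1 \<Omega> \<Longrightarrow> u \<in> L2 L"
  by (simp add: H1_def)

lemma
  assumes "u \<in> H1 \<Omega>"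
  shows D_L2: "D i u \<in> L2 L" and D_is_weak_deriv: "is_weak_deriv \<Omega> i u (D i u)"
proof -
  have "\<exists>v. v \<in> L2 L \<and> is_weak_deriv \<Omega> i u v" using assms unfolding H1_def by blast
  from someI_ex[OF this] show "D i u \<in> L2 L" "is_weak_deriv \<Omega> i u (D i u)"
    unfolding weak_deriv_def by auto
qed

lemma H1_I:
  "u \<in> L2 L \<Longrightarrow> (\<And>i. v i \<in> L2 L) \<Longrightarrow> (\<And>i. is_weak_deriv \<Omega> i u (v i)) \<Longrightarrow> u \<in> H1 \<Omega>"
  unfolding H1_def by blast

text \<open>The working tool for \<open>D\<close>: as a choice among all square-integrable weak
  derivatives it can be compared with a concrete candidate only almost everywhere. Linearity of
  \<open>D\<close> is derived from this.\<close>

lemma D_AE_eq: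
  "u \<in> H1 \<Omega> \<Longrightarrow> v \<in> L2 L \<Longrightarrow> is_weak_deriv \<Omega> i u v \<Longrightarrow> AE x in L. D i u x = v x"
  by (rule weak_deriv_unique[OF D_L2 _ D_is_weak_deriv])

lemma is_weak_deriv_add:
  assumes "u \<in> L2 L" "u' \<in> L2 L" "v \<in> L2 L" "v' \<in> L2 L"
    and "is_weak_deriv \<Omega> i u v" "is_weak_deriv \<Omega> i u' v'"
  shows "is_weak_deriv \<Omega> i (\<lambda>x. u x + u' x) (\<lambda>x. v x + v' x)"
  unfolding is_weak_deriv_def
proof
  fix \<phi> assume \<phi>: "\<phi> \<in> test_functions \<Omega>"
  have "(LINT x|L. (u x + u' x) * partial_deriv i \<phi> x)
      = (LINT x|L. u x * partial_deriv i \<phi> x) + (LINT x|L. u' x * partial_deriv i \<phi> x)"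
    unfolding distrib_right
    by (intro Bochner_Integration.integral_add L2_integrable_mult partial_L2 assms \<phi>)
  moreover have "(LINT x|L. (v x + v' x) * \<phi> x) = (LINT x|L. v x * \<phi> x) + (LINT x|L. v' x * \<phi> x)"
    unfolding distrib_right
    by (intro Bochner_Integration.integral_add L2_integrable_mult test_L2 assms \<phi>)
  ultimately show "(LINT x|L. (u x + u' x) * partial_deriv i \<phi> x) = - (LINT x|L. (v x + v' x) * \<phi> x)"
    using bspec[OF assms(5)[unfolded is_weak_deriv_def] \<phi>] bspec[OF assms(6)[unfolded is_weak_deriv_def] \<phi>] by simp
qed

lemma is_weak_deriv_scale:
  "is_weak_deriv \<Omega> i u v \<Longrightarrow> is_weak_deriv \<Omega> i (\<lambda>x. c * u x) (\<lambda>x. c * v x)"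
  by (simp add: is_weak_deriv_def mult.assoc)

lemma H1_add:
  assumes "u \<in> H1 \<Omega>" "v \<in> H1 \<Omega>"
  shows "(\<lambda>x. u x + v x) \<in> H1 \<Omega>"
  by (rule H1_I[where v="\<lambda>i x. D i u x + D i v x"])
    (intro L2_add H1_L2 D_L2 is_weak_deriv_add D_is_weak_deriv assms)+

lemma H1_scale:
  assumes "u \<in> H1 \<Omega>"
  shows "(\<lambda>x. c * u x) \<in> H1 \<Omega>"
  by (rule H1_I[where v="\<lambda>i x. c * D i u x"])
    (intro L2_scale H1_L2 D_L2 is_weak_deriv_scale D_is_weak_deriv assms)+

lemma H1_zero: "(\<lambda>_. 0) \<in> H1 \<Omega>"
  by (rule H1_I[where v="\<lambda>_ _. 0"]) (auto intro: L2_zero simp: is_weak_deriv_def)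

lemma H1_diff: "u \<in> H1 \<Omega> \<Longrightarrow> v \<in> H1 \<Omega> \<Longrightarrow> (\<lambda>x. u x - v x) \<in> H1 \<Omega>"
  using H1_add[of u "\<lambda>x. -1 * v x"] H1_scale[of v "-1"] by simp

lemma D_add:
  assumes "u \<in> H1 \<Omega>" "v \<in> H1 \<Omega>"
  shows "AE x in L. D i (\<lambda>x. u x + v x) x = D i u x + D i v x"
  by (intro D_AE_eq H1_add L2_add H1_L2 D_L2 is_weak_deriv_add D_is_weak_deriv assms)

lemma D_scale:
  assumes "u \<in> H1 \<Omega>"
  shows "AE x in L. D i (\<lambda>x. c * u x) x = c * D i u x"
  by (intro D_AE_eq H1_scale L2_scale D_L2 is_weak_deriv_scale D_is_weak_deriv assms)

lemma D_diff:
  assumes "u \<in> H1 \<Omega>" "v \<in> H1 \<Omega>"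
  shows "AE x in L. D i (\<lambda>x. u x - v x) x = D i u x - D i v x"
  using D_add[OF assms(1) H1_scale[OF assms(2), of "-1"], of i] D_scale[OF assms(2), of i "-1"]
  by eventually_elim simp

lemma D_eq_0: "u \<in> H1 \<Omega> \<Longrightarrow> AE x in L. u x = 0 \<Longrightarrow> AE x in L. D i u x = 0"
proof (rule D_AE_eq[OF _ L2_zero])
  assume u: "u \<in> H1 \<Omega>" "AE x in L. u x = 0"
  have "(LINT x|L. u x * partial_deriv i \<phi> x) = 0" for \<phi>
    using u(2) by (intro integral_eq_zero_AE) auto
  then show "is_weak_deriv \<Omega> i u (\<lambda>_. 0)" by (simp add: is_weak_deriv_def)
qed

section \<open>The H^1 inner product and completeness\<close>

lemma S_op_add:
  assumes "u \<in> H1 \<Omega>" "v \<in> H1 \<Omega>" "w \<in> H1 \<Omega>"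
  shows "S_op \<Omega> (\<lambda>x. u x + v x) w = S_op \<Omega> u w + S_op \<Omega> v w"
proof -
  have "inner_L2 L (D i (\<lambda>x. u x + v x)) (D i w) = inner_L2 L (D i u) (D i w) + inner_L2 L (D i v) (D i w)" for i
  proof -
    have "inner_L2 L (D i (\<lambda>x. u x + v x)) (D i w) = inner_L2 L (\<lambda>x. D i u x + D i v x) (D i w)"
      by (intro inner_L2_cong_AE D_add assms L2_measurable L2_add D_L2 H1_add) auto
    also have "\<dots> = inner_L2 L (D i u) (D i w) + inner_L2 L (D i v) (D i w)"
      by (intro inner_L2_add_left D_L2 assms)
    finally show ?thesis .
  qed
  then show ?thesis by (simp add: S_op_def sum.distrib)
qed

lemma S_op_scale:
  assumes "u \<in> H1 \<Omega>" "w \<in> H1 \<Omega>"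
  shows "S_op \<Omega> (\<lambda>x. c * u x) w = c * S_op \<Omega> u w"
proof -
  have "inner_L2 L (D i (\<lambda>x. c * u x)) (D i w) = c * inner_L2 L (D i u) (D i w)" for i
  proof -
    have "inner_L2 L (D i (\<lambda>x. c * u x)) (D i w) = inner_L2 L (\<lambda>x. c * D i u x) (D i w)"
      by (intro inner_L2_cong_AE D_scale assms L2_measurable L2_scale D_L2 H1_scale) auto
    then show ?thesis by (simp add: inner_L2_scale_left)
  qed
  then show ?thesis by (simp add: S_op_def sum_distrib_left)
qed

lemma S_op_cnj: "cnj (S_op \<Omega> u v) = S_op \<Omega> v u"
  by (simp add: S_op_def inner_L2_cnj)

definition G :: "(real^2 \<Rightarrow> complex) \<Rightarrow> (real^2 \<Rightarrow> complex) \<Rightarrow> complex" where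
  "G u v = inner_L2 L u v + S_op \<Omega> u v"

lemma sqrt_G: "sqrt (Re (G u u)) = norm_H1 \<Omega> u"
  by (simp add: G_def S_op_def norm_H1_def inner_L2_self)

lemma norm_L2_le_H1: "norm_L2 L u \<le> norm_H1 \<Omega> u"
  unfolding norm_H1_def by (intro real_le_rsqrt) (simp add: sum_nonneg)

lemma norm_D_le_H1: "norm_L2 L (D i u) \<le> norm_H1 \<Omega> u"
  unfolding norm_H1_def
  by (intro real_le_rsqrt) (auto intro!: add_increasing member_le_sum)

text \<open>Functions and derivatives converge separately in L^2. The identity defining weak
  derivatives passes to the limit against a fixed test function, so the limit of the derivatives is
  a weak derivative of the limit.\<close>

lemma H1_complete:
  assumes X: "\<And>n. X n \<in> H1 \<Omega>"
    and Cauchy: "\<And>e. 0 < e \<Longrightarrow> \<exists>N. \<forall>m\<ge>N. \<forall>n\<ge>N. norm_H1 \<Omega> (\<lambda>x. X m x - X n x) < e"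
  shows "\<exists>u\<in>H1 \<Omega>. (\<lambda>n. norm_H1 \<Omega> (\<lambda>x. X n x - u x)) \<longlonglongrightarrow> 0"
proof -
  have "\<exists>u\<in>L2 L. (\<lambda>n. norm_L2 L (\<lambda>x. X n x - u x)) \<longlonglongrightarrow> 0"
  proof (rule L2_complete[OF finite_L H1_L2[OF X]])
    fix e :: real assume "0 < e"
    with Cauchy norm_L2_le_H1 show "\<exists>N. \<forall>m\<ge>N. \<forall>n\<ge>N. norm_L2 L (\<lambda>x. X m x - X n x) < e"
      by (meson le_less_trans)
  qed
  then obtain u where u: "u \<in> L2 L" "(\<lambda>n. norm_L2 L (\<lambda>x. X n x - u x)) \<longlonglongrightarrow> 0" by blast
  \<comment> \<open>\<open>D\<close> of a difference is a fresh choice, equal to the difference of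
    the chosen derivatives only almost everywhere; the L^2 norm does not see this.\<close>
  have DX: "norm_L2 L (D i (\<lambda>x. X m x - X n x)) = norm_L2 L (\<lambda>x. D i (X m) x - D i (X n) x)" for i m n
    by (intro norm_L2_cong_AE D_diff X L2_measurable L2_diff D_L2 H1_diff)
  have "\<exists>v\<in>L2 L. (\<lambda>n. norm_L2 L (\<lambda>x. D i (X n) x - v x)) \<longlonglongrightarrow> 0" for i
  proof (rule L2_complete[OF finite_L D_L2[OF X]])
    fix e :: real assume "0 < e"
    with Cauchy norm_D_le_H1 show "\<exists>N. \<forall>m\<ge>N. \<forall>n\<ge>N. norm_L2 L (\<lambda>x. D i (X m) x - D i (X n) x) < e"
      unfolding DX[symmetric] by (meson le_less_trans)
  qed
  then have "\<forall>i. \<exists>v. v \<in> L2 L \<and> (\<lambda>n. norm_L2 L (\<lambda>x. D i (X n) x - v x)) \<longlonglongrightarrow> 0" by blast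
  from choice[OF this] obtain v where v: "\<And>i. v i \<in> L2 L"
    "\<And>i. (\<lambda>n. norm_L2 L (\<lambda>x. D i (X n) x - v i x)) \<longlonglongrightarrow> 0" by blast
  have lim: "(\<lambda>n. LINT x|L. f n x * \<phi> x) \<longlonglongrightarrow> (LINT x|L. g x * \<phi> x)"
    if f: "\<And>n. f n \<in> L2 L" and g: "g \<in> L2 L" and \<phi>: "\<phi> \<in> L2 L" and fg: "(\<lambda>n. norm_L2 L (\<lambda>x. f n x - g x)) \<longlonglongrightarrow> 0"
    for f :: "nat \<Rightarrow> real^2 \<Rightarrow> complex" and g \<phi>
  proof (rule LIM_zero_cancel, rule Lim_null_comparison)
    have "(LINT x|L. f n x * \<phi> x) - (LINT x|L. g x * \<phi> x) = (LINT x|L. (f n x - g x) * \<phi> x)" for n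
      unfolding left_diff_distrib
      by (intro Bochner_Integration.integral_diff[symmetric] L2_integrable_mult f g \<phi>)
    then show "\<forall>\<^sub>F n in sequentially. norm ((LINT x|L. f n x * \<phi> x) - (LINT x|L. g x * \<phi> x))
        \<le> norm_L2 L (\<lambda>x. f n x - g x) * norm_L2 L \<phi>"
      using norm_integral_mult_le[OF L2_diff[OF f g] \<phi>] by (intro always_eventually allI) (simp only:)
    show "(\<lambda>n. norm_L2 L (\<lambda>x. f n x - g x) * norm_L2 L \<phi>) \<longlonglongrightarrow> 0"
      using tendsto_mult[OF fg tendsto_const[of "norm_L2 L \<phi>"]] by simp
  qed
  have wd: "is_weak_deriv \<Omega> i u (v i)" for i
    unfolding is_weak_deriv_def
  proof
    fix \<phi> assume \<phi>: "\<phi> \<in> test_functions \<Omega>"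
    have "(\<lambda>n. LINT x|L. X n x * partial_deriv i \<phi> x) \<longlonglongrightarrow> (LINT x|L. u x * partial_deriv i \<phi> x)"
      by (rule lim[OF H1_L2[OF X] u(1) partial_L2[OF \<phi>] u(2)])
    moreover have "(\<lambda>n. - (LINT x|L. D i (X n) x * \<phi> x)) \<longlonglongrightarrow> - (LINT x|L. v i x * \<phi> x)"
      by (intro tendsto_minus lim[OF D_L2[OF X] v(1) test_L2[OF \<phi>] v(2)])
    moreover have "(LINT x|L. X n x * partial_deriv i \<phi> x) = - (LINT x|L. D i (X n) x * \<phi> x)" for n
      using D_is_weak_deriv[OF X] \<phi> unfolding is_weak_deriv_def by blast
    ultimately show "(LINT x|L. u x * partial_deriv i \<phi> x) = - (LINT x|L. v i x * \<phi> x)"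
      using LIMSEQ_unique by simp
  qed
  have uH: "u \<in> H1 \<Omega>" by (rule H1_I[OF u(1) v(1) wd])
  have Du: "norm_L2 L (D i (\<lambda>x. X n x - u x)) = norm_L2 L (\<lambda>x. D i (X n) x - v i x)" for i n
  proof (rule norm_L2_cong_AE)
    show "AE x in L. D i (\<lambda>x. X n x - u x) x = D i (X n) x - v i x"
      using D_diff[OF X uH, of i n] D_AE_eq[OF uH v(1) wd, of i] by eventually_elim simp
  qed (intro L2_measurable L2_diff D_L2 H1_diff X uH v(1))+
  have "(\<lambda>n. norm_H1 \<Omega> (\<lambda>x. X n x - u x)) \<longlonglongrightarrow> sqrt (0\<^sup>2 + (\<Sum>i\<in>(UNIV::2 set). 0\<^sup>2))"
    unfolding norm_H1_def Du by (intro tendsto_intros u v)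
  then show ?thesis using uH by auto
qed

sublocale hilbert_function_space "H1 \<Omega>" G
proof
  show "(\<lambda>_. 0) \<in> H1 \<Omega>" by (rule H1_zero)
  show "G (\<lambda>x. u x + v x) w = G u w + G v w" if "u \<in> H1 \<Omega>" "v \<in> H1 \<Omega>" "w \<in> H1 \<Omega>" for u v w
    using that by (simp add: G_def S_op_add inner_L2_add_left H1_L2)
  show "G (\<lambda>x. c * u x) w = c * G u w" if "u \<in> H1 \<Omega>" "w \<in> H1 \<Omega>" for u w c
    using that by (simp add: G_def S_op_scale inner_L2_scale_left algebra_simps)
  show "cnj (G u v) = G v u" for u v by (simp add: G_def S_op_cnj inner_L2_cnj)
  show "0 \<le> Re (G u u)" for u
    by (simp add: G_def S_op_def inner_L2_self sum_nonneg)
qed (auto simp: sqrt_G intro: H1_add H1_scale H1_complete)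

lemma nrm_eq: "nrm = norm_H1 \<Omega>"
  by (auto simp: nrm_def sqrt_G)

text \<open>A null function has null weak derivatives. This is what makes two representatives of one
  class indistinguishable to the Helmholtz form.\<close>

lemma norm_H1_eq_0:
  assumes "u \<in> H1 \<Omega>" "AE x in L. u x = 0"
  shows "norm_H1 \<Omega> u = 0"
proof -
  have "norm_L2 L (D i u) = 0" for i
    using norm_L2_eq_0_iff[OF D_L2[OF assms(1)]] D_eq_0[OF assms] by blast
  moreover have "norm_L2 L u = 0" using norm_L2_eq_0_iff[OF H1_L2[OF assms(1)]] assms(2) by blast
  ultimately show ?thesis by (simp add: norm_H1_def)
qed

end

section \<open>The Helmholtz operator\<close>

locale helmholtz_domain = bounded_open +
  fixes T :: "(real^2 \<Rightarrow> complex) \<Rightarrow> real^2 \<Rightarrow> complex" and k :: real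
  assumes trace: "trace_operator \<Omega> T"
    and regularity: "helmholtz_regularity \<Omega> T"
    and k_pos: "0 < k"
begin

abbreviation "M\<^sub>\<Gamma> \<equiv> boundary_measure \<Omega>"
abbreviation "A \<equiv> helmholtz_op \<Omega> T k (\<lambda>_. 1)"

lemma T_L2: "u \<in> H1 \<Omega> \<Longrightarrow> T u \<in> L2 M\<^sub>\<Gamma>"
  using trace unfolding trace_operator_def by blast

lemma T_add: "u \<in> H1 \<Omega> \<Longrightarrow> v \<in> H1 \<Omega> \<Longrightarrow> AE x in M\<^sub>\<Gamma>. T (\<lambda>y. u y + v y) x = T u x + T v x"
  using trace unfolding trace_operator_def by blast

lemma T_scale: "u \<in> H1 \<Omega> \<Longrightarrow> AE x in M\<^sub>\<Gamma>. T (\<lambda>y. c * u y) x = c * T u x"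
  using trace unfolding trace_operator_def by blast

lemma B_add:
  assumes "u \<in> H1 \<Omega>" "v \<in> H1 \<Omega>" "w \<in> H1 \<Omega>"
  shows "B_op \<Omega> T (\<lambda>x. u x + v x) w = B_op \<Omega> T u w + B_op \<Omega> T v w"
proof -
  have "B_op \<Omega> T (\<lambda>x. u x + v x) w = inner_L2 M\<^sub>\<Gamma> (\<lambda>x. T u x + T v x) (T w)"
    unfolding B_op_def
    by (intro inner_L2_cong_AE T_add assms L2_measurable L2_add T_L2 H1_add) auto
  also have "\<dots> = B_op \<Omega> T u w + B_op \<Omega> T v w"
    unfolding B_op_def by (intro inner_L2_add_left T_L2 assms)
  finally show ?thesis .
qed

lemma B_scale:
  assumes "u \<in> H1 \<Omega>" "w \<in> H1 \<Omega>"
  shows "B_op \<Omega> T (\<lambda>x. c * u x) w = c * B_op \<Omega> T u w"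
proof -
  have "B_op \<Omega> T (\<lambda>x. c * u x) w = inner_L2 M\<^sub>\<Gamma> (\<lambda>x. c * T u x) (T w)"
    unfolding B_op_def
    by (intro inner_L2_cong_AE T_scale assms L2_measurable L2_scale T_L2 H1_scale) auto
  then show ?thesis by (simp add: B_op_def inner_L2_scale_left)
qed

lemma B_cnj: "cnj (B_op \<Omega> T u v) = B_op \<Omega> T v u"
  by (simp add: B_op_def inner_L2_cnj)

lemma B_bound:
  "\<exists>C\<ge>0. \<forall>u\<in>H1 \<Omega>. \<forall>v\<in>H1 \<Omega>. cmod (B_op \<Omega> T u v) \<le> C * norm_H1 \<Omega> u * norm_H1 \<Omega> v"
proof -
  obtain C where C: "\<And>u. u \<in> H1 \<Omega> \<Longrightarrow> norm_L2 M\<^sub>\<Gamma> (T u) \<le> C * norm_H1 \<Omega> u"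
    using trace unfolding trace_operator_def by blast
  \<comment> \<open>The trace constant comes without a sign. Its square is nonnegative, and C times
    the H^1 norm is nonnegative because it dominates a norm.\<close>
  have "cmod (B_op \<Omega> T u v) \<le> C\<^sup>2 * norm_H1 \<Omega> u * norm_H1 \<Omega> v" if "u \<in> H1 \<Omega>" "v \<in> H1 \<Omega>" for u v
  proof -
    have "cmod (B_op \<Omega> T u v) \<le> norm_L2 M\<^sub>\<Gamma> (T u) * norm_L2 M\<^sub>\<Gamma> (T v)"
      unfolding B_op_def by (intro norm_inner_L2_le T_L2 that)
    also have "\<dots> \<le> (C * norm_H1 \<Omega> u) * (C * norm_H1 \<Omega> v)"
      using C that order_trans[OF norm_L2_nonneg C] by (intro mult_mono) auto
    finally show ?thesis by (simp add: power2_eq_square mult_ac)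
  qed
  then show ?thesis by (intro exI[of _ "C\<^sup>2"]) auto
qed

text \<open>The shift is chosen so that the volume part of the form becomes exactly the H^1 inner
  product; coercivity then holds with constant 1.\<close>

definition A0 :: "(real^2 \<Rightarrow> complex) \<Rightarrow> (real^2 \<Rightarrow> complex) \<Rightarrow> complex" where
  "A0 u \<phi> = G u \<phi> - \<i> * complex_of_real k * B_op \<Omega> T u \<phi>"

lemma A0_add:
  "u \<in> H1 \<Omega> \<Longrightarrow> v \<in> H1 \<Omega> \<Longrightarrow> w \<in> H1 \<Omega> \<Longrightarrow> A0 (\<lambda>x. u x + v x) w = A0 u w + A0 v w"
  by (simp add: A0_def G_add B_add algebra_simps)

lemma A0_scale: "u \<in> H1 \<Omega> \<Longrightarrow> w \<in> H1 \<Omega> \<Longrightarrow> A0 (\<lambda>x. c * u x) w = c * A0 u w"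
  by (simp add: A0_def G_scale B_scale algebra_simps)

lemma antilinear_on_A0:
  assumes "u \<in> H1 \<Omega>"
  shows "antilinear_on (A0 u)"
  unfolding antilinear_on_def
proof (intro conjI ballI allI)
  fix \<phi> \<psi> assume \<phi>: "\<phi> \<in> H1 \<Omega>" "\<psi> \<in> H1 \<Omega>"
  have "B_op \<Omega> T u (\<lambda>x. \<phi> x + \<psi> x) = B_op \<Omega> T u \<phi> + B_op \<Omega> T u \<psi>"
    using arg_cong[OF B_add[OF \<phi> assms], of cnj] by (simp add: B_cnj)
  then show "A0 u (\<lambda>x. \<phi> x + \<psi> x) = A0 u \<phi> + A0 u \<psi>"
    using G_add_right[OF \<phi> assms] by (simp add: A0_def algebra_simps)
next
  fix c \<phi> assume \<phi>: "\<phi> \<in> H1 \<Omega>"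
  have "B_op \<Omega> T u (\<lambda>x. c * \<phi> x) = cnj c * B_op \<Omega> T u \<phi>"
    using arg_cong[OF B_scale[OF \<phi> assms], of cnj c] by (simp add: B_cnj)
  then show "A0 u (\<lambda>x. c * \<phi> x) = cnj c * A0 u \<phi>"
    using G_scale_right[OF \<phi> assms] by (simp add: A0_def algebra_simps)
qed

lemma A0_surjective:
  assumes F: "F \<in> antidual_H1 \<Omega>"
  shows "\<exists>u\<in>H1 \<Omega>. \<forall>\<phi>\<in>H1 \<Omega>. A0 u \<phi> = F \<phi>"
proof -
  obtain C where C: "0 \<le> C"
    "\<And>u v. u \<in> H1 \<Omega> \<Longrightarrow> v \<in> H1 \<Omega> \<Longrightarrow> cmod (B_op \<Omega> T u v) \<le> C * norm_H1 \<Omega> u * norm_H1 \<Omega> v"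
    using B_bound by blast
  obtain K where K: "\<And>\<phi>. \<phi> \<in> H1 \<Omega> \<Longrightarrow> cmod (F \<phi>) \<le> K * norm_H1 \<Omega> \<phi>"
    using F unfolding antidual_H1_def by blast
  show ?thesis
  proof (rule lax_milgram[of A0 "1 + k * C" F K])
    show "antilinear_on F" using F unfolding antidual_H1_def antilinear_on_def by blast
    show "cmod (F \<phi>) \<le> K * nrm \<phi>" if "\<phi> \<in> H1 \<Omega>" for \<phi> using K[OF that] by (simp add: nrm_eq)
    fix u assume u: "u \<in> H1 \<Omega>"
    \<comment> \<open>The boundary form is real on the diagonal, so its multiple by -i k contributes
      nothing to the real part.\<close>
    have "cnj (B_op \<Omega> T u u) = B_op \<Omega> T u u" by (rule B_cnj)
    then have "Im (B_op \<Omega> T u u) = 0" by (simp add: complex_eq_iff)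
    then show "(nrm u)\<^sup>2 \<le> Re (A0 u u)" by (simp add: A0_def nrm_sq[OF u])
  next
    fix u w assume uw: "u \<in> H1 \<Omega>" "w \<in> H1 \<Omega>"
    have "cmod (A0 u w) \<le> cmod (G u w) + k * cmod (B_op \<Omega> T u w)"
      unfolding A0_def using norm_triangle_ineq4[of "G u w" "\<i> * complex_of_real k * B_op \<Omega> T u w"] k_pos
      by (simp add: norm_mult)
    also have "\<dots> \<le> nrm u * nrm w + k * (C * nrm u * nrm w)"
      using G_Cauchy_Schwarz[OF uw] C(2)[OF uw] k_pos by (intro add_mono mult_left_mono) (auto simp: nrm_eq)
    finally show "cmod (A0 u w) \<le> (1 + k * C) * nrm u * nrm w" by (simp add: algebra_simps)
  qed (auto intro: A0_add A0_scale antilinear_on_A0)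
qed

section \<open>Inverting the Helmholtz operator\<close>

lemma A_eq: "A u \<phi> = A0 u \<phi> - (1 + (complex_of_real k)\<^sup>2) * inner_L2 L u \<phi>"
  by (simp add: helmholtz_op_def A0_def G_def M_op_def algebra_simps)

lemma A_add:
  "u \<in> H1 \<Omega> \<Longrightarrow> v \<in> H1 \<Omega> \<Longrightarrow> w \<in> H1 \<Omega> \<Longrightarrow> A (\<lambda>x. u x + v x) w = A u w + A v w"
  by (simp add: A_eq A0_add inner_L2_add_left H1_L2 algebra_simps)

lemma A_scale: "u \<in> H1 \<Omega> \<Longrightarrow> w \<in> H1 \<Omega> \<Longrightarrow> A (\<lambda>x. c * u x) w = c * A u w"
  by (simp add: A_eq A0_scale inner_L2_scale_left algebra_simps)

lemma A_diff:
  "u \<in> H1 \<Omega> \<Longrightarrow> v \<in> H1 \<Omega> \<Longrightarrow> w \<in> H1 \<Omega> \<Longrightarrow> A (\<lambda>x. u x - v x) w = A u w - A v w"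
  using A_add[of u "\<lambda>x. -1 * v x" w] H1_scale[of v "-1"] A_scale[of v w "-1"] by simp

text \<open>Supplies what the form alone does not: the term with -k^2 spoils coercivity of
  \<open>A\<close>, so solvability for L^2 data and uniqueness are both read off from the regularity
  assumption.\<close>

lemma L2_solvable:
  assumes "g \<in> L2 L"
  shows "\<exists>w\<in>H1 \<Omega>. (\<forall>\<phi>\<in>H1 \<Omega>. A w \<phi> = inner_L2 L g \<phi>) \<and>
    (\<forall>v\<in>H1 \<Omega>. (\<forall>\<phi>\<in>H1 \<Omega>. A v \<phi> = inner_L2 L g \<phi>) \<longrightarrow> (AE x in L. v x = w x))"
proof -
  obtain C where "\<forall>k>0. \<forall>g\<in>L2 L. \<exists>w. unique_solution_H1 \<Omega>
       (\<lambda>w. eq_antidual_H1 \<Omega> (helmholtz_op \<Omega> T k (\<lambda>_. 1) w) (inner_L2 L g)) w \<and>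
     w \<in> H2 \<Omega> \<and> norm_H2 \<Omega> w \<le> C * (k + 1 + 1/k + 1/k\<^sup>2) * norm_L2 L g"
    using regularity unfolding helmholtz_regularity_def by (elim exE conjE)
  from this[rule_format, OF k_pos assms] obtain w
    where "unique_solution_H1 \<Omega> (\<lambda>w. eq_antidual_H1 \<Omega> (A w) (inner_L2 L g)) w" by blast
  then show ?thesis unfolding unique_solution_H1_def eq_antidual_H1_def eq_H1_def by blast
qed

text \<open>The coercive problem leaves the defect (1 + k^2) u, which is no longer a general
  functional but an L^2 function; solving with it as right-hand side repairs the solution.\<close>

lemma A_surjective:
  assumes F: "F \<in> antidual_H1 \<Omega>"
  shows "\<exists>u\<in>H1 \<Omega>. \<forall>\<phi>\<in>H1 \<Omega>. A u \<phi> = F \<phi>"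
proof -
  obtain u where u: "u \<in> H1 \<Omega>" "\<And>\<phi>. \<phi> \<in> H1 \<Omega> \<Longrightarrow> A0 u \<phi> = F \<phi>" using A0_surjective[OF F] by blast
  define g where "g = (\<lambda>x. (1 + (complex_of_real k)\<^sup>2) * u x)"
  have "g \<in> L2 L" unfolding g_def by (intro L2_scale H1_L2 u)
  then obtain w where w: "w \<in> H1 \<Omega>" "\<And>\<phi>. \<phi> \<in> H1 \<Omega> \<Longrightarrow> A w \<phi> = inner_L2 L g \<phi>"
    using L2_solvable[of g] by blast
  have "A (\<lambda>x. u x + w x) \<phi> = F \<phi>" if \<phi>: "\<phi> \<in> H1 \<Omega>" for \<phi>
    using A_add[OF u(1) w(1) \<phi>] w(2)[OF \<phi>] u(2)[OF \<phi>]
    by (simp add: A_eq[of u] g_def inner_L2_scale_left)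
  with H1_add[OF u(1) w(1)] show ?thesis by blast
qed

text \<open>Both d and 0 solve the problem with datum 0, so both agree with its unique
  solution.\<close>

lemma A_injective:
  assumes d: "d \<in> H1 \<Omega>" and zero: "\<And>\<phi>. \<phi> \<in> H1 \<Omega> \<Longrightarrow> A d \<phi> = 0"
  shows "AE x in L. d x = 0"
proof -
  have I: "inner_L2 L (\<lambda>_. 0) \<phi> = 0" for \<phi> by (simp add: inner_L2_def)
  obtain w where w: "\<And>v. v \<in> H1 \<Omega> \<Longrightarrow> (\<forall>\<phi>\<in>H1 \<Omega>. A v \<phi> = inner_L2 L (\<lambda>_. 0) \<phi>) \<Longrightarrow> AE x in L. v x = w x"
    using L2_solvable[OF L2_zero] by blast
  have "A (\<lambda>_. 0) \<phi> = 0" if "\<phi> \<in> H1 \<Omega>" for \<phi> using A_scale[OF H1_zero that, of 0] by simp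
  then have "AE x in L. 0 = w x" using w[OF H1_zero] I by simp
  moreover have "AE x in L. d x = w x" using w[OF d] zero I by simp
  ultimately show ?thesis by eventually_elim simp
qed

text \<open>Makes \<open>A\<close> well defined on classes. For the boundary term this rests on the
  H^1 bound of the trace, since the values of d on the boundary are not determined almost everywhere
  in the domain.\<close>

lemma A_AE_zero:
  assumes d: "d \<in> H1 \<Omega>" "AE x in L. d x = 0" and \<phi>: "\<phi> \<in> H1 \<Omega>"
  shows "A d \<phi> = 0"
proof -
  have n: "norm_H1 \<Omega> d = 0" by (rule norm_H1_eq_0[OF d])
  have "G d \<phi> = 0" using G_Cauchy_Schwarz[OF d(1) \<phi>] n by (simp add: nrm_eq)
  moreover obtain C where "cmod (B_op \<Omega> T d \<phi>) \<le> C * norm_H1 \<Omega> d * norm_H1 \<Omega> \<phi>"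
    using B_bound d(1) \<phi> by blast
  then have "B_op \<Omega> T d \<phi> = 0" using n by simp
  moreover have "inner_L2 L d \<phi> = 0"
    unfolding inner_L2_def using d(2) by (intro integral_eq_zero_AE) auto
  ultimately show ?thesis by (simp add: A_eq A0_def)
qed

lemma helmholtz_inv_props:
  assumes "F \<in> antidual_H1 \<Omega>"
  shows "helmholtz_inv \<Omega> T k F \<in> H1 \<Omega>"
    and "\<phi> \<in> H1 \<Omega> \<Longrightarrow> A (helmholtz_inv \<Omega> T k F) \<phi> = F \<phi>"
proof -
  have "\<exists>y. y \<in> H1 \<Omega> \<and> eq_antidual_H1 \<Omega> (A y) F"
    using A_surjective[OF assms] unfolding eq_antidual_H1_def by blast
  from someI_ex[OF this] have "helmholtz_inv \<Omega> T k F \<in> H1 \<Omega> \<and> eq_antidual_H1 \<Omega> (A (helmholtz_inv \<Omega> T k F)) F"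
    unfolding helmholtz_inv_def .
  then show "helmholtz_inv \<Omega> T k F \<in> H1 \<Omega>" "\<phi> \<in> H1 \<Omega> \<Longrightarrow> A (helmholtz_inv \<Omega> T k F) \<phi> = F \<phi>"
    unfolding eq_antidual_H1_def by auto
qed

text \<open>Integrability is a hypothesis of its own because the Bochner integral of a
  non-integrable function is 0 by convention, so a bound on the values would not give
  additivity.\<close>

lemma M_op_antidual:
  assumes u: "u \<in> H1 \<Omega>"
    and int: "\<And>\<phi>. \<phi> \<in> H1 \<Omega> \<Longrightarrow> integrable L (\<lambda>x. complex_of_real (q x) * u x * cnj (\<phi> x))"
    and bound: "\<And>\<phi>. \<phi> \<in> H1 \<Omega> \<Longrightarrow> cmod (M_op \<Omega> q u \<phi>) \<le> C * norm_H1 \<Omega> \<phi>"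
  shows "M_op \<Omega> q u \<in> antidual_H1 \<Omega>"
proof -
  have "M_op \<Omega> q u (\<lambda>x. \<phi> x + \<psi> x) = M_op \<Omega> q u \<phi> + M_op \<Omega> q u \<psi>" if "\<phi> \<in> H1 \<Omega>" "\<psi> \<in> H1 \<Omega>" for \<phi> \<psi>
    using Bochner_Integration.integral_add[OF int[OF that(1)] int[OF that(2)]]
    by (simp add: M_op_def inner_L2_def distrib_left)
  moreover have "M_op \<Omega> q u (\<lambda>x. c * \<phi> x) = cnj c * M_op \<Omega> q u \<phi>" for c \<phi>
    by (simp add: M_op_def inner_L2_def mult.left_commute)
  ultimately show ?thesis using bound unfolding antidual_H1_def by blast
qed

text \<open>Both equations concern the residual \<open>d\<close>: it vanishes almost everywhere
  exactly when \<open>A d\<close> vanishes as a functional, and \<open>A d\<close> is the residual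
  of the second equation. The claim is made for each v separately, so that uniqueness transfers as
  well.\<close>

lemma solution_equivalence:
  assumes f: "f \<in> antidual_H1 \<Omega>"
    and int: "\<And>u \<phi>. u \<in> H1 \<Omega> \<Longrightarrow> \<phi> \<in> H1 \<Omega> \<Longrightarrow> integrable L (\<lambda>x. complex_of_real (q x) * u x * cnj (\<phi> x))"
    and bound: "\<And>u. u \<in> H1 \<Omega> \<Longrightarrow> \<exists>C. \<forall>\<phi>\<in>H1 \<Omega>. cmod (M_op \<Omega> q u \<phi>) \<le> C * norm_H1 \<Omega> \<phi>"
    and v: "v \<in> H1 \<Omega>"
  shows "eq_H1 \<Omega> (\<lambda>x. v x - (complex_of_real k)\<^sup>2 * V_op \<Omega> T k q v x) (helmholtz_inv \<Omega> T k f) \<longleftrightarrow>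
    eq_antidual_H1 \<Omega> (helmholtz_op \<Omega> T k (\<lambda>x. 1 + q x) v) f"
proof -
  define y z where "y = helmholtz_inv \<Omega> T k f" and "z = V_op \<Omega> T k q v"
  have z_eq: "z = helmholtz_inv \<Omega> T k (M_op \<Omega> q v)" by (simp add: z_def V_op_def V_tilde_op_def)
  \<comment> \<open>Membership in the anti-dual guarantees that the choice inside
    \<open>helmholtz_inv\<close> returns a solution.\<close>
  have M: "M_op \<Omega> q v \<in> antidual_H1 \<Omega>"
    using bound[OF v] M_op_antidual[OF v int[OF v]] by blast
  have y: "y \<in> H1 \<Omega>" "\<And>\<phi>. \<phi> \<in> H1 \<Omega> \<Longrightarrow> A y \<phi> = f \<phi>"
    unfolding y_def using helmholtz_inv_props[OF f] by auto
  have z: "z \<in> H1 \<Omega>" "\<And>\<phi>. \<phi> \<in> H1 \<Omega> \<Longrightarrow> A z \<phi> = M_op \<Omega> q v \<phi>"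
    unfolding z_eq using helmholtz_inv_props[OF M] by auto
  define d where "d = (\<lambda>x. (v x - (complex_of_real k)\<^sup>2 * z x) - y x)"
  have kz: "(\<lambda>x. (complex_of_real k)\<^sup>2 * z x) \<in> H1 \<Omega>" by (rule H1_scale[OF z(1)])
  have d: "d \<in> H1 \<Omega>" unfolding d_def by (intro H1_diff v kz y)
  have Ad: "A d \<phi> = helmholtz_op \<Omega> T k (\<lambda>x. 1 + q x) v \<phi> - f \<phi>" if \<phi>: "\<phi> \<in> H1 \<Omega>" for \<phi>
  proof -
    have "integrable L (\<lambda>x. v x * cnj (\<phi> x))" by (intro L2_integrable_mult L2_cnj H1_L2 v \<phi>)
    from Bochner_Integration.integral_add[OF this int[OF v \<phi>]]
    have "M_op \<Omega> (\<lambda>x. 1 + q x) v \<phi> = M_op \<Omega> (\<lambda>_. 1) v \<phi> + M_op \<Omega> q v \<phi>"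
      by (simp add: M_op_def inner_L2_def distrib_right)
    then have "helmholtz_op \<Omega> T k (\<lambda>x. 1 + q x) v \<phi> = A v \<phi> - (complex_of_real k)\<^sup>2 * M_op \<Omega> q v \<phi>"
      by (simp add: helmholtz_op_def algebra_simps)
    moreover have "A d \<phi> = (A v \<phi> - (complex_of_real k)\<^sup>2 * A z \<phi>) - A y \<phi>"
      unfolding d_def A_diff[OF H1_diff[OF v kz] y(1) \<phi>] A_diff[OF v kz \<phi>] A_scale[OF z(1) \<phi>] ..
    ultimately show ?thesis using z(2)[OF \<phi>] y(2)[OF \<phi>] by simp
  qed
  have "(AE x in L. d x = 0) \<longleftrightarrow> (\<forall>\<phi>\<in>H1 \<Omega>. A d \<phi> = 0)"
    using A_injective[OF d] A_AE_zero[OF d] by blast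
  moreover have "(AE x in L. d x = 0) \<longleftrightarrow> eq_H1 \<Omega> (\<lambda>x. v x - (complex_of_real k)\<^sup>2 * z x) y"
    by (simp add: d_def eq_H1_def)
  moreover have "(\<forall>\<phi>\<in>H1 \<Omega>. A d \<phi> = 0) \<longleftrightarrow> eq_antidual_H1 \<Omega> (helmholtz_op \<Omega> T k (\<lambda>x. 1 + q x) v) f"
    using Ad by (auto simp: eq_antidual_H1_def)
  ultimately show ?thesis unfolding y_def z_def by blast
qed

end

section \<open>Line integrals in the plane\<close>

lemma vector_2_measurable: "(\<lambda>(a::real, b). vector [a, b] :: real^2) \<in> borel_measurable (borel \<Otimes>\<^sub>M borel)"
proof -
  have "continuous_on UNIV (\<lambda>p::real \<times> real. vector [fst p, snd p] :: real^2)"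
    unfolding continuous_on_def
  proof (intro ballI vec_tendstoI)
    fix x :: "real \<times> real" and i :: 2
    show "((\<lambda>p. vector [fst p, snd p] $ i) \<longlongrightarrow> (vector [fst x, snd x] :: real^2) $ i) (at x)"
      using exhaust_2[of i] by (elim disjE) (simp_all only: vector_2 tendsto_fst tendsto_snd tendsto_ident_at)
  qed
  from borel_measurable_continuous_onI[OF this] show ?thesis
    by (simp add: case_prod_beta' borel_prod)
qed

text \<open>Both measures agree on boxes; this transfers Tonelli from pairs of reals to
  vectors.\<close>

lemma lborel_real2: "lborel = distr (lborel \<Otimes>\<^sub>M lborel) borel (\<lambda>(a::real, b). vector [a, b] :: real^2)"
proof (rule lborel_eqI)
  note [measurable] = vector_2_measurable
  fix l u :: "real^2" assume le: "\<And>b. b \<in> Basis \<Longrightarrow> l \<bullet> b \<le> u \<bullet> b"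
  have lu: "l $ i \<le> u $ i" for i
    using le[of "axis i 1"] by (simp add: inner_axis axis_in_Basis_iff)
  have "emeasure (distr (lborel \<Otimes>\<^sub>M lborel) borel (\<lambda>(a::real, b). vector [a, b] :: real^2)) (box l u)
      = emeasure (lborel \<Otimes>\<^sub>M lborel) ((\<lambda>(a::real, b). vector [a, b] :: real^2) -` box l u)"
    by (subst emeasure_distr) (auto simp: space_pair_measure)
  also have "(\<lambda>(a::real, b). vector [a, b] :: real^2) -` box l u = {l $ 1<..<u $ 1} \<times> {l $ 2<..<u $ 2}"
    by (auto simp: mem_box_cart forall_2)
  also have "emeasure (lborel \<Otimes>\<^sub>M lborel) \<dots> = ennreal (u $ 1 - l $ 1) * ennreal (u $ 2 - l $ 2)"
    by (subst lborel.emeasure_pair_measure_Times) (auto simp: lu)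
  also have "\<dots> = ennreal ((u $ 1 - l $ 1) * (u $ 2 - l $ 2))"
    using lu by (simp add: ennreal_mult)
  also have "(u $ 1 - l $ 1) * (u $ 2 - l $ 2) = (\<Prod>b\<in>Basis. (u - l) \<bullet> b)"
  proof -
    have B: "(Basis :: (real^2) set) = {axis 1 1, axis 2 1}"
      by (auto simp: Basis_vec_def UNIV_2)
    have "axis 1 (1::real) \<noteq> (axis 2 1 :: real^2)" by (simp add: axis_eq_axis)
    then show ?thesis unfolding B by (simp add: inner_axis)
  qed
  finally show "emeasure (distr (lborel \<Otimes>\<^sub>M lborel) borel (\<lambda>(a::real, b). vector [a, b] :: real^2)) (box l u)
      = (\<Prod>b\<in>Basis. (u - l) \<bullet> b)" .
qed simp

lemma nn_integral_real2:
  fixes W :: "real^2 \<Rightarrow> ennreal"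
  assumes [measurable]: "W \<in> borel_measurable borel"
  shows "(\<integral>\<^sup>+x. W x \<partial>lborel) = (\<integral>\<^sup>+a. \<integral>\<^sup>+b. W (vector [a, b]) \<partial>lborel \<partial>lborel)"
proof -
  note [measurable] = vector_2_measurable
  have "(\<integral>\<^sup>+x. W x \<partial>lborel) = (\<integral>\<^sup>+p. W (case p of (a, b) \<Rightarrow> vector [a, b]) \<partial>(lborel \<Otimes>\<^sub>M lborel))"
    by (subst lborel_real2, subst nn_integral_distr) auto
  also have "\<dots> = (\<integral>\<^sup>+a. \<integral>\<^sup>+b. W (vector [a, b]) \<partial>lborel \<partial>lborel)"
    by (subst lborel.nn_integral_fst[symmetric]) auto
  finally show ?thesis .
qed

text \<open>Change of variables for (t, r) -> t d + r e, reduced to one-dimensional affine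
  substitutions and Tonelli. If the first entry of e is 0 the map is triangular and the order of
  integration can be kept.\<close>

lemma nn_integral_oblique:
  fixes W :: "real^2 \<Rightarrow> ennreal" and d e :: "real^2"
  assumes W[measurable]: "W \<in> borel_measurable borel"
    and det: "d $ 1 * e $ 2 - d $ 2 * e $ 1 \<noteq> 0"
  shows "ennreal \<bar>d $ 1 * e $ 2 - d $ 2 * e $ 1\<bar> * (\<integral>\<^sup>+t. \<integral>\<^sup>+r. W (t *\<^sub>R d + r *\<^sub>R e) \<partial>lborel \<partial>lborel)
    = (\<integral>\<^sup>+x. W x \<partial>lborel)"
proof -
  define V where "V a b = W (vector [a, b])" for a b :: real
  have V[measurable]: "(\<lambda>(a, b). V a b) \<in> borel_measurable (borel \<Otimes>\<^sub>M borel)"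
    unfolding V_def case_prod_beta' using measurable_compose[OF vector_2_measurable W] by (simp add: case_prod_beta')
  have VW: "W (t *\<^sub>R d + r *\<^sub>R e) = V (t * d $ 1 + r * e $ 1) (t * d $ 2 + r * e $ 2)" for t r
    unfolding V_def by (rule arg_cong[where f=W]) (simp add: vec_eq_iff forall_2)
  have int: "(\<integral>\<^sup>+x. W x \<partial>lborel) = (\<integral>\<^sup>+a. \<integral>\<^sup>+b. V a b \<partial>lborel \<partial>lborel)"
    unfolding V_def by (rule nn_integral_real2[OF W])
  show ?thesis
  proof (cases "e $ 1 = 0")
    case True
    with det have nz: "d $ 1 \<noteq> 0" "e $ 2 \<noteq> 0" by auto
    have "(\<integral>\<^sup>+a. \<integral>\<^sup>+b. V a b \<partial>lborel \<partial>lborel)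
        = ennreal \<bar>d $ 1\<bar> * (\<integral>\<^sup>+t. \<integral>\<^sup>+b. V (0 + d $ 1 * t) b \<partial>lborel \<partial>lborel)"
      by (rule nn_integral_real_affine[OF _ nz(1)]) measurable
    also have "\<dots> = ennreal \<bar>d $ 1\<bar> * (\<integral>\<^sup>+t. ennreal \<bar>e $ 2\<bar> * (\<integral>\<^sup>+r. V (0 + d $ 1 * t) (t * d $ 2 + e $ 2 * r) \<partial>lborel) \<partial>lborel)"
      by (intro arg_cong[where f="\<lambda>z. _ * z"] nn_integral_cong nn_integral_real_affine[OF _ nz(2)]) measurable
    also have "\<dots> = ennreal \<bar>d $ 1\<bar> * (ennreal \<bar>e $ 2\<bar> * (\<integral>\<^sup>+t. \<integral>\<^sup>+r. V (0 + d $ 1 * t) (t * d $ 2 + e $ 2 * r) \<partial>lborel \<partial>lborel))"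
      by (subst nn_integral_cmult) auto
    finally show ?thesis
      unfolding int VW using True by (simp add: abs_mult ennreal_mult mult.assoc mult.commute)
  next
    case False
    \<comment> \<open>Once r is traded for the first coordinate a, the second coordinate at fixed a
      is affine in t with slope \<open>m\<close>; \<open>m * e $ 1\<close> is minus the
      determinant.\<close>
    define m where "m = d $ 2 - d $ 1 * e $ 2 / e $ 1"
    have m: "m \<noteq> 0" using det False by (auto simp: m_def field_simps)
    have "(\<integral>\<^sup>+t. \<integral>\<^sup>+a. V a (t * d $ 2 + (a - t * d $ 1) / e $ 1 * e $ 2) \<partial>lborel \<partial>lborel)
        = (\<integral>\<^sup>+t. ennreal \<bar>e $ 1\<bar> * (\<integral>\<^sup>+r. V (t * d $ 1 + r * e $ 1) (t * d $ 2 + r * e $ 2) \<partial>lborel) \<partial>lborel)"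
    proof (rule nn_integral_cong)
      fix t :: real
      have "(\<integral>\<^sup>+a. V a (t * d $ 2 + (a - t * d $ 1) / e $ 1 * e $ 2) \<partial>lborel)
         = ennreal \<bar>e $ 1\<bar> * (\<integral>\<^sup>+r. V (t * d $ 1 + e $ 1 * r) (t * d $ 2 + (t * d $ 1 + e $ 1 * r - t * d $ 1) / e $ 1 * e $ 2) \<partial>lborel)"
        by (rule nn_integral_real_affine[OF _ False]) measurable
      then show "(\<integral>\<^sup>+a. V a (t * d $ 2 + (a - t * d $ 1) / e $ 1 * e $ 2) \<partial>lborel)
         = ennreal \<bar>e $ 1\<bar> * (\<integral>\<^sup>+r. V (t * d $ 1 + r * e $ 1) (t * d $ 2 + r * e $ 2) \<partial>lborel)"
        using False by (simp add: mult.commute)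
    qed
    also have "\<dots> = ennreal \<bar>e $ 1\<bar> * (\<integral>\<^sup>+t. \<integral>\<^sup>+r. V (t * d $ 1 + r * e $ 1) (t * d $ 2 + r * e $ 2) \<partial>lborel \<partial>lborel)"
      by (rule nn_integral_cmult) measurable
    finally have 1: "ennreal \<bar>e $ 1\<bar> * (\<integral>\<^sup>+t. \<integral>\<^sup>+r. V (t * d $ 1 + r * e $ 1) (t * d $ 2 + r * e $ 2) \<partial>lborel \<partial>lborel)
        = (\<integral>\<^sup>+t. \<integral>\<^sup>+a. V a (t * d $ 2 + (a - t * d $ 1) / e $ 1 * e $ 2) \<partial>lborel \<partial>lborel)" ..
    also have "\<dots> = (\<integral>\<^sup>+a. \<integral>\<^sup>+t. V a (t * d $ 2 + (a - t * d $ 1) / e $ 1 * e $ 2) \<partial>lborel \<partial>lborel)"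
      by (rule lborel_pair.Fubini') measurable
    also have "ennreal \<bar>m\<bar> * \<dots> = (\<integral>\<^sup>+a. ennreal \<bar>m\<bar> * (\<integral>\<^sup>+t. V a (t * d $ 2 + (a - t * d $ 1) / e $ 1 * e $ 2) \<partial>lborel) \<partial>lborel)"
      by (rule nn_integral_cmult[symmetric]) measurable
    also have "\<dots> = (\<integral>\<^sup>+a. \<integral>\<^sup>+b. V a b \<partial>lborel \<partial>lborel)"
    proof (rule nn_integral_cong)
      fix a :: real
      have "(\<integral>\<^sup>+b. V a b \<partial>lborel) = ennreal \<bar>m\<bar> * (\<integral>\<^sup>+t. V a (a * e $ 2 / e $ 1 + m * t) \<partial>lborel)"
        by (rule nn_integral_real_affine[OF _ m]) measurable
      also have "(\<lambda>t. V a (a * e $ 2 / e $ 1 + m * t)) = (\<lambda>t. V a (t * d $ 2 + (a - t * d $ 1) / e $ 1 * e $ 2))"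
        using False by (intro ext arg_cong[where f="V a"]) (simp add: m_def field_simps)
      finally show "ennreal \<bar>m\<bar> * (\<integral>\<^sup>+t. V a (t * d $ 2 + (a - t * d $ 1) / e $ 1 * e $ 2) \<partial>lborel) = (\<integral>\<^sup>+b. V a b \<partial>lborel)" ..
    qed
    finally have "(\<integral>\<^sup>+a. \<integral>\<^sup>+b. V a b \<partial>lborel \<partial>lborel)
        = (ennreal \<bar>m\<bar> * ennreal \<bar>e $ 1\<bar>) * (\<integral>\<^sup>+t. \<integral>\<^sup>+r. V (t * d $ 1 + r * e $ 1) (t * d $ 2 + r * e $ 2) \<partial>lborel \<partial>lborel)"
      by (simp add: mult.assoc)
    also have "ennreal \<bar>m\<bar> * ennreal \<bar>e $ 1\<bar> = ennreal (\<bar>m * e $ 1\<bar>)"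
      by (simp add: ennreal_mult abs_mult)
    also have "m * e $ 1 = - (d $ 1 * e $ 2 - d $ 2 * e $ 1)"
      using False by (simp add: m_def field_simps)
    finally show ?thesis unfolding int VW by (simp only: abs_minus_cancel)
  qed
qed

lemma nn_integral_translate:
  fixes W :: "'a::euclidean_space \<Rightarrow> ennreal"
  assumes [measurable]: "W \<in> borel_measurable borel"
  shows "(\<integral>\<^sup>+x. W (c + x) \<partial>lborel) = (\<integral>\<^sup>+x. W x \<partial>lborel)"
  by (subst lborel_distr_plus[of c, symmetric], subst nn_integral_distr) auto

text \<open>Shifting x by t d turns the first factor into V x and leaves the integral of W over the
  points x - t d + r e, which sweep out the plane with constant density 1/|det|. With two directions
  in the plane this gives an equality.\<close>

lemma loomis_whitney_oblique:
  fixes V W :: "real^2 \<Rightarrow> ennreal" and d e :: "real^2"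
  assumes V[measurable]: "V \<in> borel_measurable borel" and W[measurable]: "W \<in> borel_measurable borel"
    and det: "d $ 1 * e $ 2 - d $ 2 * e $ 1 \<noteq> 0"
  shows "ennreal \<bar>d $ 1 * e $ 2 - d $ 2 * e $ 1\<bar> *
      (\<integral>\<^sup>+x. (\<integral>\<^sup>+t. V (x + t *\<^sub>R d) \<partial>lborel) * (\<integral>\<^sup>+r. W (x + r *\<^sub>R e) \<partial>lborel) \<partial>lborel)
    = (\<integral>\<^sup>+x. V x \<partial>lborel) * (\<integral>\<^sup>+x. W x \<partial>lborel)"
proof -
  let ?c = "ennreal \<bar>d $ 1 * e $ 2 - d $ 2 * e $ 1\<bar>"
  have "(\<integral>\<^sup>+x. (\<integral>\<^sup>+t. V (x + t *\<^sub>R d) \<partial>lborel) * (\<integral>\<^sup>+r. W (x + r *\<^sub>R e) \<partial>lborel) \<partial>lborel)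
      = (\<integral>\<^sup>+x. \<integral>\<^sup>+t. V (x + t *\<^sub>R d) * (\<integral>\<^sup>+r. W (x + r *\<^sub>R e) \<partial>lborel) \<partial>lborel \<partial>lborel)"
    by (intro nn_integral_cong nn_integral_multc[symmetric]) measurable
  also have "\<dots> = (\<integral>\<^sup>+t. \<integral>\<^sup>+x. V (x + t *\<^sub>R d) * (\<integral>\<^sup>+r. W (x + r *\<^sub>R e) \<partial>lborel) \<partial>lborel \<partial>lborel)"
    by (rule lborel_pair.Fubini') measurable
  also have "\<dots> = (\<integral>\<^sup>+t. \<integral>\<^sup>+x. V x * (\<integral>\<^sup>+r. W (x - t *\<^sub>R d + r *\<^sub>R e) \<partial>lborel) \<partial>lborel \<partial>lborel)"
  proof (rule nn_integral_cong)
    fix t :: real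
    have "(\<integral>\<^sup>+x. V x * (\<integral>\<^sup>+r. W (x - t *\<^sub>R d + r *\<^sub>R e) \<partial>lborel) \<partial>lborel)
        = (\<integral>\<^sup>+x. V (t *\<^sub>R d + x) * (\<integral>\<^sup>+r. W (t *\<^sub>R d + x - t *\<^sub>R d + r *\<^sub>R e) \<partial>lborel) \<partial>lborel)"
      by (rule nn_integral_translate[symmetric]) measurable
    then show "(\<integral>\<^sup>+x. V (x + t *\<^sub>R d) * (\<integral>\<^sup>+r. W (x + r *\<^sub>R e) \<partial>lborel) \<partial>lborel)
        = (\<integral>\<^sup>+x. V x * (\<integral>\<^sup>+r. W (x - t *\<^sub>R d + r *\<^sub>R e) \<partial>lborel) \<partial>lborel)"
      by (simp add: add.commute)
  qed
  also have "\<dots> = (\<integral>\<^sup>+x. \<integral>\<^sup>+t. V x * (\<integral>\<^sup>+r. W (x - t *\<^sub>R d + r *\<^sub>R e) \<partial>lborel) \<partial>lborel \<partial>lborel)"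
    by (rule lborel_pair.Fubini'[symmetric]) measurable
  also have "\<dots> = (\<integral>\<^sup>+x. V x * (\<integral>\<^sup>+t. \<integral>\<^sup>+r. W (x - t *\<^sub>R d + r *\<^sub>R e) \<partial>lborel \<partial>lborel) \<partial>lborel)"
    by (intro nn_integral_cong nn_integral_cmult) measurable
  finally have "?c * (\<integral>\<^sup>+x. (\<integral>\<^sup>+t. V (x + t *\<^sub>R d) \<partial>lborel) * (\<integral>\<^sup>+r. W (x + r *\<^sub>R e) \<partial>lborel) \<partial>lborel)
      = ?c * (\<integral>\<^sup>+x. V x * (\<integral>\<^sup>+t. \<integral>\<^sup>+r. W (x - t *\<^sub>R d + r *\<^sub>R e) \<partial>lborel \<partial>lborel) \<partial>lborel)" by simp
  also have "\<dots> = (\<integral>\<^sup>+x. ?c * (V x * (\<integral>\<^sup>+t. \<integral>\<^sup>+r. W (x - t *\<^sub>R d + r *\<^sub>R e) \<partial>lborel \<partial>lborel)) \<partial>lborel)"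
    by (rule nn_integral_cmult[symmetric]) measurable
  also have "\<dots> = (\<integral>\<^sup>+x. V x * (\<integral>\<^sup>+y. W y \<partial>lborel) \<partial>lborel)"
  proof (rule nn_integral_cong)
    fix x
    \<comment> \<open>Reversing d to -d only changes the sign of the determinant.\<close>
    have "?c * (\<integral>\<^sup>+t. \<integral>\<^sup>+r. W (x - t *\<^sub>R d + r *\<^sub>R e) \<partial>lborel \<partial>lborel)
        = ennreal \<bar>(- d) $ 1 * e $ 2 - (- d) $ 2 * e $ 1\<bar> * (\<integral>\<^sup>+t. \<integral>\<^sup>+r. W (x + (t *\<^sub>R (- d) + r *\<^sub>R e)) \<partial>lborel \<partial>lborel)"
      by (simp add: abs_minus_commute add_diff_eq diff_add_eq)
    also have "\<dots> = (\<integral>\<^sup>+y. W (x + y) \<partial>lborel)"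
      by (rule nn_integral_oblique) (use det in auto)
    also have "\<dots> = (\<integral>\<^sup>+y. W y \<partial>lborel)" by (rule nn_integral_translate[OF W])
    finally show "?c * (V x * (\<integral>\<^sup>+t. \<integral>\<^sup>+r. W (x - t *\<^sub>R d + r *\<^sub>R e) \<partial>lborel \<partial>lborel)) = V x * (\<integral>\<^sup>+y. W y \<partial>lborel)"
      by (simp add: mult.left_commute)
  qed
  also have "\<dots> = (\<integral>\<^sup>+x. V x \<partial>lborel) * (\<integral>\<^sup>+x. W x \<partial>lborel)"
    by (rule nn_integral_multc) measurable
  finally show ?thesis .
qed

section \<open>Translates and directional derivatives of test functions\<close>

lemma frechet_derivative_translate:
  fixes \<phi> :: "real^2 \<Rightarrow> complex"
  assumes "\<phi> differentiable (at (x - a))"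
  shows "((\<lambda>x. \<phi> (x - a)) has_derivative frechet_derivative \<phi> (at (x - a))) (at x)"
proof -
  have 1: "(\<phi> has_derivative frechet_derivative \<phi> (at (x - a))) (at (x - a))"
    using assms frechet_derivative_works by blast
  have "((\<lambda>x. x - a) has_derivative (\<lambda>h. h)) (at x)" by (auto intro!: derivative_eq_intros)
  from has_derivative_compose[OF this 1] show ?thesis by simp
qed

lemma Ck_translate: "Ck n \<phi> \<Longrightarrow> Ck n (\<lambda>x. \<phi> (x - a))"
proof (induction n arbitrary: \<phi>)
  case 0
  have "continuous_on UNIV (\<lambda>x. x - a)" by (intro continuous_intros)
  from continuous_on_compose2[OF _ this, of UNIV \<phi>] 0 show ?case by simp
next
  case (Suc n)
  then have d: "((\<lambda>x. \<phi> (x - a)) has_derivative frechet_derivative \<phi> (at (x - a))) (at x)" for x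
    by (intro frechet_derivative_translate) simp
  have "partial_deriv i (\<lambda>x. \<phi> (x - a)) = (\<lambda>x. partial_deriv i \<phi> (x - a))" for i
    unfolding partial_deriv_def frechet_derivative_at[OF d, symmetric] ..
  then show ?case using Suc d by (auto simp: differentiable_def)
qed

lemma test_functions_translate:
  assumes \<phi>: "\<phi> \<in> test_functions U" and UV: "\<And>x. x \<in> U \<Longrightarrow> x + a \<in> V"
  shows "(\<lambda>x. \<phi> (x - a)) \<in> test_functions V"
proof -
  have "{x. \<phi> (x - a) \<noteq> 0} = (\<lambda>x. a + x) ` {x. \<phi> x \<noteq> 0}"
    by (auto simp: image_iff) (metis add.commute diff_add_cancel)
  then have cl: "closure {x. \<phi> (x - a) \<noteq> 0} = (\<lambda>x. a + x) ` closure {x. \<phi> x \<noteq> 0}"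
    by (simp only: closure_translation)
  have 1: "\<forall>n. Ck n \<phi>" "compact (closure {x. \<phi> x \<noteq> 0})" "closure {x. \<phi> x \<noteq> 0} \<subseteq> U"
    using \<phi> unfolding test_functions_def by blast+
  have "closure {x. \<phi> (x - a) \<noteq> 0} \<subseteq> V"
    unfolding cl using 1(3) UV by (auto simp: add.commute)
  moreover have "compact (closure {x. \<phi> (x - a) \<noteq> 0})"
    unfolding cl by (rule compact_translation[OF 1(2)])
  ultimately show ?thesis unfolding test_functions_def using 1(1) Ck_translate by blast
qed

text \<open>Written with partial derivatives so that the weak identities for the two coordinates can
  be combined linearly; on test functions it is the Frechet derivative applied to d.\<close>

definition dir_deriv :: "real^2 \<Rightarrow> (real^2 \<Rightarrow> complex) \<Rightarrow> real^2 \<Rightarrow> complex" where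
  "dir_deriv d \<phi> x = (\<Sum>i\<in>UNIV. complex_of_real (d $ i) * partial_deriv i \<phi> x)"

lemma test_differentiable: "\<phi> \<in> test_functions U \<Longrightarrow> \<phi> differentiable (at x)"
proof -
  assume "\<phi> \<in> test_functions U"
  then have "Ck (Suc 0) \<phi>" unfolding test_functions_def by blast
  then show ?thesis by simp
qed

lemma dir_deriv_frechet:
  assumes "\<phi> \<in> test_functions U"
  shows "frechet_derivative \<phi> (at x) d = dir_deriv d \<phi> x"
proof -
  have lin: "linear (frechet_derivative \<phi> (at x))"
    using test_differentiable[OF assms] frechet_derivative_works has_derivative_linear by blast
  have "d = (\<Sum>i\<in>UNIV. d $ i *\<^sub>R axis i 1)"
    by (simp add: vec_eq_iff axis_def if_distrib cong: if_cong)
  then have "frechet_derivative \<phi> (at x) d = frechet_derivative \<phi> (at x) (\<Sum>i\<in>UNIV. d $ i *\<^sub>R axis i 1)" by simp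
  also have "\<dots> = (\<Sum>i\<in>UNIV. d $ i *\<^sub>R frechet_derivative \<phi> (at x) (axis i 1))"
    by (simp add: linear_sum[OF lin] linear_scale[OF lin])
  also have "\<dots> = dir_deriv d \<phi> x" by (simp add: dir_deriv_def partial_deriv_def scaleR_conv_of_real)
  finally show ?thesis .
qed

lemma dir_deriv_continuous:
  assumes "\<phi> \<in> test_functions U"
  shows "continuous_on UNIV (dir_deriv d \<phi>)"
  unfolding dir_deriv_def[abs_def]
  by (intro continuous_on_sum continuous_on_mult continuous_on_const
      test_functions_continuous[OF partial_deriv_test[OF assms]])

lemma dir_deriv_bounded:
  assumes "\<phi> \<in> test_functions U"
  obtains C where "\<And>x. cmod (dir_deriv d \<phi> x) \<le> C"
proof -
  have "\<exists>C. \<forall>x. cmod (partial_deriv i \<phi> x) \<le> C" for i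
    using test_functions_bounded[OF partial_deriv_test[OF assms, of i]] by blast
  then obtain C where C: "\<And>i x. cmod (partial_deriv i \<phi> x) \<le> C i" by metis
  have "cmod (dir_deriv d \<phi> x) \<le> (\<Sum>i\<in>UNIV. \<bar>d $ i\<bar> * C i)" for x
    unfolding dir_deriv_def
    by (rule sum_norm_le) (simp add: norm_mult mult_left_mono C)
  then show ?thesis by (rule that)
qed

lemma dir_deriv_translate:
  assumes "\<phi> \<in> test_functions U"
  shows "dir_deriv d (\<lambda>x. \<phi> (x - a)) x = dir_deriv d \<phi> (x - a)"
  unfolding dir_deriv_def partial_deriv_def
    frechet_derivative_at[OF frechet_derivative_translate[OF test_differentiable[OF assms]], symmetric] ..

text \<open>Fundamental theorem of calculus for -(1 - t/s) phi(y - t d): the weight is 1 at t = 0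
  and 0 at t = s, so only phi(y) survives. The segment runs backwards because the identity is going
  to be transposed onto u.\<close>

lemma test_ray_integral:
  assumes \<phi>: "\<phi> \<in> test_functions U" and s: "0 < s"
  shows "(LINT t|lborel. indicator {0..s} t *\<^sub>R
      (complex_of_real (1 / s) * \<phi> (y - t *\<^sub>R d) + complex_of_real (1 - t / s) * dir_deriv d \<phi> (y - t *\<^sub>R d))) = \<phi> y"
proof -
  let ?f = "\<lambda>t. complex_of_real (1 / s) * \<phi> (y - t *\<^sub>R d) + complex_of_real (1 - t / s) * dir_deriv d \<phi> (y - t *\<^sub>R d)"
  let ?F = "\<lambda>t. - (complex_of_real (1 - t / s) * \<phi> (y - t *\<^sub>R d))"
  have c: "continuous_on UNIV (\<lambda>t. y - t *\<^sub>R d)" by (intro continuous_intros)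
  have "(LINT t|lborel. indicator {0..s} t *\<^sub>R ?f t) = ?F s - ?F 0"
  proof (rule integral_FTC_atLeastAtMost)
    show "continuous_on {0..s} ?f"
      by (intro continuous_intros continuous_on_compose2[OF test_functions_continuous[OF \<phi>]]
          continuous_on_compose2[OF dir_deriv_continuous[OF \<phi>]]) (use s in auto)
    fix t :: real
    have "((\<lambda>t. \<phi> (y - t *\<^sub>R d)) has_derivative (\<lambda>h. frechet_derivative \<phi> (at (y - t *\<^sub>R d)) (- (h *\<^sub>R d)))) (at t)"
    proof (rule has_derivative_compose[of "\<lambda>t. y - t *\<^sub>R d" "\<lambda>h. - (h *\<^sub>R d)" t UNIV \<phi>])
      show "((\<lambda>t. y - t *\<^sub>R d) has_derivative (\<lambda>h. - (h *\<^sub>R d))) (at t)"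
        by (auto intro!: derivative_eq_intros)
      show "(\<phi> has_derivative frechet_derivative \<phi> (at (y - t *\<^sub>R d))) (at (y - t *\<^sub>R d))"
        using test_differentiable[OF \<phi>] frechet_derivative_works by blast
    qed
    moreover have "frechet_derivative \<phi> (at (y - t *\<^sub>R d)) (- (h *\<^sub>R d)) = h *\<^sub>R (- dir_deriv d \<phi> (y - t *\<^sub>R d))" for h
    proof -
      have lin: "linear (frechet_derivative \<phi> (at (y - t *\<^sub>R d)))"
        using test_differentiable[OF \<phi>] frechet_derivative_works has_derivative_linear by blast
      show ?thesis
        by (subst linear_neg[OF lin], subst linear_scale[OF lin], subst dir_deriv_frechet[OF \<phi>]) simp
    qed
    ultimately have 1: "((\<lambda>t. \<phi> (y - t *\<^sub>R d)) has_vector_derivative - dir_deriv d \<phi> (y - t *\<^sub>R d)) (at t)"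
      by (simp add: has_vector_derivative_def)
    have 2: "((\<lambda>t. complex_of_real (1 - t / s)) has_vector_derivative complex_of_real (- (1 / s))) (at t)"
      using s by (intro has_vector_derivative_of_real) (auto intro!: derivative_eq_intros)
    have "(?F has_vector_derivative - (complex_of_real (1 - t / s) * - dir_deriv d \<phi> (y - t *\<^sub>R d)
        + complex_of_real (- (1 / s)) * \<phi> (y - t *\<^sub>R d))) (at t)"
      by (rule has_vector_derivative_minus[OF has_vector_derivative_mult[OF 2 1]])
    then have "(?F has_vector_derivative ?f t) (at t)" by (simp add: algebra_simps)
    then show "(?F has_vector_derivative ?f t) (at t within {0..s})"
      by (rule has_vector_derivative_at_within)
  qed (use s in simp)
  then show ?thesis using s by simp
qed

lemma integrable_mult_bounded:
  fixes f g :: "'a \<Rightarrow> complex"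
  assumes f: "integrable M f" and g: "g \<in> borel_measurable M" and C: "\<And>x. cmod (g x) \<le> C"
  shows "integrable M (\<lambda>x. f x * g x)"
proof (rule Bochner_Integration.integrable_bound)
  show "integrable M (\<lambda>x. C * cmod (f x))" using f by simp
  show "(\<lambda>x. f x * g x) \<in> borel_measurable M"
    by (intro borel_measurable_times borel_measurable_integrable[OF f] g)
  show "AE x in M. norm (f x * g x) \<le> norm (C * cmod (f x))"
  proof (intro AE_I2)
    fix x
    have "cmod (f x) * cmod (g x) \<le> cmod (f x) * C" by (intro mult_left_mono C norm_ge_zero)
    moreover have "0 \<le> C" by (rule order_trans[OF norm_ge_zero C])
    ultimately show "norm (f x * g x) \<le> norm (C * cmod (f x))" by (simp add: norm_mult mult.commute abs_mult)
  qed
qed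

lemma integral_translate:
  fixes f :: "'a::euclidean_space \<Rightarrow> 'b::{banach, second_countable_topology}"
  assumes [measurable]: "f \<in> borel_measurable borel"
  shows "(LINT x|lborel. f (c + x)) = (LINT x|lborel. f x)"
  by (subst lborel_distr_plus[of c, symmetric], subst integral_distr) auto

text \<open>Transpose of \<open>test_ray_integral\<close>. Pairing with u and exchanging integrals
  leaves, for each t, u tested with a translate of phi; the weak identity moves the derivative onto
  v, and a change of variable moves the shift onto u and v. The ray condition keeps translated test
  functions inside the domain, and the fundamental lemma on U removes phi.\<close>

lemma line_representation:
  fixes u v :: "real^2 \<Rightarrow> complex" and d :: "real^2"
  assumes U: "open U" and s: "0 < s"
    and u: "integrable lborel u" and v: "integrable lborel v"
    and ray: "\<And>x t. x \<in> U \<Longrightarrow> 0 \<le> t \<Longrightarrow> t \<le> s \<Longrightarrow> x + t *\<^sub>R d \<in> \<Omega>"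
    and weak: "\<And>\<psi>. \<psi> \<in> test_functions \<Omega> \<Longrightarrow>
      (LINT x|lborel. u x * dir_deriv d \<psi> x) = - (LINT x|lborel. v x * \<psi> x)"
  shows "AE x in lebesgue_on U. u x = (LINT t|lborel. indicator {0..s} t *\<^sub>R
    (complex_of_real (1 / s) * u (x + t *\<^sub>R d) - complex_of_real (1 - t / s) * v (x + t *\<^sub>R d)))"
proof -
  have [measurable]: "u \<in> borel_measurable borel" "v \<in> borel_measurable borel" using u v by auto
  define E where "E t x = complex_of_real (1 / s) * u x - complex_of_real (1 - t / s) * v x" for t x
  \<comment> \<open>Integrable majorant of \<open>E t\<close> that does not depend on t in [0, s];
    it justifies Fubini in the segment parameter.\<close>
  define w where "w x = 1 / s * cmod (u x) + cmod (v x)" for x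
  define R where "R x = (LINT t|lborel. indicator {0..s} t *\<^sub>R E t (x + t *\<^sub>R d))" for x
  have [measurable]: "(\<lambda>p. E (fst p) (snd p)) \<in> borel_measurable (borel \<Otimes>\<^sub>M borel)"
    unfolding E_def by measurable
  have Em: "(\<lambda>p. indicator {0..s} (snd p) *\<^sub>R E (snd p) (fst p + snd p *\<^sub>R d)) \<in> borel_measurable (borel \<Otimes>\<^sub>M borel)"
    unfolding E_def by measurable
  have w0: "0 \<le> w x" for x using s by (simp add: w_def)
  have [measurable]: "w \<in> borel_measurable borel" unfolding w_def[abs_def] by measurable
  have wint: "integrable lborel w" unfolding w_def[abs_def] using u v by simp
  have Ew: "cmod (E t x) \<le> w x" if "0 \<le> t" "t \<le> s" for t x
  proof -
    have "cmod (E t x) \<le> cmod (complex_of_real (1 / s) * u x) + cmod (complex_of_real (1 - t / s) * v x)"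
      unfolding E_def by (rule norm_triangle_ineq4)
    also have "\<dots> = 1 / s * cmod (u x) + (1 - t / s) * cmod (v x)"
      using s that by (simp add: norm_mult del: of_real_divide of_real_diff)
    also have "\<dots> \<le> w x"
      unfolding w_def using s that by (intro add_mono mult_left_le_one_le) auto
    finally show ?thesis .
  qed
  have total: "(\<integral>\<^sup>+t. \<integral>\<^sup>+x. ennreal (norm (indicator {0..s} t *\<^sub>R E t (x + t *\<^sub>R d))) \<partial>lborel \<partial>lborel) < \<infinity>"
  proof -
    have "(\<integral>\<^sup>+t. \<integral>\<^sup>+x. ennreal (norm (indicator {0..s} t *\<^sub>R E t (x + t *\<^sub>R d))) \<partial>lborel \<partial>lborel)
        \<le> (\<integral>\<^sup>+t. indicator {0..s} t * (\<integral>\<^sup>+x. ennreal (w x) \<partial>lborel) \<partial>lborel)"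
    proof (rule nn_integral_mono)
      fix t :: real
      have "(\<integral>\<^sup>+x. ennreal (norm (indicator {0..s} t *\<^sub>R E t (x + t *\<^sub>R d))) \<partial>lborel)
          \<le> (\<integral>\<^sup>+x. indicator {0..s} t * ennreal (w (t *\<^sub>R d + x)) \<partial>lborel)"
        using Ew by (intro nn_integral_mono) (auto split: split_indicator intro!: ennreal_leI simp: add.commute)
      also have "\<dots> = indicator {0..s} t * (\<integral>\<^sup>+x. ennreal (w (t *\<^sub>R d + x)) \<partial>lborel)"
        by (rule nn_integral_cmult) measurable
      also have "(\<integral>\<^sup>+x. ennreal (w (t *\<^sub>R d + x)) \<partial>lborel) = (\<integral>\<^sup>+x. ennreal (w x) \<partial>lborel)"
        by (rule nn_integral_translate[of "\<lambda>x. ennreal (w x)"]) measurable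
      finally show "(\<integral>\<^sup>+x. ennreal (norm (indicator {0..s} t *\<^sub>R E t (x + t *\<^sub>R d))) \<partial>lborel)
          \<le> indicator {0..s} t * (\<integral>\<^sup>+x. ennreal (w x) \<partial>lborel)" .
    qed
    also have "\<dots> = ennreal s * (\<integral>\<^sup>+x. ennreal (w x) \<partial>lborel)"
      using s by (subst nn_integral_multc) auto
    also have "\<dots> < \<infinity>"
      using nn_integral_eq_integral[OF wint] w0 by (simp add: ennreal_mult_less_top)
    finally show ?thesis .
  qed
  have Eint: "integrable (lborel \<Otimes>\<^sub>M lborel) (\<lambda>p. indicator {0..s} (snd p) *\<^sub>R E (snd p) (fst p + snd p *\<^sub>R d))"
  proof (rule integrableI_bounded)
    show "(\<lambda>p. indicator {0..s} (snd p) *\<^sub>R E (snd p) (fst p + snd p *\<^sub>R d)) \<in> borel_measurable (lborel \<Otimes>\<^sub>M lborel)"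
      using Em by simp
    then have "(\<lambda>p. ennreal (norm (indicator {0..s} (snd p) *\<^sub>R E (snd p) (fst p + snd p *\<^sub>R d)))) \<in> borel_measurable (lborel \<Otimes>\<^sub>M lborel)"
      by measurable
    from lborel_pair.nn_integral_snd[OF this] total
    show "(\<integral>\<^sup>+p. ennreal (norm (indicator {0..s} (snd p) *\<^sub>R E (snd p) (fst p + snd p *\<^sub>R d))) \<partial>(lborel \<Otimes>\<^sub>M lborel)) < \<infinity>"
      by simp
  qed
  have Rint: "integrable lborel R"
    using lborel_pair.integrable_fst[of "\<lambda>x t. indicator {0..s} t *\<^sub>R E t (x + t *\<^sub>R d)"] Eint
    unfolding R_def by (simp add: case_prod_beta')
  have main: "(LINT x|lborel. u x * \<phi> x) = (LINT x|lborel. R x * \<phi> x)" if \<phi>: "\<phi> \<in> test_functions U" for \<phi>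
  proof -
    have [measurable]: "\<phi> \<in> borel_measurable borel" by (rule test_functions_measurable[OF \<phi>])
    have [measurable]: "dir_deriv d \<phi> \<in> borel_measurable borel"
      by (rule borel_measurable_continuous_onI[OF dir_deriv_continuous[OF \<phi>]])
    obtain C1 where C1: "\<And>x. cmod (\<phi> x) \<le> C1" using test_functions_bounded[OF \<phi>] by blast
    obtain C2 where C2: "\<And>x. cmod (dir_deriv d \<phi> x) \<le> C2" using dir_deriv_bounded[OF \<phi>] by blast
    have C0: "0 \<le> C1" "0 \<le> C2" using order_trans[OF norm_ge_zero C1] order_trans[OF norm_ge_zero C2] by auto
    \<comment> \<open>The kernel of \<open>test_ray_integral\<close>: its integral over t in [0, s]
      returns phi(y).\<close>
    define K where "K t y = complex_of_real (1 / s) * \<phi> (y - t *\<^sub>R d) + complex_of_real (1 - t / s) * dir_deriv d \<phi> (y - t *\<^sub>R d)" for t y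
    have KC: "cmod (K t y) \<le> 1 / s * C1 + C2" if "0 \<le> t" "t \<le> s" for t y
    proof -
      have "cmod (K t y) \<le> cmod (complex_of_real (1 / s) * \<phi> (y - t *\<^sub>R d)) + cmod (complex_of_real (1 - t / s) * dir_deriv d \<phi> (y - t *\<^sub>R d))"
        unfolding K_def by (rule norm_triangle_ineq)
      also have "\<dots> = 1 / s * cmod (\<phi> (y - t *\<^sub>R d)) + (1 - t / s) * cmod (dir_deriv d \<phi> (y - t *\<^sub>R d))"
        using s that by (simp add: norm_mult del: of_real_divide of_real_diff)
      also have "\<dots> \<le> 1 / s * C1 + 1 * C2"
        using s that C0 C1 C2 by (intro add_mono mult_mono mult_left_mono) auto
      finally show ?thesis by simp
    qed
    have Kint: "integrable (lborel \<Otimes>\<^sub>M lborel) (\<lambda>p. u (fst p) * (indicator {0..s} (snd p) *\<^sub>R K (snd p) (fst p)))"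
    proof (rule integrableI_bounded)
      show m: "(\<lambda>p. u (fst p) * (indicator {0..s} (snd p) *\<^sub>R K (snd p) (fst p))) \<in> borel_measurable (lborel \<Otimes>\<^sub>M lborel)"
        unfolding K_def by measurable
      let ?B = "1 / s * C1 + C2"
      from m have "(\<lambda>p. ennreal (norm (u (fst p) * (indicator {0..s} (snd p) *\<^sub>R K (snd p) (fst p))))) \<in> borel_measurable (lborel \<Otimes>\<^sub>M lborel)"
        by measurable
      from lborel.nn_integral_fst[OF this]
      have "(\<integral>\<^sup>+p. ennreal (norm (u (fst p) * (indicator {0..s} (snd p) *\<^sub>R K (snd p) (fst p)))) \<partial>(lborel \<Otimes>\<^sub>M lborel))
          = (\<integral>\<^sup>+x. \<integral>\<^sup>+t. ennreal (norm (u x * (indicator {0..s} t *\<^sub>R K t x))) \<partial>lborel \<partial>lborel)"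
        by simp
      also have "\<dots> \<le> (\<integral>\<^sup>+x. \<integral>\<^sup>+t. ennreal (cmod (u x) * ?B) * indicator {0..s} t \<partial>lborel \<partial>lborel)"
        using KC by (intro nn_integral_mono) (auto split: split_indicator intro!: ennreal_leI mult_left_mono simp: norm_mult)
      also have "\<dots> = (\<integral>\<^sup>+x. ennreal (cmod (u x) * ?B) * ennreal s \<partial>lborel)"
        using s by (intro nn_integral_cong) (subst nn_integral_cmult, auto)
      also have "\<dots> = (\<integral>\<^sup>+x. ennreal (cmod (u x) * ?B) \<partial>lborel) * ennreal s"
        by (rule nn_integral_multc) measurable
      also have "(\<integral>\<^sup>+x. ennreal (cmod (u x) * ?B) \<partial>lborel) = ennreal (LINT x|lborel. cmod (u x) * ?B)"
        using u s C0 by (intro nn_integral_eq_integral) auto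
      also have "\<dots> * ennreal s < \<infinity>" by (simp add: ennreal_mult_less_top)
      finally show "(\<integral>\<^sup>+p. ennreal (norm (u (fst p) * (indicator {0..s} (snd p) *\<^sub>R K (snd p) (fst p)))) \<partial>(lborel \<Otimes>\<^sub>M lborel)) < \<infinity>" .
    qed
    have EPint: "integrable (lborel \<Otimes>\<^sub>M lborel) (\<lambda>p. (indicator {0..s} (snd p) *\<^sub>R E (snd p) (fst p + snd p *\<^sub>R d)) * \<phi> (fst p))"
    proof (rule Bochner_Integration.integrable_bound)
      show "integrable (lborel \<Otimes>\<^sub>M lborel) (\<lambda>p. C1 * norm (indicator {0..s} (snd p) *\<^sub>R E (snd p) (fst p + snd p *\<^sub>R d)))"
        by (intro integrable_mult_right integrable_norm Eint)
      show "(\<lambda>p. (indicator {0..s} (snd p) *\<^sub>R E (snd p) (fst p + snd p *\<^sub>R d)) * \<phi> (fst p)) \<in> borel_measurable (lborel \<Otimes>\<^sub>M lborel)"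
        using Em by measurable
      show "AE p in lborel \<Otimes>\<^sub>M lborel. norm ((indicator {0..s} (snd p) *\<^sub>R E (snd p) (fst p + snd p *\<^sub>R d)) * \<phi> (fst p))
          \<le> norm (C1 * norm (indicator {0..s} (snd p) *\<^sub>R E (snd p) (fst p + snd p *\<^sub>R d)))"
      proof (intro AE_I2)
        fix p
        show "norm ((indicator {0..s} (snd p) *\<^sub>R E (snd p) (fst p + snd p *\<^sub>R d)) * \<phi> (fst p))
          \<le> norm (C1 * norm (indicator {0..s} (snd p) *\<^sub>R E (snd p) (fst p + snd p *\<^sub>R d)))"
          using mult_left_mono[OF C1[of "fst p"] norm_ge_zero[of "indicator {0..s} (snd p) *\<^sub>R E (snd p) (fst p + snd p *\<^sub>R d)"]] C0
          by (simp add: norm_mult abs_mult mult_ac)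
      qed
    qed
    \<comment> \<open>The weak derivative enters here, tested with the translate
      \<open>\<psi>\<close> of phi.\<close>
    have slice: "(LINT y|lborel. u y * K t y) = (LINT x|lborel. E t (x + t *\<^sub>R d) * \<phi> x)" if t: "0 \<le> t" "t \<le> s" for t
    proof -
      define \<psi> where "\<psi> = (\<lambda>y. \<phi> (y - t *\<^sub>R d))"
      have \<psi>: "\<psi> \<in> test_functions \<Omega>"
        unfolding \<psi>_def by (rule test_functions_translate[OF \<phi> ray[OF _ t]])
      have [measurable]: "\<psi> \<in> borel_measurable borel" "dir_deriv d \<psi> \<in> borel_measurable borel"
        by (rule test_functions_measurable[OF \<psi>], rule borel_measurable_continuous_onI[OF dir_deriv_continuous[OF \<psi>]])
      have dd: "dir_deriv d \<psi> y = dir_deriv d \<phi> (y - t *\<^sub>R d)" for y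
        unfolding \<psi>_def by (rule dir_deriv_translate[OF \<phi>])
      have iu: "integrable lborel (\<lambda>y. u y * \<psi> y)" by (rule integrable_mult_bounded[OF u, of _ C1]) (auto simp: \<psi>_def C1)
      have iv: "integrable lborel (\<lambda>y. v y * \<psi> y)" by (rule integrable_mult_bounded[OF v, of _ C1]) (auto simp: \<psi>_def C1)
      have id: "integrable lborel (\<lambda>y. u y * dir_deriv d \<psi> y)" by (rule integrable_mult_bounded[OF u, of _ C2]) (auto simp: dd C2)
      let ?a = "complex_of_real (1 / s)" and ?b = "complex_of_real (1 - t / s)"
      have "(LINT y|lborel. u y * K t y) = (LINT y|lborel. ?a * (u y * \<psi> y) + ?b * (u y * dir_deriv d \<psi> y))"
        unfolding K_def dd by (intro Bochner_Integration.integral_cong) (auto simp: \<psi>_def algebra_simps)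
      also have "\<dots> = ?a * (LINT y|lborel. u y * \<psi> y) + ?b * (LINT y|lborel. u y * dir_deriv d \<psi> y)"
        using iu id by (subst Bochner_Integration.integral_add) auto
      also have "\<dots> = ?a * (LINT y|lborel. u y * \<psi> y) - ?b * (LINT y|lborel. v y * \<psi> y)"
        unfolding weak[OF \<psi>] by simp
      also have "\<dots> = (LINT y|lborel. ?a * (u y * \<psi> y) - ?b * (v y * \<psi> y))"
        using iu iv by (subst Bochner_Integration.integral_diff) auto
      also have "\<dots> = (LINT y|lborel. E t y * \<psi> y)"
        unfolding E_def by (intro Bochner_Integration.integral_cong) (auto simp: algebra_simps)
      also have "\<dots> = (LINT x|lborel. E t (t *\<^sub>R d + x) * \<psi> (t *\<^sub>R d + x))"
        by (rule integral_translate[symmetric]) (unfold E_def, measurable)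
      also have "\<dots> = (LINT x|lborel. E t (x + t *\<^sub>R d) * \<phi> x)"
        by (simp add: \<psi>_def add.commute)
      finally show ?thesis .
    qed
    have "u x * \<phi> x = (LINT t|lborel. u x * (indicator {0..s} t *\<^sub>R K t x))" for x
      using test_ray_integral[OF \<phi> s, of x d] unfolding K_def by (simp only: integral_mult_right_zero)
    then have "(LINT x|lborel. u x * \<phi> x) = (LINT x|lborel. LINT t|lborel. u x * (indicator {0..s} t *\<^sub>R K t x))"
      by simp
    also have "\<dots> = (LINT t|lborel. LINT x|lborel. u x * (indicator {0..s} t *\<^sub>R K t x))"
      by (rule lborel_pair.Fubini_integral[symmetric]) (use Kint in \<open>simp add: case_prod_beta'\<close>)
    also have "\<dots> = (LINT t|lborel. LINT x|lborel. (indicator {0..s} t *\<^sub>R E t (x + t *\<^sub>R d)) * \<phi> x)"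
    proof (rule Bochner_Integration.integral_cong[OF refl])
      fix t :: real
      show "(LINT x|lborel. u x * (indicator {0..s} t *\<^sub>R K t x)) = (LINT x|lborel. (indicator {0..s} t *\<^sub>R E t (x + t *\<^sub>R d)) * \<phi> x)"
        using slice[of t] by (cases "t \<in> {0..s}") auto
    qed
    also have "\<dots> = (LINT x|lborel. LINT t|lborel. (indicator {0..s} t *\<^sub>R E t (x + t *\<^sub>R d)) * \<phi> x)"
      by (rule lborel_pair.Fubini_integral) (use EPint in \<open>simp add: case_prod_beta'\<close>)
    also have "\<dots> = (LINT x|lborel. R x * \<phi> x)"
      unfolding R_def by (rule Bochner_Integration.integral_cong[OF refl]) (rule integral_mult_left_zero)
    finally show ?thesis .
  qed
  have Us: "U \<in> sets lebesgue" using U by simp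
  have uR: "integrable lborel (\<lambda>x. u x - R x)" using u Rint by simp
  have [measurable]: "(\<lambda>x. u x - R x) \<in> borel_measurable borel" using uR by auto
  have "AE x in lebesgue_on U. u x - R x = 0"
  proof (rule fundamental_lemma[OF U])
    have "integrable lebesgue (\<lambda>x. u x - R x)" using uR by (simp add: integrable_completion)
    then show "integrable (lebesgue_on U) (\<lambda>x. u x - R x)"
      using integrable_mult_indicator[of U lebesgue "\<lambda>x. u x - R x"] Us
      by (subst integrable_restrict_space) auto
    fix \<phi> assume \<phi>: "\<phi> \<in> test_functions U"
    have [measurable]: "\<phi> \<in> borel_measurable borel" by (rule test_functions_measurable[OF \<phi>])
    obtain C where C: "\<And>x. cmod (\<phi> x) \<le> C" using test_functions_bounded[OF \<phi>] by blast
    have \<phi>0: "\<phi> x = 0" if "x \<notin> U" for x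
      using \<phi> that closure_subset[of "{x. \<phi> x \<noteq> 0}"] unfolding test_functions_def by blast
    have i: "integrable lborel (\<lambda>x. f x * \<phi> x)" if f: "integrable lborel f" for f :: "real^2 \<Rightarrow> complex"
      by (rule integrable_mult_bounded[OF f _ C]) simp
    have "(LINT x|lebesgue_on U. (u x - R x) * \<phi> x) = (LINT x|lebesgue. (if x \<in> U then (u x - R x) * \<phi> x else 0))"
      by (rule Lebesgue_Measure.integral_restrict_UNIV[symmetric, OF Us])
    also have "\<dots> = (LINT x|lebesgue. (u x - R x) * \<phi> x)"
      by (intro Bochner_Integration.integral_cong) (auto simp: \<phi>0)
    also have "\<dots> = (LINT x|lborel. (u x - R x) * \<phi> x)"
      by (rule integral_completion) measurable
    also have "\<dots> = (LINT x|lborel. u x * \<phi> x) - (LINT x|lborel. R x * \<phi> x)"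
      unfolding left_diff_distrib by (intro Bochner_Integration.integral_diff i u Rint)
    also have "\<dots> = 0" using main[OF \<phi>] by simp
    finally show "(LINT x|lebesgue_on U. (u x - R x) * \<phi> x) = 0" .
  qed
  then show ?thesis unfolding R_def E_def by simp
qed

section \<open>The embedding of $H^1$ into $L^4$\<close>

lemma C1_local_lipschitz:
  fixes \<gamma> :: "real \<Rightarrow> real"
  assumes "\<gamma> C1_differentiable_on UNIV"
  obtains K where "0 \<le> K" "\<And>x y. x \<in> {a..b} \<Longrightarrow> y \<in> {a..b} \<Longrightarrow> \<bar>\<gamma> x - \<gamma> y\<bar> \<le> K * \<bar>x - y\<bar>"
proof -
  obtain D where D: "\<And>x. (\<gamma> has_vector_derivative D x) (at x)" "continuous_on UNIV D"
    using assms unfolding C1_differentiable_on_def by blast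
  have "compact (D ` {a..b})"
    by (intro compact_continuous_image continuous_on_subset[OF D(2)]) auto
  then have "\<exists>K. \<forall>x\<in>{a..b}. \<bar>D x\<bar> \<le> K"
    by (auto dest!: compact_imp_bounded simp: bounded_iff)
  then obtain K where K: "\<And>x. x \<in> {a..b} \<Longrightarrow> \<bar>D x\<bar> \<le> K" by blast
  have "norm (\<gamma> x - \<gamma> y) \<le> max K 0 * norm (x - y)" if "x \<in> {a..b}" "y \<in> {a..b}" for x y
  proof (rule field_differentiable_bound[of "{a..b}" \<gamma> D])
    show "(\<gamma> has_field_derivative D z) (at z within {a..b})" for z
      using D(1)[of z] has_field_derivative_at_within
      by (auto simp: has_real_derivative_iff_has_vector_derivative has_vector_derivative_at_within)
    show "norm (D z) \<le> max K 0" if "z \<in> {a..b}" for z using K[OF that] by simp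
  qed (use that in auto)
  then show ?thesis by (intro that[of "max K 0"]) auto
qed

lemma inner_real2: "(x::real^2) \<bullet> y = x $ 1 * y $ 1 + x $ 2 * y $ 2"
  by (simp add: inner_vec_def sum_2)

text \<open>Lagrange's identity: the squared determinant and the squared inner product add up to
  |d|^2 |e|^2 = 1.\<close>

lemma orthonormal_det:
  fixes d e :: "real^2"
  assumes "norm d = 1" "norm e = 1" "d \<bullet> e = 0"
  shows "d $ 1 * e $ 2 - d $ 2 * e $ 1 \<noteq> 0"
proof -
  have "d \<bullet> d = 1" "e \<bullet> e = 1" using assms by (simp_all add: norm_eq_1)
  then have "(d $ 1 * d $ 1 + d $ 2 * d $ 2) * (e $ 1 * e $ 1 + e $ 2 * e $ 2) = 1" by (simp add: inner_real2)
  moreover have "(d $ 1 * d $ 1 + d $ 2 * d $ 2) * (e $ 1 * e $ 1 + e $ 2 * e $ 2)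
      = (d $ 1 * e $ 2 - d $ 2 * e $ 1)\<^sup>2 + (d \<bullet> e)\<^sup>2"
    by (simp add: inner_real2 power2_eq_square algebra_simps)
  ultimately show ?thesis using assms(3) by auto
qed

definition ray_set :: "(real^2) set \<Rightarrow> (real^2) set \<Rightarrow> real \<Rightarrow> real^2 \<Rightarrow> bool" where
  "ray_set \<Omega> U s d \<longleftrightarrow> (\<forall>x\<in>U. \<forall>t\<in>{0..s}. x + t *\<^sub>R d \<in> \<Omega>)"

text \<open>Near a boundary point the domain lies above a Lipschitz graph, so it contains short segments in
  every direction that is steep enough; two such directions are linearly independent.\<close>

lemma C1_domain_rays:
  assumes \<Omega>: "C1_domain \<Omega>" and x0: "x0 \<in> closure \<Omega>"
  shows "\<exists>r>0. \<exists>s>0. \<exists>d e. d $ 1 * e $ 2 - d $ 2 * e $ 1 \<noteq> 0 \<and>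
    ray_set \<Omega> (\<Omega> \<inter> ball x0 r) s d \<and> ray_set \<Omega> (\<Omega> \<inter> ball x0 r) s e"
proof (cases "x0 \<in> \<Omega>")
  case True
  have "open \<Omega>" using \<Omega> by (simp add: C1_domain_def)
  then obtain r where r: "0 < r" "ball x0 r \<subseteq> \<Omega>" using True by (meson openE)
  have ray: "ray_set \<Omega> (\<Omega> \<inter> ball x0 (r/2)) (r/2) (axis i 1)" for i
    unfolding ray_set_def
  proof (intro ballI)
    fix x t assume x: "x \<in> \<Omega> \<inter> ball x0 (r/2)" and t: "t \<in> {0..r/2}"
    have "norm (t *\<^sub>R axis i 1 :: real^2) \<le> r/2" using t by simp
    moreover have "norm (x - x0) < r/2" using x by (simp add: dist_norm norm_minus_commute)
    ultimately have "norm ((x - x0) + t *\<^sub>R axis i 1) < r"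
      using norm_triangle_ineq[of "x - x0" "t *\<^sub>R axis i 1"] by linarith
    then have "x + t *\<^sub>R axis i 1 \<in> ball x0 r"
      by (simp add: dist_norm norm_minus_commute[of x0] algebra_simps)
    with r show "x + t *\<^sub>R axis i 1 \<in> \<Omega>" by blast
  qed
  have "(axis 1 1 :: real^2) $ 1 * (axis 2 1 :: real^2) $ 2 - (axis 1 1 :: real^2) $ 2 * (axis 2 1 :: real^2) $ 1 \<noteq> 0"
    by (simp add: axis_def)
  then show ?thesis using ray r by (meson half_gt_zero)
next
  case False
  then have "x0 \<in> frontier \<Omega>" using x0 \<Omega> by (simp add: C1_domain_def frontier_def interior_open)
  then obtain r e1 e2 \<gamma> where r: "0 < r" and e: "norm e1 = 1" "norm e2 = 1" "e1 \<bullet> e2 = 0"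
    and \<gamma>: "\<gamma> C1_differentiable_on UNIV" and graph: "\<Omega> \<inter> ball x0 r = {x \<in> ball x0 r. \<gamma> (x \<bullet> e1) < x \<bullet> e2}"
    using \<Omega> unfolding C1_domain_def C1_boundary_def by blast
  obtain K where K: "0 \<le> K"
    "\<And>x y. x \<in> {x0 \<bullet> e1 - r..x0 \<bullet> e1 + r} \<Longrightarrow> y \<in> {x0 \<bullet> e1 - r..x0 \<bullet> e1 + r} \<Longrightarrow> \<bar>\<gamma> x - \<gamma> y\<bar> \<le> K * \<bar>x - y\<bar>"
    using C1_local_lipschitz[OF \<gamma>, of "x0 \<bullet> e1 - r" "x0 \<bullet> e1 + r"] by blast
  \<comment> \<open>Small enough that along e2 + \<sigma> e1 with |\<sigma>| = \<epsilon> the graph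
    rises by at most K \<epsilon> t \<le> t, while the point gains height t. Adding 1 keeps the
    denominator positive for K = 0.\<close>
  define \<epsilon> where "\<epsilon> = 1 / (K + 1)"
  have \<epsilon>: "0 < \<epsilon>" "\<epsilon> \<le> 1" "K * \<epsilon> < 1" using K(1) by (auto simp: \<epsilon>_def field_simps)
  have strip: "x \<bullet> e1 \<in> {x0 \<bullet> e1 - r..x0 \<bullet> e1 + r}" if "x \<in> ball x0 r" for x
  proof -
    have "\<bar>(x - x0) \<bullet> e1\<bar> \<le> norm (x - x0) * norm e1" by (rule Cauchy_Schwarz_ineq2)
    also have "\<dots> < r" using that e by (simp add: dist_norm norm_minus_commute)
    finally show ?thesis by (simp add: inner_diff_left abs_less_iff)
  qed
  \<comment> \<open>The direction has norm at most 2, so for t up to r/4 a point of the half ball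
    moves by at most r/2 and stays in the ball where the graph description holds.\<close>
  have ray: "ray_set \<Omega> (\<Omega> \<inter> ball x0 (r/2)) (r/4) (e2 + \<sigma> *\<^sub>R e1)" if \<sigma>: "\<bar>\<sigma>\<bar> = \<epsilon>" for \<sigma>
    unfolding ray_set_def
  proof (intro ballI)
    fix x t assume x: "x \<in> \<Omega> \<inter> ball x0 (r/2)" and t: "t \<in> {0..r/4}"
    let ?y = "x + t *\<^sub>R (e2 + \<sigma> *\<^sub>R e1)"
    have "norm (e2 + \<sigma> *\<^sub>R e1) \<le> 2" using norm_triangle_ineq[of e2 "\<sigma> *\<^sub>R e1"] e \<sigma> \<epsilon> by simp
    then have "t * norm (e2 + \<sigma> *\<^sub>R e1) \<le> r/4 * 2" using t by (intro mult_mono) auto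
    then have "norm (t *\<^sub>R (e2 + \<sigma> *\<^sub>R e1)) \<le> r/2" using t by simp
    moreover have "norm (x - x0) < r/2" using x by (simp add: dist_norm norm_minus_commute)
    ultimately have "norm ((x - x0) + t *\<^sub>R (e2 + \<sigma> *\<^sub>R e1)) < r"
      using norm_triangle_ineq[of "x - x0" "t *\<^sub>R (e2 + \<sigma> *\<^sub>R e1)"] by linarith
    moreover have "(x - x0) + t *\<^sub>R (e2 + \<sigma> *\<^sub>R e1) = ?y - x0" by simp
    ultimately have y: "?y \<in> ball x0 r" by (simp only: mem_ball dist_norm norm_minus_commute[of x0])
    have xr: "x \<in> ball x0 r" using x r by auto
    then have "x \<in> {x \<in> ball x0 r. \<gamma> (x \<bullet> e1) < x \<bullet> e2}" using x graph by blast
    then have g: "\<gamma> (x \<bullet> e1) < x \<bullet> e2" by simp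
    have "e1 \<bullet> e1 = 1" "e2 \<bullet> e2 = 1" "e2 \<bullet> e1 = 0" using e by (simp_all add: norm_eq_1 inner_commute)
    then have c: "?y \<bullet> e1 = x \<bullet> e1 + t * \<sigma>" "?y \<bullet> e2 = x \<bullet> e2 + t"
      using e(3) by (simp_all add: inner_add_left)
    have "\<gamma> (?y \<bullet> e1) - \<gamma> (x \<bullet> e1) \<le> K * \<bar>?y \<bullet> e1 - x \<bullet> e1\<bar>"
      using K(2)[OF strip[OF y] strip[OF xr]] by linarith
    also have "\<bar>?y \<bullet> e1 - x \<bullet> e1\<bar> = t * \<epsilon>" using c t \<sigma> by (simp add: abs_mult)
    also have "K * (t * \<epsilon>) = t * (K * \<epsilon>)" by simp
    also have "\<dots> \<le> t * 1" using t \<epsilon> by (intro mult_left_mono) auto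
    finally have "\<gamma> (?y \<bullet> e1) < ?y \<bullet> e2" using g c by linarith
    with y have "?y \<in> {x \<in> ball x0 r. \<gamma> (x \<bullet> e1) < x \<bullet> e2}" by blast
    then show "?y \<in> \<Omega>" using graph by blast
  qed
  \<comment> \<open>Independence of the two steep directions: their determinant is 2 \<epsilon>
    times that of the orthonormal frame.\<close>
  have "(e2 + \<epsilon> *\<^sub>R e1) $ 1 * (e2 + (- \<epsilon>) *\<^sub>R e1) $ 2 - (e2 + \<epsilon> *\<^sub>R e1) $ 2 * (e2 + (- \<epsilon>) *\<^sub>R e1) $ 1
      = 2 * \<epsilon> * (e1 $ 1 * e2 $ 2 - e1 $ 2 * e2 $ 1)"
    by (simp add: algebra_simps)
  also have "\<dots> \<noteq> 0" using orthonormal_det[OF e] \<epsilon> by simp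
  finally show ?thesis
    using ray[of \<epsilon>] ray[of "- \<epsilon>"] \<epsilon> r
    by (intro exI[of _ "r/2"] exI[of _ "r/4"] exI[of _ "e2 + \<epsilon> *\<^sub>R e1"] exI[of _ "e2 + (- \<epsilon>) *\<^sub>R e1"] conjI) auto
qed

text \<open>Measurability on \<open>lebesgue_on U\<close> refers to the completed measure and need
  not survive composition with (x, t) -> x + t d on the product space. A Borel representative does,
  and extension by 0 turns integrals over U into integrals over the plane.\<close>

lemma borel_representative:
  fixes v :: "'a::euclidean_space \<Rightarrow> complex"
  assumes U: "open U" and v: "v \<in> borel_measurable (lebesgue_on U)"
  shows "\<exists>g\<in>borel_measurable borel. (\<forall>x. x \<notin> U \<longrightarrow> g x = 0) \<and> (AE x in lebesgue_on U. v x = g x)"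
proof -
  have Us: "U \<in> sets lebesgue" using U by simp
  have [measurable]: "U \<in> sets borel" using U by simp
  define V where "V x = (if x \<in> U then v x else 0)" for x
  have "V \<in> borel_measurable lebesgue" unfolding V_def[abs_def] using v Us by (simp add: borel_measurable_if)
  then have "(\<lambda>x. Re (V x)) \<in> borel_measurable lebesgue" "(\<lambda>x. Im (V x)) \<in> borel_measurable lebesgue"
    by (auto intro: measurable_compose[OF _ borel_measurable_Re] measurable_compose[OF _ borel_measurable_Im])
  then obtain a b where [measurable]: "a \<in> borel_measurable lborel" "b \<in> borel_measurable lborel"
    and ae: "AE x in lborel. Re (V x) = a x" "AE x in lborel. Im (V x) = b x"
    using completion_ex_borel_measurable_real[of "\<lambda>x. Re (V x)" lborel]
      completion_ex_borel_measurable_real[of "\<lambda>x. Im (V x)" lborel] by blast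
  define g where "g x = (indicator U x :: complex) * (complex_of_real (a x) + \<i> * complex_of_real (b x))" for x
  have "g \<in> borel_measurable borel" unfolding g_def[abs_def] by measurable
  moreover have "\<forall>x. x \<notin> U \<longrightarrow> g x = 0" by (simp add: g_def)
  moreover have "AE x in lebesgue. x \<in> U \<longrightarrow> v x = g x"
    using AE_completion[OF ae(1)] AE_completion[OF ae(2)]
    by eventually_elim (auto simp: V_def g_def complex_eq_iff)
  then have "AE x in lebesgue_on U. v x = g x" using Us by (simp add: AE_restrict_space_iff)
  ultimately show ?thesis by blast
qed

section \<open>Integrals over an open set and over the whole space\<close>

lemma integral_lebesgue_on_borel:
  fixes f :: "'a::euclidean_space \<Rightarrow> complex"
  assumes U: "open U" and f: "f \<in> borel_measurable borel" and zero: "\<And>x. x \<notin> U \<Longrightarrow> f x = 0"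
  shows "(LINT x|lebesgue_on U. f x) = (LINT x|lborel. f x)"
    and "integrable (lebesgue_on U) f \<longleftrightarrow> integrable lborel f"
proof -
  have Us: "U \<in> sets lebesgue" using U by simp
  have eq: "(\<lambda>x. if x \<in> U then f x else 0) = f" using zero by auto
  show "(LINT x|lebesgue_on U. f x) = (LINT x|lborel. f x)"
    using Lebesgue_Measure.integral_restrict_UNIV[OF Us, of f] f by (simp add: eq integral_completion)
  show "integrable (lebesgue_on U) f \<longleftrightarrow> integrable lborel f"
    using Lebesgue_Measure.integrable_restrict_UNIV[OF Us, of f] f by (simp add: eq integrable_completion)
qed

lemma nn_integral_lebesgue_on_le:
  fixes f :: "'a::euclidean_space \<Rightarrow> ennreal"
  assumes U: "open U"
  shows "(\<integral>\<^sup>+x. f x \<partial>lebesgue_on U) \<le> (\<integral>\<^sup>+x. f x \<partial>lborel)"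
proof -
  have "(\<integral>\<^sup>+x. f x \<partial>lebesgue_on U) = (\<integral>\<^sup>+x. f x * indicator U x \<partial>lebesgue)"
    using U by (subst nn_integral_restrict_space) auto
  also have "\<dots> \<le> (\<integral>\<^sup>+x. f x \<partial>lebesgue)"
    by (intro nn_integral_mono) (auto split: split_indicator)
  finally show ?thesis by (simp add: nn_integral_completion)
qed

lemma nn_integral_lebesgue_on_eq:
  fixes f :: "'a::euclidean_space \<Rightarrow> ennreal"
  assumes U: "open U" and zero: "\<And>x. x \<notin> U \<Longrightarrow> f x = 0"
  shows "(\<integral>\<^sup>+x. f x \<partial>lebesgue_on U) = (\<integral>\<^sup>+x. f x \<partial>lborel)"
proof -
  have "(\<integral>\<^sup>+x. f x \<partial>lebesgue_on U) = (\<integral>\<^sup>+x. f x * indicator U x \<partial>lebesgue)"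
    using U by (subst nn_integral_restrict_space) auto
  also have "\<dots> = (\<integral>\<^sup>+x. f x \<partial>lebesgue)"
    using zero by (intro nn_integral_cong) (auto split: split_indicator)
  finally show ?thesis by (simp add: nn_integral_completion)
qed

text \<open>If f is not integrable, the left side is 0 by convention.\<close>

lemma norm_integral_le_nn_integral:
  fixes f :: "'a \<Rightarrow> 'b::{banach, second_countable_topology}"
  shows "ennreal (norm (LINT x|M. f x)) \<le> (\<integral>\<^sup>+x. ennreal (norm (f x)) \<partial>M)"
  by (cases "integrable M f") (auto intro: integral_norm_bound_ennreal simp: not_integrable_integral_eq)

lemma AE_lebesgue_on_subset:
  assumes "U \<subseteq> V" "open U" "open V" "AE x in lebesgue_on V. P x"
  shows "AE x in lebesgue_on U. P x"
  using assms by (simp add: AE_restrict_space_iff) (auto elim: eventually_mono)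

context bounded_open
begin

text \<open>Cauchy-Schwarz in t on the segment formula. One function \<open>W\<close> serves all
  base points x, and its integral runs over the full line: this is the form in which two directions
  can be multiplied and integrated.\<close>

lemma square_bound_on_rays:
  assumes U: "open U" "U \<subseteq> \<Omega>" and s: "0 < s" and ray: "ray_set \<Omega> U s d" and u: "u \<in> H1 \<Omega>"
  shows "\<exists>W\<in>borel_measurable borel.
    (AE x in lebesgue_on U. ennreal ((cmod (u x))\<^sup>2) \<le> ennreal s * (\<integral>\<^sup>+t. W (x + t *\<^sub>R d) \<partial>lborel)) \<and>
    (\<integral>\<^sup>+x. W x \<partial>lborel) \<le> ennreal ((2 / s\<^sup>2 + 4 * (d $ 1)\<^sup>2 + 4 * (d $ 2)\<^sup>2) * (norm_H1 \<Omega> u)\<^sup>2)"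
proof -
  obtain g where g[measurable]: "g \<in> borel_measurable borel" and g0: "\<And>x. x \<notin> \<Omega> \<Longrightarrow> g x = 0"
    and gu: "AE x in L. u x = g x"
    using borel_representative[OF open_\<Omega> L2_measurable[OF H1_L2[OF u]]] by blast
  have "\<forall>i. \<exists>h. h \<in> borel_measurable borel \<and> (\<forall>x. x \<notin> \<Omega> \<longrightarrow> h x = 0) \<and> (AE x in L. D i u x = h x)"
    using borel_representative[OF open_\<Omega> L2_measurable[OF D_L2[OF u]]] by blast
  from choice[OF this] obtain h where h[measurable]: "\<And>i. h i \<in> borel_measurable borel"
    and h0: "\<And>i x. x \<notin> \<Omega> \<Longrightarrow> h i x = 0" and hu: "\<And>i. AE x in L. D i u x = h i x" by blast
  have gL: "g \<in> L2 L" by (rule L2_cong_AE[OF H1_L2[OF u] _ gu]) (rule borel_measurable_lebesgue_on[OF g])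
  have hL: "h i \<in> L2 L" for i by (rule L2_cong_AE[OF D_L2[OF u] _ hu]) (rule borel_measurable_lebesgue_on[OF h])
  define v where "v x = (\<Sum>i\<in>UNIV. complex_of_real (d $ i) * h i x)" for x
  have [measurable]: "v \<in> borel_measurable borel" unfolding v_def[abs_def] by measurable
  have v0: "v x = 0" if "x \<notin> \<Omega>" for x using that h0 by (simp add: v_def)
  have gi: "integrable lborel g"
    using L2_imp_integrable[OF finite_L gL] integral_lebesgue_on_borel(2)[OF open_\<Omega> g g0] by blast
  have hi: "integrable lborel (h i)" for i
    using L2_imp_integrable[OF finite_L hL] integral_lebesgue_on_borel(2)[OF open_\<Omega> h h0] by blast
  have vi: "integrable lborel v" unfolding v_def[abs_def] using hi by simp
  have weak: "(LINT x|lborel. g x * dir_deriv d \<psi> x) = - (LINT x|lborel. v x * \<psi> x)" if \<psi>: "\<psi> \<in> test_functions \<Omega>" for \<psi>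
  proof -
    have [measurable]: "\<psi> \<in> borel_measurable borel" "dir_deriv d \<psi> \<in> borel_measurable borel"
      by (rule test_functions_measurable[OF \<psi>], rule borel_measurable_continuous_onI[OF dir_deriv_continuous[OF \<psi>]])
    have wk: "(LINT x|L. g x * partial_deriv i \<psi> x) = - (LINT x|L. h i x * \<psi> x)" for i
    proof -
      have "(LINT x|L. g x * partial_deriv i \<psi> x) = (LINT x|L. u x * partial_deriv i \<psi> x)"
        using gu
        by (intro integral_cong_AE borel_measurable_times L2_measurable gL H1_L2 u partial_L2 \<psi>)
          (auto elim: eventually_mono)
      also have "\<dots> = - (LINT x|L. D i u x * \<psi> x)"
        using D_is_weak_deriv[OF u] \<psi> unfolding is_weak_deriv_def by blast
      also have "(LINT x|L. D i u x * \<psi> x) = (LINT x|L. h i x * \<psi> x)"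
        using hu[of i]
        by (intro integral_cong_AE borel_measurable_times L2_measurable hL D_L2 u test_L2 \<psi>)
          (auto elim: eventually_mono)
      finally show ?thesis .
    qed
    have "(LINT x|lborel. g x * dir_deriv d \<psi> x) = (LINT x|L. g x * dir_deriv d \<psi> x)"
      by (rule integral_lebesgue_on_borel(1)[OF open_\<Omega>, symmetric]) (auto simp: g0)
    also have "\<dots> = (LINT x|L. (\<Sum>i\<in>UNIV. complex_of_real (d $ i) * (g x * partial_deriv i \<psi> x)))"
      by (simp add: dir_deriv_def sum_distrib_left mult.left_commute)
    also have "\<dots> = (\<Sum>i\<in>UNIV. complex_of_real (d $ i) * (LINT x|L. g x * partial_deriv i \<psi> x))"
      by (subst Bochner_Integration.integral_sum)
        (auto intro!: integrable_mult_right L2_integrable_mult gL partial_L2 \<psi>)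
    also have "\<dots> = - (\<Sum>i\<in>UNIV. complex_of_real (d $ i) * (LINT x|L. h i x * \<psi> x))"
      by (simp add: wk sum_negf)
    also have "(\<Sum>i\<in>UNIV. complex_of_real (d $ i) * (LINT x|L. h i x * \<psi> x)) = (LINT x|L. (\<Sum>i\<in>UNIV. complex_of_real (d $ i) * (h i x * \<psi> x)))"
      by (subst Bochner_Integration.integral_sum)
        (auto intro!: integrable_mult_right L2_integrable_mult hL test_L2 \<psi>)
    also have "\<dots> = (LINT x|L. v x * \<psi> x)" by (simp add: v_def sum_distrib_right mult.assoc)
    also have "\<dots> = (LINT x|lborel. v x * \<psi> x)"
      by (rule integral_lebesgue_on_borel(1)[OF open_\<Omega>]) (auto simp: v0)
    finally show ?thesis .
  qed
  \<comment> \<open>Dominates the segment integrand for every t in [0, s], since 0 \<le> 1 - t/s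
    \<le> 1.\<close>
  define w where "w x = 1 / s * cmod (g x) + cmod (v x)" for x
  have w0: "0 \<le> w x" for x using s by (simp add: w_def)
  have [measurable]: "w \<in> borel_measurable borel" unfolding w_def[abs_def] by measurable
  define W where "W x = ennreal ((w x)\<^sup>2)" for x
  have W[measurable]: "W \<in> borel_measurable borel" unfolding W_def[abs_def] by measurable
  have rep: "AE x in lebesgue_on U. g x = (LINT t|lborel. indicator {0..s} t *\<^sub>R
    (complex_of_real (1 / s) * g (x + t *\<^sub>R d) - complex_of_real (1 - t / s) * v (x + t *\<^sub>R d)))"
    by (rule line_representation[OF U(1) s gi vi _ weak]) (use ray in \<open>auto simp: ray_set_def\<close>)
  have pw: "ennreal ((cmod (g x))\<^sup>2) \<le> ennreal s * (\<integral>\<^sup>+t. W (x + t *\<^sub>R d) \<partial>lborel)"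
    if x: "g x = (LINT t|lborel. indicator {0..s} t *\<^sub>R
    (complex_of_real (1 / s) * g (x + t *\<^sub>R d) - complex_of_real (1 - t / s) * v (x + t *\<^sub>R d)))" for x
  proof -
    have "ennreal (cmod (g x)) \<le> (\<integral>\<^sup>+t. ennreal (norm (indicator {0..s} t *\<^sub>R
      (complex_of_real (1 / s) * g (x + t *\<^sub>R d) - complex_of_real (1 - t / s) * v (x + t *\<^sub>R d)))) \<partial>lborel)"
      by (subst x) (rule norm_integral_le_nn_integral)
    also have "\<dots> \<le> (\<integral>\<^sup>+t. indicator {0..s} t * ennreal (w (x + t *\<^sub>R d)) \<partial>lborel)"
    proof (rule nn_integral_mono)
      fix t :: real
      have "cmod (complex_of_real (1 / s) * g (x + t *\<^sub>R d) - complex_of_real (1 - t / s) * v (x + t *\<^sub>R d)) \<le> w (x + t *\<^sub>R d)"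
        if t: "0 \<le> t" "t \<le> s"
      proof -
        have "cmod (complex_of_real (1 / s) * g (x + t *\<^sub>R d) - complex_of_real (1 - t / s) * v (x + t *\<^sub>R d))
          \<le> cmod (complex_of_real (1 / s) * g (x + t *\<^sub>R d)) + cmod (complex_of_real (1 - t / s) * v (x + t *\<^sub>R d))"
          by (rule norm_triangle_ineq4)
        also have "\<dots> = 1 / s * cmod (g (x + t *\<^sub>R d)) + (1 - t / s) * cmod (v (x + t *\<^sub>R d))"
          using s t by (simp add: norm_mult del: of_real_divide of_real_diff)
        also have "\<dots> \<le> w (x + t *\<^sub>R d)"
          unfolding w_def using s t by (intro add_mono mult_left_le_one_le) auto
        finally show ?thesis .
      qed
      then show "ennreal (norm (indicator {0..s} t *\<^sub>R
        (complex_of_real (1 / s) * g (x + t *\<^sub>R d) - complex_of_real (1 - t / s) * v (x + t *\<^sub>R d))))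
        \<le> indicator {0..s} t * ennreal (w (x + t *\<^sub>R d))"
        by (auto split: split_indicator intro!: ennreal_leI)
    qed
    finally have "(ennreal (cmod (g x)))\<^sup>2 \<le> (\<integral>\<^sup>+t. indicator {0..s} t * ennreal (w (x + t *\<^sub>R d)) \<partial>lborel)\<^sup>2"
      by (intro power_mono) auto
    \<comment> \<open>The indicator goes entirely into the first factor and yields the length s; the
      second factor is then an integral over the whole line.\<close>
    also have "\<dots> \<le> (\<integral>\<^sup>+t. (indicator {0..s} t)\<^sup>2 \<partial>lborel) * (\<integral>\<^sup>+t. (ennreal (w (x + t *\<^sub>R d)))\<^sup>2 \<partial>lborel)"
      by (rule Cauchy_Schwarz_nn_integral) measurable
    also have "(\<integral>\<^sup>+t. (indicator {0..s} t)\<^sup>2 \<partial>lborel) = (\<integral>\<^sup>+t. indicator {0..s} t \<partial>(lborel :: real measure))"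
      by (intro nn_integral_cong) (auto split: split_indicator)
    also have "\<dots> = ennreal s" using s by simp
    also have "(\<integral>\<^sup>+t. (ennreal (w (x + t *\<^sub>R d)))\<^sup>2 \<partial>lborel) = (\<integral>\<^sup>+t. W (x + t *\<^sub>R d) \<partial>lborel)"
      by (simp add: W_def ennreal_power w0)
    finally show ?thesis by (simp add: ennreal_power)
  qed
  have "AE x in lebesgue_on U. ennreal ((cmod (u x))\<^sup>2) \<le> ennreal s * (\<integral>\<^sup>+t. W (x + t *\<^sub>R d) \<partial>lborel)"
    using rep AE_lebesgue_on_subset[OF U(2,1) open_\<Omega> gu]
  proof eventually_elim
    case (elim x)
    show ?case using pw[OF elim(1)] elim(2) by simp
  qed
  moreover have "(\<integral>\<^sup>+x. W x \<partial>lborel) \<le> ennreal ((2 / s\<^sup>2 + 4 * (d $ 1)\<^sup>2 + 4 * (d $ 2)\<^sup>2) * (norm_H1 \<Omega> u)\<^sup>2)"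
  proof -
    let ?N = "(norm_H1 \<Omega> u)\<^sup>2"
    \<comment> \<open>Comes from (a + b)^2 \<le> 2 a^2 + 2 b^2, applied to the two terms of
      \<open>w\<close> and again to the two components of \<open>v\<close>; hence the factors 2 and
      4.\<close>
    define Q where "Q x = (2 / s\<^sup>2) * (cmod (g x))\<^sup>2 + (4 * (d $ 1)\<^sup>2 * (cmod (h 1 x))\<^sup>2 + 4 * (d $ 2)\<^sup>2 * (cmod (h 2 x))\<^sup>2)" for x
    have wQ: "(w x)\<^sup>2 \<le> Q x" for x
    proof -
      have sq: "(a + b)\<^sup>2 \<le> 2 * a\<^sup>2 + 2 * b\<^sup>2" for a b :: real
        using sum_squares_bound[of a b] by (simp add: power2_sum)
      have "cmod (v x) \<le> \<bar>d $ 1\<bar> * cmod (h 1 x) + \<bar>d $ 2\<bar> * cmod (h 2 x)"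
        unfolding v_def sum_2
        using norm_triangle_ineq[of "complex_of_real (d $ 1) * h 1 x" "complex_of_real (d $ 2) * h 2 x"]
        by (simp add: norm_mult)
      then have "(cmod (v x))\<^sup>2 \<le> (\<bar>d $ 1\<bar> * cmod (h 1 x) + \<bar>d $ 2\<bar> * cmod (h 2 x))\<^sup>2"
        by (rule power_mono) simp
      also have "\<dots> \<le> 2 * (\<bar>d $ 1\<bar> * cmod (h 1 x))\<^sup>2 + 2 * (\<bar>d $ 2\<bar> * cmod (h 2 x))\<^sup>2" by (rule sq)
      finally have "2 * (cmod (v x))\<^sup>2 \<le> 4 * (d $ 1)\<^sup>2 * (cmod (h 1 x))\<^sup>2 + 4 * (d $ 2)\<^sup>2 * (cmod (h 2 x))\<^sup>2"
        by (simp add: power_mult_distrib)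
      moreover have "(w x)\<^sup>2 \<le> 2 * (1 / s * cmod (g x))\<^sup>2 + 2 * (cmod (v x))\<^sup>2" unfolding w_def by (rule sq)
      moreover have "2 * (1 / s * cmod (g x))\<^sup>2 = (2 / s\<^sup>2) * (cmod (g x))\<^sup>2" by (simp add: power_divide)
      ultimately show ?thesis unfolding Q_def by linarith
    qed
    have "(\<integral>\<^sup>+x. W x \<partial>lborel) = (\<integral>\<^sup>+x. W x \<partial>L)"
      by (rule nn_integral_lebesgue_on_eq[OF open_\<Omega>, symmetric]) (simp add: W_def w_def g0 v0)
    also have "\<dots> \<le> (\<integral>\<^sup>+x. ennreal (Q x) \<partial>L)"
      unfolding W_def using wQ by (intro nn_integral_mono ennreal_leI)
    also have "\<dots> = ennreal (LINT x|L. Q x)"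
      unfolding Q_def
      by (intro nn_integral_eq_integral Bochner_Integration.integrable_add integrable_mult_right L2_integrable gL hL) simp
    also have "(LINT x|L. Q x) = (2 / s\<^sup>2) * (norm_L2 L g)\<^sup>2 + (4 * (d $ 1)\<^sup>2 * (norm_L2 L (h 1))\<^sup>2 + 4 * (d $ 2)\<^sup>2 * (norm_L2 L (h 2))\<^sup>2)"
      unfolding Q_def norm_L2_sq
      using L2_integrable[OF gL] L2_integrable[OF hL[of 1]] L2_integrable[OF hL[of 2]] by simp
    also have "norm_L2 L g = norm_L2 L u"
      by (intro norm_L2_cong_AE L2_measurable gL H1_L2 u AE_symmetric[OF gu])
    also have "norm_L2 L (h 1) = norm_L2 L (D 1 u)"
      by (intro norm_L2_cong_AE L2_measurable hL D_L2 u AE_symmetric[OF hu])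
    also have "norm_L2 L (h 2) = norm_L2 L (D 2 u)"
      by (intro norm_L2_cong_AE L2_measurable hL D_L2 u AE_symmetric[OF hu])
    also have "(2 / s\<^sup>2) * (norm_L2 L u)\<^sup>2 + (4 * (d $ 1)\<^sup>2 * (norm_L2 L (D 1 u))\<^sup>2 + 4 * (d $ 2)\<^sup>2 * (norm_L2 L (D 2 u))\<^sup>2)
        \<le> (2 / s\<^sup>2) * ?N + (4 * (d $ 1)\<^sup>2 * ?N + 4 * (d $ 2)\<^sup>2 * ?N)"
      by (intro add_mono mult_left_mono power_mono norm_L2_le_H1 norm_D_le_H1) auto
    also have "\<dots> = (2 / s\<^sup>2 + 4 * (d $ 1)\<^sup>2 + 4 * (d $ 2)\<^sup>2) * ?N" by (simp add: algebra_simps)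
    finally show ?thesis by (simp add: ennreal_leI)
  qed
  ultimately show ?thesis using W by blast
qed

text \<open>One factor |u|^2 is estimated along d, the other along e. The determinant
  \<open>\<Delta>\<close> enters the denominator, so this constant degenerates as the directions
  become parallel.\<close>

lemma local_L4_bound:
  assumes U: "open U" "U \<subseteq> \<Omega>" and s: "0 < s"
    and det: "d $ 1 * e $ 2 - d $ 2 * e $ 1 \<noteq> 0"
    and rays: "ray_set \<Omega> U s d" "ray_set \<Omega> U s e"
  shows "\<exists>C\<ge>0. \<forall>u\<in>H1 \<Omega>. (\<integral>\<^sup>+x. ennreal ((cmod (u x))^4) \<partial>lebesgue_on U) \<le> ennreal (C * (norm_H1 \<Omega> u)^4)"
proof -
  define K where "K d = 2 / s\<^sup>2 + 4 * (d $ 1)\<^sup>2 + 4 * (d $ 2)\<^sup>2" for d :: "real^2"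
  have K: "0 \<le> K d" for d by (simp add: K_def)
  define \<Delta> where "\<Delta> = \<bar>d $ 1 * e $ 2 - d $ 2 * e $ 1\<bar>"
  have \<Delta>: "0 < \<Delta>" using det by (simp add: \<Delta>_def)
  have "(\<integral>\<^sup>+x. ennreal ((cmod (u x))^4) \<partial>lebesgue_on U) \<le> ennreal (s\<^sup>2 / \<Delta> * K d * K e * (norm_H1 \<Omega> u)^4)"
    if u: "u \<in> H1 \<Omega>" for u
  proof -
    let ?N = "norm_H1 \<Omega> u"
    obtain V where V[measurable]: "V \<in> borel_measurable borel"
      and Vae: "AE x in lebesgue_on U. ennreal ((cmod (u x))\<^sup>2) \<le> ennreal s * (\<integral>\<^sup>+t. V (x + t *\<^sub>R d) \<partial>lborel)"
      and Vint: "(\<integral>\<^sup>+x. V x \<partial>lborel) \<le> ennreal (K d * ?N\<^sup>2)"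
      using square_bound_on_rays[OF U s rays(1) u] unfolding K_def by blast
    obtain W where W[measurable]: "W \<in> borel_measurable borel"
      and Wae: "AE x in lebesgue_on U. ennreal ((cmod (u x))\<^sup>2) \<le> ennreal s * (\<integral>\<^sup>+t. W (x + t *\<^sub>R e) \<partial>lborel)"
      and Wint: "(\<integral>\<^sup>+x. W x \<partial>lborel) \<le> ennreal (K e * ?N\<^sup>2)"
      using square_bound_on_rays[OF U s rays(2) u] unfolding K_def by blast
    let ?P = "\<lambda>x. (\<integral>\<^sup>+t. V (x + t *\<^sub>R d) \<partial>lborel) * (\<integral>\<^sup>+t. W (x + t *\<^sub>R e) \<partial>lborel)"
    have "(\<integral>\<^sup>+x. ennreal ((cmod (u x))^4) \<partial>lebesgue_on U) \<le> (\<integral>\<^sup>+x. ennreal (s\<^sup>2) * ?P x \<partial>lebesgue_on U)"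
    proof (rule nn_integral_mono_AE)
      show "AE x in lebesgue_on U. ennreal ((cmod (u x))^4) \<le> ennreal (s\<^sup>2) * ?P x"
        using Vae Wae
      proof eventually_elim
        case (elim x)
        have "ennreal ((cmod (u x))^4) = ennreal ((cmod (u x))\<^sup>2) * ennreal ((cmod (u x))\<^sup>2)"
          by (simp add: ennreal_mult[symmetric] power2_eq_square power4_eq_xxxx mult.assoc)
        also have "\<dots> \<le> (ennreal s * (\<integral>\<^sup>+t. V (x + t *\<^sub>R d) \<partial>lborel)) * (ennreal s * (\<integral>\<^sup>+t. W (x + t *\<^sub>R e) \<partial>lborel))"
          using elim by (intro mult_mono) auto
        also have "\<dots> = ennreal (s\<^sup>2) * ?P x"
          using s by (simp add: power2_eq_square ennreal_mult mult_ac)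
        finally show ?case .
      qed
    qed
    also have "\<dots> \<le> (\<integral>\<^sup>+x. ennreal (s\<^sup>2) * ?P x \<partial>lborel)" by (rule nn_integral_lebesgue_on_le[OF U(1)])
    also have "\<dots> = ennreal (s\<^sup>2) * (\<integral>\<^sup>+x. ?P x \<partial>lborel)" by (rule nn_integral_cmult) measurable
    also have "\<dots> = ennreal (s\<^sup>2 / \<Delta>) * (ennreal \<Delta> * (\<integral>\<^sup>+x. ?P x \<partial>lborel))"
      using \<Delta> by (simp add: mult.assoc[symmetric] ennreal_mult[symmetric])
    also have "ennreal \<Delta> * (\<integral>\<^sup>+x. ?P x \<partial>lborel) = (\<integral>\<^sup>+x. V x \<partial>lborel) * (\<integral>\<^sup>+x. W x \<partial>lborel)"
      unfolding \<Delta>_def by (rule loomis_whitney_oblique[OF V W det])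
    also have "ennreal (s\<^sup>2 / \<Delta>) * \<dots> \<le> ennreal (s\<^sup>2 / \<Delta>) * (ennreal (K d * ?N\<^sup>2) * ennreal (K e * ?N\<^sup>2))"
      using Vint Wint by (intro mult_mono) auto
    also have "\<dots> = ennreal (s\<^sup>2 / \<Delta> * ((K d * ?N\<^sup>2) * (K e * ?N\<^sup>2)))"
      using K \<Delta> by (subst ennreal_mult[symmetric], simp, simp, subst ennreal_mult[symmetric]) auto
    also have "s\<^sup>2 / \<Delta> * ((K d * ?N\<^sup>2) * (K e * ?N\<^sup>2)) = s\<^sup>2 / \<Delta> * K d * K e * ?N^4"
      by (simp add: power2_eq_square power4_eq_xxxx)
    finally show ?thesis .
  qed
  then show ?thesis using K \<Delta> by (intro exI[of _ "s\<^sup>2 / \<Delta> * K d * K e"]) auto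
qed

text \<open>Compactness of the closure leaves finitely many balls. The integral over the domain is
  at most the sum of the local ones, so the local constants simply add up.\<close>

lemma L4_embedding:
  assumes "C1_domain \<Omega>"
  shows "\<exists>C\<ge>0. \<forall>u\<in>H1 \<Omega>. (\<integral>\<^sup>+x. ennreal ((cmod (u x))^4) \<partial>L) \<le> ennreal (C * (norm_H1 \<Omega> u)^4)"
proof -
  have "\<exists>r>0. \<exists>C\<ge>0. \<forall>u\<in>H1 \<Omega>. (\<integral>\<^sup>+x. ennreal ((cmod (u x))^4) \<partial>lebesgue_on (\<Omega> \<inter> ball x0 r)) \<le> ennreal (C * (norm_H1 \<Omega> u)^4)"
    if x0: "x0 \<in> closure \<Omega>" for x0
  proof -
    obtain r s d e where r: "r > 0" and s: "s > 0" and det: "d $ 1 * e $ 2 - d $ 2 * e $ 1 \<noteq> 0"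
      and rays: "ray_set \<Omega> (\<Omega> \<inter> ball x0 r) s d" "ray_set \<Omega> (\<Omega> \<inter> ball x0 r) s e"
      using C1_domain_rays[OF assms x0] by blast
    have "open (\<Omega> \<inter> ball x0 r)" using open_\<Omega> by blast
    from local_L4_bound[OF this _ s det rays] r show ?thesis by blast
  qed
  then have "\<forall>x0\<in>closure \<Omega>. \<exists>r. r > 0 \<and> (\<exists>C\<ge>0. \<forall>u\<in>H1 \<Omega>. (\<integral>\<^sup>+x. ennreal ((cmod (u x))^4) \<partial>lebesgue_on (\<Omega> \<inter> ball x0 r)) \<le> ennreal (C * (norm_H1 \<Omega> u)^4))"
    by blast
  from bchoice[OF this] obtain r where r: "\<And>x0. x0 \<in> closure \<Omega> \<Longrightarrow> r x0 > 0"
    and "\<forall>x0\<in>closure \<Omega>. \<exists>C. C \<ge> 0 \<and> (\<forall>u\<in>H1 \<Omega>. (\<integral>\<^sup>+x. ennreal ((cmod (u x))^4) \<partial>lebesgue_on (\<Omega> \<inter> ball x0 (r x0))) \<le> ennreal (C * (norm_H1 \<Omega> u)^4))"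
    by blast
  from bchoice[OF this(2)] obtain C where C: "\<And>x0. x0 \<in> closure \<Omega> \<Longrightarrow> C x0 \<ge> 0"
    "\<And>x0 u. x0 \<in> closure \<Omega> \<Longrightarrow> u \<in> H1 \<Omega> \<Longrightarrow>
      (\<integral>\<^sup>+x. ennreal ((cmod (u x))^4) \<partial>lebesgue_on (\<Omega> \<inter> ball x0 (r x0))) \<le> ennreal (C x0 * (norm_H1 \<Omega> u)^4)"
    by blast
  have cover: "closure \<Omega> \<subseteq> (\<Union>x\<in>closure \<Omega>. ball x (r x))" using r by force
  have "compact (closure \<Omega>)" using bounded_\<Omega> by (simp add: compact_closure)
  then obtain F where F: "F \<subseteq> closure \<Omega>" "finite F" "closure \<Omega> \<subseteq> (\<Union>x\<in>F. ball x (r x))"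
    by (rule compactE_image[OF _ open_ball cover])
  have "(\<integral>\<^sup>+x. ennreal ((cmod (u x))^4) \<partial>L) \<le> ennreal ((\<Sum>x0\<in>F. C x0) * (norm_H1 \<Omega> u)^4)" if u: "u \<in> H1 \<Omega>" for u
  proof -
    let ?f = "\<lambda>x. ennreal ((cmod (u x))^4)"
    have um: "u \<in> borel_measurable L" by (rule L2_measurable[OF H1_L2[OF u]])
    have fm: "?f \<in> borel_measurable L" using um by measurable
    have iL: "(\<lambda>x. indicator (ball x0 (r x0)) x :: ennreal) \<in> borel_measurable L" for x0
      by (intro borel_measurable_lebesgue_on borel_measurable_indicator) simp
    have "(\<integral>\<^sup>+x. ?f x \<partial>L) \<le> (\<integral>\<^sup>+x. (\<Sum>x0\<in>F. ?f x * indicator (ball x0 (r x0)) x) \<partial>L)"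
    proof (rule nn_integral_mono)
      fix x assume "x \<in> space L"
      then have "x \<in> closure \<Omega>" using closure_subset by auto
      then obtain x0 where x0: "x0 \<in> F" "x \<in> ball x0 (r x0)" using F(3) by blast
      then have "?f x = ?f x * indicator (ball x0 (r x0)) x" by simp
      also have "\<dots> \<le> (\<Sum>x0\<in>F. ?f x * indicator (ball x0 (r x0)) x)"
        by (rule member_le_sum[OF x0(1)]) (auto simp: F(2))
      finally show "?f x \<le> (\<Sum>x0\<in>F. ?f x * indicator (ball x0 (r x0)) x)" .
    qed
    also have "\<dots> = (\<Sum>x0\<in>F. \<integral>\<^sup>+x. ?f x * indicator (ball x0 (r x0)) x \<partial>L)"
      by (intro nn_integral_sum borel_measurable_times_ennreal fm iL)
    also have "\<dots> \<le> (\<Sum>x0\<in>F. ennreal (C x0 * (norm_H1 \<Omega> u)^4))"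
    proof (rule sum_mono)
      fix x0 assume "x0 \<in> F"
      then have x0: "x0 \<in> closure \<Omega>" using F(1) by blast
      have "(\<integral>\<^sup>+x. ?f x * indicator (ball x0 (r x0)) x \<partial>L) = (\<integral>\<^sup>+x. ?f x * indicator (ball x0 (r x0)) x * indicator \<Omega> x \<partial>lebesgue)"
        using sets_\<Omega> by (subst nn_integral_restrict_space) auto
      also have "\<dots> = (\<integral>\<^sup>+x. ?f x * indicator (\<Omega> \<inter> ball x0 (r x0)) x \<partial>lebesgue)"
        by (intro nn_integral_cong) (auto split: split_indicator)
      also have "\<dots> = (\<integral>\<^sup>+x. ?f x \<partial>lebesgue_on (\<Omega> \<inter> ball x0 (r x0)))"
        using sets_\<Omega> by (subst nn_integral_restrict_space) auto
      finally show "(\<integral>\<^sup>+x. ?f x * indicator (ball x0 (r x0)) x \<partial>L) \<le> ennreal (C x0 * (norm_H1 \<Omega> u)^4)"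
        using C(2)[OF x0 u] by simp
    qed
    also have "\<dots> = ennreal ((\<Sum>x0\<in>F. C x0) * (norm_H1 \<Omega> u)^4)"
      using C(1) F(1) by (subst sum_ennreal) (auto simp: sum_distrib_right)
    finally show ?thesis .
  qed
  moreover have "0 \<le> (\<Sum>x0\<in>F. C x0)" using C(1) F(1) by (intro sum_nonneg) auto
  ultimately show ?thesis by blast
qed

end

text \<open>For finite p the majorant is 1 + |q|^p, where the constant 1 is integrable because the
  measure is finite; for p = \<infinity> it is the square of an essential bound.\<close>

lemma Lp_real_imp_square_integrable:
  assumes M: "finite_measure M" and q: "q \<in> Lp_real M p" and p: "2 < p"
  shows "integrable M (\<lambda>x. (q x)\<^sup>2)"
proof (cases "p = \<infinity>")
  case True
  interpret finite_measure M by fact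
  from q True obtain C where [measurable]: "q \<in> borel_measurable M" and C: "AE x in M. \<bar>q x\<bar> \<le> C"
    by (auto simp: Lp_real_def)
  show ?thesis
  proof (rule integrable_const_bound[where B="C\<^sup>2"])
    show "AE x in M. norm ((q x)\<^sup>2) \<le> C\<^sup>2"
      using C
    proof eventually_elim
      case (elim x)
      then have "\<bar>q x\<bar>\<^sup>2 \<le> C\<^sup>2" by (intro power_mono) auto
      then show ?case by simp
    qed
  qed measurable
next
  case False
  interpret finite_measure M by fact
  from q False have [measurable]: "q \<in> borel_measurable M"
    and int: "integrable M (\<lambda>x. \<bar>q x\<bar> powr enn2real p)"
    by (auto simp: Lp_real_def)
  have p2: "2 < enn2real p"
  proof (cases p)
    case (real r)
    then have "ennreal 2 < ennreal r" using p by simp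
    then show ?thesis using real by (subst (asm) ennreal_less_iff) auto
  qed (use False in simp)
  show ?thesis
  proof (rule Bochner_Integration.integrable_bound)
    show "integrable M (\<lambda>x. 1 + \<bar>q x\<bar> powr enn2real p)" using int by simp
    show "AE x in M. norm ((q x)\<^sup>2) \<le> norm (1 + \<bar>q x\<bar> powr enn2real p)"
    proof (intro AE_I2)
      fix x
      have "\<bar>q x\<bar>\<^sup>2 \<le> 1 + \<bar>q x\<bar> powr enn2real p"
      proof (cases "\<bar>q x\<bar> \<le> 1")
        case True
        then have "\<bar>q x\<bar>\<^sup>2 \<le> 1" by (simp only: power_le_one abs_ge_zero)
        then show ?thesis by (simp add: add_increasing2)
      next
        case False
        then have "\<bar>q x\<bar>\<^sup>2 = \<bar>q x\<bar> powr 2" by simp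
        also have "\<dots> \<le> \<bar>q x\<bar> powr enn2real p" using False p2 by (intro powr_mono) auto
        finally show ?thesis by simp
      qed
      then show "norm ((q x)\<^sup>2) \<le> norm (1 + \<bar>q x\<bar> powr enn2real p)" by simp
    qed
  qed measurable
qed

text \<open>An infinite \<open>Y\<close> is excluded because its square would be infinite.\<close>

lemma ennreal_le_of_power2_le:
  assumes "Y\<^sup>2 \<le> ennreal (a\<^sup>2)" "0 \<le> a"
  shows "Y \<le> ennreal a"
proof (cases Y)
  case (real y)
  then have "ennreal (y\<^sup>2) \<le> ennreal (a\<^sup>2)" using assms(1) by (simp add: ennreal_power)
  then have "y\<^sup>2 \<le> a\<^sup>2" by simp
  then have "y \<le> a" using assms(2) by (rule power2_le_imp_le)
  then show ?thesis using real by (simp add: ennreal_leI)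
next
  case top
  then show ?thesis using assms(1) by (simp add: ennreal_top_eq_mult_iff power2_eq_square top_unique)
qed

context bounded_open
begin

text \<open>Cauchy-Schwarz twice: |q| against |u phi|, then |u|^2 against |phi|^2. Working with
  extended nonnegative integrals lets integrability and the bound come out of one estimate.\<close>

lemma weighted_product_bound:
  assumes q[measurable]: "q \<in> borel_measurable L" and q2: "integrable L (\<lambda>x. (q x)\<^sup>2)"
    and C: "0 \<le> C" "\<And>u. u \<in> H1 \<Omega> \<Longrightarrow> (\<integral>\<^sup>+x. ennreal ((cmod (u x))^4) \<partial>L) \<le> ennreal (C * (norm_H1 \<Omega> u)^4)"
    and u: "u \<in> H1 \<Omega>" and \<phi>: "\<phi> \<in> H1 \<Omega>"
  shows "integrable L (\<lambda>x. complex_of_real (q x) * u x * cnj (\<phi> x))"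
    and "cmod (M_op \<Omega> q u \<phi>) \<le> sqrt (LINT x|L. (q x)\<^sup>2) * sqrt C * norm_H1 \<Omega> u * norm_H1 \<Omega> \<phi>"
proof -
  have [measurable]: "u \<in> borel_measurable L" "\<phi> \<in> borel_measurable L"
    by (intro L2_measurable H1_L2 u \<phi>)+
  let ?f = "\<lambda>x. complex_of_real (q x) * u x * cnj (\<phi> x)"
  let ?n = "norm_H1 \<Omega> u" and ?m = "norm_H1 \<Omega> \<phi>"
  let ?Q = "sqrt (LINT x|L. (q x)\<^sup>2)"
  have nm: "0 \<le> ?n" "0 \<le> ?m" using order_trans[OF norm_L2_nonneg norm_L2_le_H1] by blast+
  have Q0: "0 \<le> (LINT x|L. (q x)\<^sup>2)" by simp
  have 1: "(\<integral>\<^sup>+x. (ennreal (cmod (u x) * cmod (\<phi> x)))\<^sup>2 \<partial>L) \<le> ennreal (C * ?n\<^sup>2 * ?m\<^sup>2)"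
  proof (rule ennreal_le_of_power2_le)
    have "(\<integral>\<^sup>+x. (ennreal (cmod (u x) * cmod (\<phi> x)))\<^sup>2 \<partial>L) = (\<integral>\<^sup>+x. ennreal ((cmod (u x))\<^sup>2) * ennreal ((cmod (\<phi> x))\<^sup>2) \<partial>L)"
      by (simp add: ennreal_power ennreal_mult[symmetric] power_mult_distrib)
    then have "(\<integral>\<^sup>+x. (ennreal (cmod (u x) * cmod (\<phi> x)))\<^sup>2 \<partial>L)\<^sup>2
        = (\<integral>\<^sup>+x. ennreal ((cmod (u x))\<^sup>2) * ennreal ((cmod (\<phi> x))\<^sup>2) \<partial>L)\<^sup>2" by (simp only:)
    also have "\<dots> \<le> (\<integral>\<^sup>+x. (ennreal ((cmod (u x))\<^sup>2))\<^sup>2 \<partial>L) * (\<integral>\<^sup>+x. (ennreal ((cmod (\<phi> x))\<^sup>2))\<^sup>2 \<partial>L)"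
      by (rule Cauchy_Schwarz_nn_integral) measurable
    also have "\<dots> = (\<integral>\<^sup>+x. ennreal ((cmod (u x))^4) \<partial>L) * (\<integral>\<^sup>+x. ennreal ((cmod (\<phi> x))^4) \<partial>L)"
      by (simp add: ennreal_power)
    also have "\<dots> \<le> ennreal (C * ?n^4) * ennreal (C * ?m^4)"
      using C(2)[OF u] C(2)[OF \<phi>] by (intro mult_mono) auto
    also have "\<dots> = ennreal ((C * ?n^4) * (C * ?m^4))"
      using C(1) by (intro ennreal_mult[symmetric]) auto
    also have "(C * ?n^4) * (C * ?m^4) = (C * ?n\<^sup>2 * ?m\<^sup>2)\<^sup>2"
      by (simp add: power2_eq_square power4_eq_xxxx)
    finally show "(\<integral>\<^sup>+x. (ennreal (cmod (u x) * cmod (\<phi> x)))\<^sup>2 \<partial>L)\<^sup>2 \<le> ennreal ((C * ?n\<^sup>2 * ?m\<^sup>2)\<^sup>2)" .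
  qed (use C(1) in simp)
  have 2: "(\<integral>\<^sup>+x. ennreal (cmod (?f x)) \<partial>L) \<le> ennreal (?Q * sqrt C * ?n * ?m)"
  proof (rule ennreal_le_of_power2_le)
    have "(\<integral>\<^sup>+x. ennreal (cmod (?f x)) \<partial>L)\<^sup>2 = (\<integral>\<^sup>+x. ennreal \<bar>q x\<bar> * ennreal (cmod (u x) * cmod (\<phi> x)) \<partial>L)\<^sup>2"
      by (simp add: ennreal_mult[symmetric] norm_mult mult.assoc)
    also have "\<dots> \<le> (\<integral>\<^sup>+x. (ennreal \<bar>q x\<bar>)\<^sup>2 \<partial>L) * (\<integral>\<^sup>+x. (ennreal (cmod (u x) * cmod (\<phi> x)))\<^sup>2 \<partial>L)"
      by (rule Cauchy_Schwarz_nn_integral) measurable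
    also have "(\<integral>\<^sup>+x. (ennreal \<bar>q x\<bar>)\<^sup>2 \<partial>L) = ennreal (LINT x|L. (q x)\<^sup>2)"
      using q2 by (simp add: ennreal_power nn_integral_eq_integral)
    also have "\<dots> * (\<integral>\<^sup>+x. (ennreal (cmod (u x) * cmod (\<phi> x)))\<^sup>2 \<partial>L) \<le> ennreal (LINT x|L. (q x)\<^sup>2) * ennreal (C * ?n\<^sup>2 * ?m\<^sup>2)"
      by (rule mult_left_mono[OF 1]) simp
    also have "\<dots> = ennreal ((LINT x|L. (q x)\<^sup>2) * (C * ?n\<^sup>2 * ?m\<^sup>2))"
      using C(1) by (intro ennreal_mult[symmetric]) auto
    also have "(LINT x|L. (q x)\<^sup>2) * (C * ?n\<^sup>2 * ?m\<^sup>2) = (?Q * sqrt C * ?n * ?m)\<^sup>2"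
      using C(1) Q0 by (simp only: power_mult_distrib real_sqrt_pow2 mult.assoc)
    finally show "(\<integral>\<^sup>+x. ennreal (cmod (?f x)) \<partial>L)\<^sup>2 \<le> ennreal ((?Q * sqrt C * ?n * ?m)\<^sup>2)" .
  qed (intro mult_nonneg_nonneg nm real_sqrt_ge_zero C(1) Q0)
  show "integrable L ?f"
  proof (rule integrableI_bounded)
    show "?f \<in> borel_measurable L" by measurable
    show "(\<integral>\<^sup>+x. ennreal (norm (?f x)) \<partial>L) < \<infinity>" using 2 by (rule le_less_trans) simp
  qed
  have "ennreal (cmod (M_op \<Omega> q u \<phi>)) \<le> (\<integral>\<^sup>+x. ennreal (cmod (?f x)) \<partial>L)"
    unfolding M_op_def inner_L2_def by (rule norm_integral_le_nn_integral)
  also note 2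
  finally show "cmod (M_op \<Omega> q u \<phi>) \<le> ?Q * sqrt C * ?n * ?m"
    by (subst (asm) ennreal_le_iff) (intro mult_nonneg_nonneg nm real_sqrt_ge_zero C(1) Q0)
qed

end

section \<open>Equivalence of the two problems\<close>

theorem corollary3p3:
  fixes \<Omega> :: "(real^2) set"
    and T :: "(real^2 \<Rightarrow> complex) \<Rightarrow> real^2 \<Rightarrow> complex"
    and p :: ennreal
    and k :: real
    and f :: "(real^2 \<Rightarrow> complex) \<Rightarrow> complex"
    and q :: "real^2 \<Rightarrow> real"
    and u :: "real^2 \<Rightarrow> complex"
  assumes "C1_domain \<Omega>"
    and "trace_operator \<Omega> T"
    and "compact_embedding_H2_H1 \<Omega>"
    and "helmholtz_regularity \<Omega> T"
    and "2 < p"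
    and "0 < k"
    and "f \<in> antidual_H1 \<Omega>"
    and "q \<in> Lp_real (lebesgue_on \<Omega>) p"
    and "AE x in lebesgue_on \<Omega>. -1 \<le> q x"
  shows "unique_solution_H1 \<Omega>
           (\<lambda>u. eq_H1 \<Omega> (\<lambda>x. u x - (complex_of_real k)\<^sup>2 * V_op \<Omega> T k q u x) (helmholtz_inv \<Omega> T k f)) u
         \<longleftrightarrow>
         unique_solution_H1 \<Omega>
           (\<lambda>u. eq_antidual_H1 \<Omega> (helmholtz_op \<Omega> T k (\<lambda>x. 1 + q x) u) f) u"
proof -
  interpret helmholtz_domain \<Omega> T k
    by unfold_locales (use assms in \<open>auto simp: C1_domain_def\<close>)
  have q: "q \<in> borel_measurable L" using assms(8) by (simp add: Lp_real_def)
  have q2: "integrable L (\<lambda>x. (q x)\<^sup>2)"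
    by (rule Lp_real_imp_square_integrable[OF finite_L assms(8,5)])
  obtain C where C: "0 \<le> C"
    "\<And>u. u \<in> H1 \<Omega> \<Longrightarrow> (\<integral>\<^sup>+x. ennreal ((cmod (u x))^4) \<partial>L) \<le> ennreal (C * (norm_H1 \<Omega> u)^4)"
    using L4_embedding[OF assms(1)] by blast
  note bound = weighted_product_bound[OF q q2 C]
  \<comment> \<open>Holds for every v in H^1, so the two solution sets coincide and the uniqueness
    clauses match too.\<close>
  have "eq_H1 \<Omega> (\<lambda>x. v x - (complex_of_real k)\<^sup>2 * V_op \<Omega> T k q v x) (helmholtz_inv \<Omega> T k f) \<longleftrightarrow>
      eq_antidual_H1 \<Omega> (helmholtz_op \<Omega> T k (\<lambda>x. 1 + q x) v) f" if "v \<in> H1 \<Omega>" for v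
    using bound(2) by (intro solution_equivalence[OF assms(7) bound(1) _ that]) blast+
  then show ?thesis unfolding unique_solution_H1_def by blast
qed

end
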